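(* Let $H$ be a separable Hilbert space, let $a>0$, $b\ge0$, $d\ge0$, $\alpha\in[0,1)$, and let $(A,B)$ be a pair of linear operators on $H$ such that: $A$ is skew-adjoint with domain $D(A)$; $\mathrm{i}A$ is bounded from below; $B$ is skew-symmetric; $\|B\psi\|\le a\|A\psi\|+b\|\psi\|$ for every $\psi\in D(A)$; and $\|B\psi\|\le d\,\||A|^\alpha\psi\|$ for every $\psi\in D(|A|^\alpha)$. Assume moreover that $\Phi=(\phi_j)_{j\in\mathbf{N}}$ is a Hilbert basis of $H$ and that $A$ has discrete spectrum $(-\mathrm{i}\lambda_j)_{j\in\mathbf{N}}$ with $\lambda_j\to+\infty$ as $j\to\infty$ and $A\phi_j=-\mathrm{i}\lambda_j\phi_j$ for every $j\in\mathbf{N}$. Let $\delta\in(0,1)$. Then for every $\varepsilon>0$, $K\ge0$, $n\in\mathbf{N}$ and $(\psi_j)_{1\le j\le n}$ in $D(|A|)^n$, there exists $N\in\mathbf{N}$ such that for every $L^1$ function $u$ in $\mathcal{U}_{\delta,a}$, $$\|u\|_{L^1}+TV_{\mathbf{R}}(u)<K\ \Longrightarrow\ \|\Upsilon^u_t\psi_j-X^u_{(\Phi,N)}(t,0)\,\pi^\Phi_N\psi_j\|<\varepsilon$$ for every $t\ge0$ and every $j=1,\dots,n$.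
   Context: $\pi^\Phi_N\psi:=\sum_{j\le N}\langle\phi_j,\psi\rangle\phi_j$ is the orthogonal projection on the span of the $\phi_j$, $j\le N$. The Galerkin approximation of order $N$ is the finite-dimensional system $\dot x=(A^{(\Phi,N)}+u(t)B^{(\Phi,N)})x$, where $A^{(\Phi,N)}=\pi^\Phi_NA_{\upharpoonright\mathrm{Im}\,\pi^\Phi_N}$ and $B^{(\Phi,N)}=\pi^\Phi_NB_{\upharpoonright\mathrm{Im}\,\pi^\Phi_N}$ are the compressions of $A$ and $B$; for $u\in L^1$, $X^u_{(\Phi,N)}(t,s)$ denotes its propagator from time $s$ to time $t$. $\mathcal{U}_{\delta,a}$ is the set of functions $u:\mathbf{R}\to\left(-\frac{1-\delta}{a},\frac{1-\delta}{a}\right)$ of bounded variation on $\mathbf{R}$ with $u(t)=0$ for all $t\le 0$; $TV_I(u)$ denotes the total variation of $u$ on the interval $I$. For real $v$ with $|v|<1/a$, by the Kato-Rellich theorem $A+vB$ is skew-adjoint with domain $D(A)$ and generates a unitary group. For a piecewise constant control $u$ taking successively the values $v_1,\dots,v_p$ on intervals of lengths $t_1,\dots,t_p\ge0$ with $t_1+\dots+t_p=t$, the propagator of $\frac{\mathrm{d}\psi}{\mathrm{d}t}=(A+u(t)B)\psi$ is $\Upsilon^u_{t}=e^{t_p(A+v_pB)}\cdots e^{t_1(A+v_1B)}$. For general $u\in\mathcal{U}_{\delta,a}$ and $t\in[0,T]$, $\Upsilon^u_{t}$ is the strong limit in $H$ of $\Upsilon^{u_n}_{t}$, where $(u_n)_n$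 is any sequence of piecewise constant functions in $\mathcal{U}_{\delta,a}$ converging pointwise to $u$ with $TV_{[0,T]}(u_n)\le TV_{[0,T]}(u)$ for all $n$; such sequences exist, and the limit exists and does not depend on the sequence. *)

theory Defs
  imports "HOL-Analysis.Analysis"
begin

text \<open>The inner product is antilinear in its first and linear in its second argument.
  Positive definiteness is inherited from the norm through the last axiom.\<close>

class complex_hilbert_space = banach +
  fixes scaleC :: "complex \<Rightarrow> 'a \<Rightarrow> 'a"  (infixr \<open>*\<^sub>C\<close> 75)
    and cinner :: "'a \<Rightarrow> 'a \<Rightarrow> complex"
  assumes scaleC_add_right: "z *\<^sub>C (x + y) = z *\<^sub>C x + z *\<^sub>C y"
    and scaleC_add_left: "(z + w) *\<^sub>C x = z *\<^sub>C x + w *\<^sub>C x"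
    and scaleC_scaleC: "z *\<^sub>C (w *\<^sub>C x) = (z * w) *\<^sub>C x"
    and scaleC_of_real: "complex_of_real r *\<^sub>C x = r *\<^sub>R x"
    and cinner_commute: "cinner x y = cnj (cinner y x)"
    and cinner_add_right: "cinner x (y + y') = cinner x y + cinner x y'"
    and cinner_scaleC_right: "cinner x (z *\<^sub>C y) = z * cinner x y"
    and cinner_same: "cinner x x = complex_of_real ((norm x)\<^sup>2)"

interpretation cvs: vector_space "scaleC :: complex \<Rightarrow> 'a \<Rightarrow> 'a::complex_hilbert_space"
proof
  fix z w :: complex and x y :: 'a
  show "z *\<^sub>C (x + y) = z *\<^sub>C x + z *\<^sub>C y" by (rule scaleC_add_right)
  show "(z + w) *\<^sub>C x = z *\<^sub>C x + w *\<^sub>C x" by (rule scaleC_add_left)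
  show "z *\<^sub>C (w *\<^sub>C x) = (z * w) *\<^sub>C x" by (rule scaleC_scaleC)
  show "1 *\<^sub>C x = x" using scaleC_of_real[of 1 x] by simp
qed

definition hilbert_basis :: "(nat \<Rightarrow> 'a::complex_hilbert_space) \<Rightarrow> bool" where
  "hilbert_basis \<phi> \<longleftrightarrow>
     (\<forall>i j. cinner (\<phi> i) (\<phi> j) = (if i = j then 1 else 0)) \<and>
     closure (cvs.span (range \<phi>)) = UNIV"

text \<open>An operator is given by its domain \<open>D\<close> and a function \<open>T\<close> whose values outside \<open>D\<close>
  are irrelevant.\<close>

definition linear_operator ::
    "'a::complex_hilbert_space set \<Rightarrow> ('a \<Rightarrow> 'a) \<Rightarrow> bool" where
  "linear_operator D T \<longleftrightarrow> cvs.subspace D \<and>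
     (\<forall>x\<in>D. \<forall>y\<in>D. T (x + y) = T x + T y) \<and> (\<forall>z. \<forall>x\<in>D. T (z *\<^sub>C x) = z *\<^sub>C T x)"

definition adjoint_dom ::
    "'a::complex_hilbert_space set \<Rightarrow> ('a \<Rightarrow> 'a) \<Rightarrow> 'a set" where
  "adjoint_dom D T = {y. \<exists>z. \<forall>x\<in>D. cinner y (T x) = cinner z x}"

definition adjoint_op ::
    "'a::complex_hilbert_space set \<Rightarrow> ('a \<Rightarrow> 'a) \<Rightarrow> 'a \<Rightarrow> 'a" where
  "adjoint_op D T y = (THE z. \<forall>x\<in>D. cinner y (T x) = cinner z x)"

definition skew_adjoint ::
    "'a::complex_hilbert_space set \<Rightarrow> ('a \<Rightarrow> 'a) \<Rightarrow> bool" where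
  "skew_adjoint D T \<longleftrightarrow> linear_operator D T \<and> closure D = UNIV \<and>
     adjoint_dom D T = D \<and> (\<forall>x\<in>D. adjoint_op D T x = - T x)"

definition skew_symmetric ::
    "'a::complex_hilbert_space set \<Rightarrow> ('a \<Rightarrow> 'a) \<Rightarrow> bool" where
  "skew_symmetric D T \<longleftrightarrow> linear_operator D T \<and> closure D = UNIV \<and>
     (\<forall>x\<in>D. \<forall>y\<in>D. cinner (T x) y = - cinner x (T y))"

definition bounded_from_below ::
    "'a::complex_hilbert_space set \<Rightarrow> ('a \<Rightarrow> 'a) \<Rightarrow> bool" where
  "bounded_from_below D T \<longleftrightarrow>
     (\<exists>c. \<forall>x\<in>D. cinner x (T x) \<in> \<real> \<and> c * (norm x)\<^sup>2 \<le> Re (cinner x (T x)))"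

definition op_spectrum ::
    "'a::complex_hilbert_space set \<Rightarrow> ('a \<Rightarrow> 'a) \<Rightarrow> complex set" where
  "op_spectrum D T = {z. \<not> (bij_betw (\<lambda>x. T x - z *\<^sub>C x) D UNIV \<and>
     (\<exists>c. \<forall>x\<in>D. norm x \<le> c * norm (T x - z *\<^sub>C x)))}"

text \<open>Functional calculus: if \<open>T \<phi>\<^sub>j = \<mu>\<^sub>j \<phi>\<^sub>j\<close> for a Hilbert basis \<open>\<phi>\<close>, then \<open>f(T)\<close> is the
  operator which is diagonal in \<open>\<phi>\<close> with entries \<open>f(\<mu>\<^sub>j)\<close>, on its maximal domain.\<close>

definition diag_dom ::
    "(nat \<Rightarrow> 'a::complex_hilbert_space) \<Rightarrow> (nat \<Rightarrow> complex) \<Rightarrow> 'a set" where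
  "diag_dom \<phi> m = {x. summable (\<lambda>j. (cmod (m j * cinner (\<phi> j) x))\<^sup>2)}"

definition diag_op ::
    "(nat \<Rightarrow> 'a::complex_hilbert_space) \<Rightarrow> (nat \<Rightarrow> complex) \<Rightarrow> 'a \<Rightarrow> 'a" where
  "diag_op \<phi> m x = (\<Sum>j. (m j * cinner (\<phi> j) x) *\<^sub>C \<phi> j)"

text \<open>Entries of \<open>|A|\<^sup>\<alpha>\<close> when \<open>A \<phi>\<^sub>j = -\<i> \<lambda>\<^sub>j \<phi>\<^sub>j\<close>. The case distinction makes \<open>|A|\<^sup>0\<close> the
  identity even if \<open>\<lambda>\<^sub>j = 0\<close>, because \<open>0 powr 0 = 0\<close>.\<close>

definition abs_pow_entry :: "(nat \<Rightarrow> real) \<Rightarrow> real \<Rightarrow> nat \<Rightarrow> complex" where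
  "abs_pow_entry lam \<alpha> j = (if \<alpha> = 0 then 1 else complex_of_real (\<bar>lam j\<bar> powr \<alpha>))"

abbreviation abs_pow_dom where
  "abs_pow_dom \<phi> lam \<alpha> \<equiv> diag_dom \<phi> (abs_pow_entry lam \<alpha>)"

abbreviation abs_pow where
  "abs_pow \<phi> lam \<alpha> \<equiv> diag_op \<phi> (abs_pow_entry lam \<alpha>)"

definition unitary_group :: "(real \<Rightarrow> 'a::complex_hilbert_space \<Rightarrow> 'a) \<Rightarrow> bool" where
  "unitary_group U \<longleftrightarrow>
     (\<forall>t. linear_operator UNIV (U t) \<and> surj (U t) \<and>
       (\<forall>x y. cinner (U t x) (U t y) = cinner x y)) \<and>
     U 0 = id \<and> (\<forall>s t. U (s + t) = U s \<circ> U t) \<and>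
     (\<forall>x. continuous_on UNIV (\<lambda>t. U t x))"

definition has_generator ::
    "(real \<Rightarrow> 'a::complex_hilbert_space \<Rightarrow> 'a) \<Rightarrow> 'a set \<Rightarrow> ('a \<Rightarrow> 'a) \<Rightarrow> bool" where
  "has_generator U D T \<longleftrightarrow>
     D = {x. \<exists>y. ((\<lambda>h. (U h x - x) /\<^sub>R h) \<longlongrightarrow> y) (at 0)} \<and>
     (\<forall>x\<in>D. ((\<lambda>h. (U h x - x) /\<^sub>R h) \<longlongrightarrow> T x) (at 0))"

definition exp_group ::
    "'a::complex_hilbert_space set \<Rightarrow> ('a \<Rightarrow> 'a) \<Rightarrow> real \<Rightarrow> 'a \<Rightarrow> 'a" where
  "exp_group D T = (THE U. unitary_group U \<and> has_generator U D T)"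

definition total_variation :: "real set \<Rightarrow> (real \<Rightarrow> real) \<Rightarrow> ennreal" where
  "total_variation I u =
     (SUP xs\<in>{xs. sorted xs \<and> set xs \<subseteq> I}.
        ennreal (\<Sum>i<length xs - 1. \<bar>u (xs ! Suc i) - u (xs ! i)\<bar>))"

definition controls :: "real \<Rightarrow> real \<Rightarrow> (real \<Rightarrow> real) set" where
  "controls \<delta> a = {u. (\<forall>t. - ((1 - \<delta>) / a) < u t \<and> u t < (1 - \<delta>) / a) \<and>
     total_variation UNIV u < \<infinity> \<and> (\<forall>t\<le>0. u t = 0)}"

text \<open>The values at the finitely many break points are arbitrary.\<close>

definition piecewise_constant :: "(real \<Rightarrow> real) \<Rightarrow> bool" where
  "piecewise_constant u \<longleftrightarrow>
     (\<exists>P. finite P \<and> (\<forall>x y. x \<le> y \<and> {x..y} \<inter> P = {} \<longrightarrow> u x = u y))"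

text \<open>\<open>xs\<close> lists the lengths and the values of successive intervals covering \<open>[0, t]\<close> on whose
  interiors \<open>u\<close> is constant. Intervals of length zero would contribute the identity
  to the propagator and are left out; so the values listed are actually taken by \<open>u\<close>.\<close>

definition pc_steps :: "(real \<Rightarrow> real) \<Rightarrow> real \<Rightarrow> (real \<times> real) list \<Rightarrow> bool" where
  "pc_steps u t xs \<longleftrightarrow>
     (\<forall>(\<tau>, v)\<in>set xs. 0 < \<tau>) \<and> sum_list (map fst xs) = t \<and>
     (\<forall>i<length xs. \<forall>s. sum_list (map fst (take i xs)) < s \<and>
        s < sum_list (map fst (take (Suc i) xs)) \<longrightarrow> u s = snd (xs ! i))"

text \<open>The product of the exponentials does not depend on the choice of the steps.\<close>

definition pc_propagator ::
    "'a::complex_hilbert_space set \<Rightarrow> ('a \<Rightarrow> 'a) \<Rightarrow> ('a \<Rightarrow> 'a) \<Rightarrow> (real \<Rightarrow> real) \<Rightarrow> real \<Rightarrow> 'a \<Rightarrow> 'a"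
  where
  "pc_propagator D A B u t =
     fold (\<lambda>(\<tau>, v). exp_group D (\<lambda>x. A x + v *\<^sub>R B x) \<tau>) (SOME xs. pc_steps u t xs)"

definition pc_approximation ::
    "real \<Rightarrow> real \<Rightarrow> real \<Rightarrow> (real \<Rightarrow> real) \<Rightarrow> (nat \<Rightarrow> real \<Rightarrow> real) \<Rightarrow> bool" where
  "pc_approximation \<delta> a T u v \<longleftrightarrow>
     (\<forall>n. v n \<in> controls \<delta> a \<and> piecewise_constant (v n) \<and>
        total_variation {0..T} (v n) \<le> total_variation {0..T} u) \<and>
     (\<forall>s. (\<lambda>n. v n s) \<longlonglongrightarrow> u s)"

definition propagator ::
    "real \<Rightarrow> real \<Rightarrow> 'a::complex_hilbert_space set \<Rightarrow> ('a \<Rightarrow> 'a) \<Rightarrow> ('a \<Rightarrow> 'a) \<Rightarrow>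
     (real \<Rightarrow> real) \<Rightarrow> real \<Rightarrow> 'a \<Rightarrow> 'a" where
  "propagator \<delta> a D A B u t \<psi> =
     (THE l. \<forall>T\<ge>t. \<forall>v. pc_approximation \<delta> a T u v \<longrightarrow>
        (\<lambda>n. pc_propagator D A B (v n) t \<psi>) \<longlonglongrightarrow> l)"

text \<open>The basis is indexed from \<open>0\<close>, so the projection of order \<open>N\<close> has rank \<open>N + 1\<close>.\<close>

definition galerkin_proj ::
    "(nat \<Rightarrow> 'a::complex_hilbert_space) \<Rightarrow> nat \<Rightarrow> 'a \<Rightarrow> 'a" where
  "galerkin_proj \<phi> N \<psi> = (\<Sum>j\<le>N. cinner (\<phi> j) \<psi> *\<^sub>C \<phi> j)"

definition compression ::
    "(nat \<Rightarrow> 'a::complex_hilbert_space) \<Rightarrow> nat \<Rightarrow> ('a \<Rightarrow> 'a) \<Rightarrow> 'a \<Rightarrow> 'a" where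
  "compression \<phi> N T x = galerkin_proj \<phi> N (T x)"

text \<open>For merely integrable \<open>u\<close>, solutions are understood in the sense of Caratheodory, that is,
  as continuous solutions of the integral equation. Only \<open>s \<le> t\<close> is considered.\<close>

definition galerkin_solution ::
    "(nat \<Rightarrow> 'a::complex_hilbert_space) \<Rightarrow> nat \<Rightarrow> ('a \<Rightarrow> 'a) \<Rightarrow> ('a \<Rightarrow> 'a) \<Rightarrow> (real \<Rightarrow> real) \<Rightarrow>
     real \<Rightarrow> real \<Rightarrow> (real \<Rightarrow> 'a) \<Rightarrow> bool" where
  "galerkin_solution \<phi> N A B u s t x \<longleftrightarrow>
     continuous_on {s..t} x \<and> x ` {s..t} \<subseteq> range (galerkin_proj \<phi> N) \<and>
     (\<forall>r\<in>{s..t}. ((\<lambda>\<tau>. compression \<phi> N A (x \<tau>) + u \<tau> *\<^sub>R compression \<phi> N B (x \<tau>))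
        has_integral (x r - x s)) {s..r})"

definition galerkin_propagator ::
    "(nat \<Rightarrow> 'a::complex_hilbert_space) \<Rightarrow> nat \<Rightarrow> ('a \<Rightarrow> 'a) \<Rightarrow> ('a \<Rightarrow> 'a) \<Rightarrow> (real \<Rightarrow> real) \<Rightarrow>
     real \<Rightarrow> real \<Rightarrow> 'a \<Rightarrow> 'a" where
  "galerkin_propagator \<phi> N A B u t s x0 =
     (THE y. \<exists>x. galerkin_solution \<phi> N A B u s t x \<and> x s = x0 \<and> x t = y)"

end

theory Submission
  imports Defs
begin

text \<open>
  Why the theorem holds. Let \<open>\<pi>\<^sub>N\<close> be the projection of order \<open>N\<close>. On the range of \<open>\<pi>\<^sub>N\<close>
  the exact equation \<open>x' = (A + u B) x\<close> and the Galerkin system \<open>x' = (A + u \<pi>\<^sub>N B) x\<close> differ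
  only by the term \<open>u (1 - \<pi>\<^sub>N) B x\<close>, because \<open>\<pi>\<^sub>N\<close> commutes with \<open>A\<close>. Both evolutions are
  isometric, so the two solutions differ at time \<open>t\<close> by at most the initial error
  \<open>\<parallel>\<psi> - \<pi>\<^sub>N \<psi>\<parallel>\<close> plus the integral of \<open>\<bar>u\<bar>\<close> times the supremum of \<open>\<parallel>(1 - \<pi>\<^sub>N) B x\<parallel>\<close> along the
  Galerkin solution \<open>x\<close>. The integral of \<open>\<bar>u\<bar>\<close> is at most \<open>K\<close>, hence the estimate is uniform in
  time. Two facts make the supremum small, uniformly in \<open>u\<close>.

  The graph norm \<open>\<parallel>A x\<parallel>\<close> stays bounded (\<open>energy_along_steps\<close>). While \<open>u\<close> has the constant value
  \<open>v\<close>, the flow is isometric and commutes with its generator, so it conserves the energy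
  \<open>\<parallel>(A + v \<pi>\<^sub>N B) x\<parallel> + (b / a) \<parallel>x\<parallel>\<close>. Since \<open>\<bar>v\<bar> a \<le> 1 - \<delta>\<close>, the energy dominates
  \<open>\<delta> \<parallel>A x\<parallel>\<close>, and a jump of \<open>u\<close> by \<open>h\<close> multiplies it by at most \<open>exp (2 a \<bar>h\<bar> / \<delta>)\<close>. So the total growth is governed by the variation.

  On sets of bounded graph norm, \<open>(1 - \<pi>\<^sub>N) B\<close> tends to \<open>0\<close> uniformly (\<open>proj_B_uniform\<close>). High
  modes contribute little to \<open>B x\<close> because \<open>\<bar>\<lambda>\<^sub>j\<bar>\<^sup>\<alpha>\<close> is negligible compared to \<open>\<bar>\<lambda>\<^sub>j\<bar>\<close>, and the low
  modes form a space of finite dimension.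

  The exact propagator, too, is obtained from Galerkin systems. For a constant value
  \<open>v\<close> the comparison above, applied to two orders \<open>N \<le> M\<close>, shows that the flows of the compressions
  form a Cauchy sequence; its limit is a unitary group, a contraction argument in the style of Kato and
  Rellich identifies its generator as \<open>A + v B\<close> with the domain of \<open>A\<close> (\<open>U_generator\<close>), and uniqueness
  of the group gives \<open>exp_group_eq_U\<close>. Comparing orders along piecewise constant controls and letting
  \<open>M\<close> tend to infinity yields the estimate for these controls (\<open>pc_galerkin_error\<close>). For general \<open>u\<close>
  it is passed to the limit: for fixed \<open>N\<close> the Galerkin solutions depend continuously on \<open>u\<close> in
  \<open>L\<^sup>1\<close> by Gronwall's inequality (\<open>galerkin_propagator_tendsto\<close>), and the uniformity of the error
  in the approximating controls shows at the same time that the limit defining the propagator exists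
  and is independent of the approximation (\<open>propagator_eq_lim\<close>).
\<close>

section \<open>Elementary estimates\<close>

lemma norm_add_diff_le: "norm (x + y - z) \<le> norm x + norm y + norm (z::'a::real_normed_vector)"
  using norm_triangle_ineq4[of "x + y" z] norm_triangle_ineq[of x y] by linarith

lemma small_factor:
  fixes c e :: real
  assumes "0 \<le> c" and "0 < e"
  shows "\<exists>\<eta>>0. \<eta> * c < e"
  using assms by (intro exI[of _ "e / (c + 1)"]) (auto simp: field_simps add_nonneg_pos)

section \<open>Hilbert spaces\<close>

lemma norm_scaleC: "norm (z *\<^sub>C x) = cmod z * norm (x::'a::complex_hilbert_space)"
proof -
  have "cinner (z *\<^sub>C x) (z *\<^sub>C x) = z * cnj z * cinner x x"
    by (metis cinner_commute cinner_scaleC_right complex_cnj_mult mult.assoc)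
  then have "complex_of_real ((norm (z *\<^sub>C x))\<^sup>2) = complex_of_real ((cmod z * norm x)\<^sup>2)"
    by (simp only: cinner_same complex_norm_square[symmetric] power_mult_distrib of_real_mult
        of_real_power)
  then have "(norm (z *\<^sub>C x))\<^sup>2 = (cmod z * norm x)\<^sup>2"
    using of_real_eq_iff by blast
  then show ?thesis by (simp add: power2_eq_iff_nonneg)
qed

lemma cinner_add_left: "cinner (x + x') y = cinner x y + cinner x' (y::'a::complex_hilbert_space)"
  by (metis cinner_add_right cinner_commute complex_cnj_add)

lemma cinner_scaleC_left: "cinner (z *\<^sub>C x) y = cnj z * cinner x (y::'a::complex_hilbert_space)"
  by (metis cinner_scaleC_right cinner_commute complex_cnj_mult)

lemma cinner_scaleR_right: "cinner x (r *\<^sub>R y) = r *\<^sub>R cinner x (y::'a::complex_hilbert_space)"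
  by (metis scaleC_of_real cinner_scaleC_right scaleR_conv_of_real)

lemma cinner_scaleR_left: "cinner (r *\<^sub>R x) y = r *\<^sub>R cinner x (y::'a::complex_hilbert_space)"
  using cinner_scaleC_left[of "complex_of_real r" x y]
  by (simp add: scaleC_of_real scaleR_conv_of_real)

lemma cinner_minus_right: "cinner x (- y) = - cinner x (y::'a::complex_hilbert_space)"
  using cinner_scaleR_right[of x "-1" y] by simp

lemma cinner_minus_left: "cinner (- x) y = - cinner x (y::'a::complex_hilbert_space)"
  using cinner_scaleR_left[of "-1" x y] by simp

lemma norm_add_squared:
  "(norm (x + y))\<^sup>2 = (norm x)\<^sup>2 + 2 * Re (cinner x y) + (norm (y::'a::complex_hilbert_space))\<^sup>2"
proof -
  have "complex_of_real ((norm (x + y))\<^sup>2)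
      = complex_of_real ((norm x)\<^sup>2) + (cinner x y + cinner y x) + complex_of_real ((norm y)\<^sup>2)"
    by (metis (no_types, lifting) ab_semigroup_add_class.add_ac(1) cinner_add_left
        cinner_add_right cinner_same)
  moreover have "cinner x y + cinner y x = complex_of_real (2 * Re (cinner x y))"
    by (subst cinner_commute[of y x]) (simp add: complex_eq_iff)
  ultimately have "complex_of_real ((norm (x + y))\<^sup>2)
      = complex_of_real ((norm x)\<^sup>2 + 2 * Re (cinner x y) + (norm y)\<^sup>2)"
    by simp
  then show ?thesis by (rule of_real_eq_iff[THEN iffD1])
qed

lemma norm_cinner_le: "cmod (cinner x y) \<le> norm x * norm (y::'a::complex_hilbert_space)"
proof (cases "x = 0")
  case True
  then show ?thesis using cinner_scaleR_left[of 0 x y] by simp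
next
  case False
  \<comment> \<open>The component of \<open>y\<close> orthogonal to \<open>x\<close> has nonnegative squared norm.\<close>
  define z where "z = - (cinner x y / (norm x)\<^sup>2)"
  have n: "norm x > 0" using False by simp
  have "0 \<le> (norm (y + z *\<^sub>C x))\<^sup>2" by simp
  also have "\<dots> = (norm y)\<^sup>2 + 2 * Re (z * cinner y x) + (cmod z * norm x)\<^sup>2"
    by (simp add: norm_add_squared cinner_scaleC_right norm_scaleC)
  also have "z * cinner y x = - complex_of_real ((cmod (cinner x y))\<^sup>2 / (norm x)\<^sup>2)"
    unfolding z_def by (subst cinner_commute[of y x]) (simp add: complex_norm_square[symmetric])
  also have "(cmod z * norm x)\<^sup>2 = (cmod (cinner x y))\<^sup>2 / (norm x)\<^sup>2"
    using n by (simp add: z_def norm_divide norm_power power_mult_distrib power_divide)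
      (simp add: power2_eq_square power4_eq_xxxx)
  finally have "(cmod (cinner x y))\<^sup>2 / (norm x)\<^sup>2 \<le> (norm y)\<^sup>2" by simp
  then have "(cmod (cinner x y))\<^sup>2 \<le> (norm x * norm y)\<^sup>2"
    using n by (simp add: divide_simps power_mult_distrib mult.commute)
  then show ?thesis by (rule power2_le_imp_le) simp
qed

interpretation cinner: bounded_bilinear "cinner :: 'a::complex_hilbert_space \<Rightarrow> 'a \<Rightarrow> complex"
proof
  show "\<exists>K. \<forall>a b :: 'a. norm (cinner a b) \<le> norm a * norm b * K"
    using norm_cinner_le by (intro exI[of _ 1]) auto
qed (simp_all add: cinner_add_left cinner_add_right cinner_scaleR_left cinner_scaleR_right)

interpretation scaleC: bounded_bilinear "scaleC :: complex \<Rightarrow> 'a \<Rightarrow> 'a::complex_hilbert_space"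
proof
  show "(r *\<^sub>R z) *\<^sub>C (x::'a) = r *\<^sub>R z *\<^sub>C x" for r z x
    by (simp only: scaleR_conv_of_real scaleC_scaleC[symmetric] scaleC_of_real)
  show "z *\<^sub>C (r *\<^sub>R x) = r *\<^sub>R z *\<^sub>C (x::'a)" for r z x
    by (simp only: scaleC_of_real[symmetric] scaleC_scaleC mult.commute)
  show "\<exists>K. \<forall>z (x::'a). norm (z *\<^sub>C x) \<le> norm z * norm x * K"
    by (intro exI[of _ 1]) (auto simp: norm_scaleC)
qed (simp_all add: scaleC_add_left scaleC_add_right)

declare cinner.zero_left [simp] cinner.zero_right [simp]
  scaleC.zero_left [simp] scaleC.zero_right [simp]

lemma cinner_eq_zero_iff: "cinner x x = 0 \<longleftrightarrow> x = (0::'a::complex_hilbert_space)"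
  by (simp add: cinner_same)

lemma cinner_sum_scaleC_left:
  "cinner (\<Sum>i\<in>I. c i *\<^sub>C f i) x = (\<Sum>i\<in>I. cnj (c i) * cinner (f i) (x::'a::complex_hilbert_space))"
  by (simp add: cinner.sum_left cinner_scaleC_left)

lemma cinner_sum_scaleC_right:
  "cinner x (\<Sum>i\<in>I. c i *\<^sub>C f i) = (\<Sum>i\<in>I. c i * cinner x (f i :: 'a::complex_hilbert_space))"
  by (simp add: cinner.sum_right cinner_scaleC_right)

text \<open>Density of the domain is what makes the adjoint of an operator single-valued.\<close>

lemma cinner_right_eqI_dense:
  fixes D :: "'a::complex_hilbert_space set"
  assumes "closure D = UNIV" and "\<And>x. x \<in> D \<Longrightarrow> cinner y x = cinner z x"
  shows "y = z"
proof -
  have "closed {x. cinner y x = cinner z x}"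
    by (intro closed_Collect_eq continuous_intros cinner.continuous_on)
  moreover have "D \<subseteq> {x. cinner y x = cinner z x}" using assms(2) by auto
  ultimately have "y - z \<in> {x. cinner y x = cinner z x}"
    using assms(1) closure_minimal by blast
  then have "cinner (y - z) (y - z) = 0" by (simp add: cinner.diff_left)
  then show ?thesis by (simp add: cinner_eq_zero_iff)
qed

section \<open>Expansions in a Hilbert basis\<close>

locale hilbert_basis_setting =
  fixes \<phi> :: "nat \<Rightarrow> 'a::complex_hilbert_space"
  assumes hilbert_basis: "hilbert_basis \<phi>"
begin

abbreviation "P \<equiv> galerkin_proj \<phi>"

lemma cinner_basis: "cinner (\<phi> i) (\<phi> j) = (if i = j then 1 else 0)"
  and span_basis_dense: "closure (cvs.span (range \<phi>)) = UNIV"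
  using hilbert_basis unfolding hilbert_basis_def by auto

lemma norm_basis [simp]: "norm (\<phi> j) = 1"
proof -
  have "complex_of_real ((norm (\<phi> j))\<^sup>2) = complex_of_real 1"
    using cinner_basis[of j j] by (simp only: cinner_same[symmetric]) simp
  then have "(norm (\<phi> j))\<^sup>2 = 1" by (rule of_real_eq_iff[THEN iffD1])
  then show ?thesis using power2_eq_1_iff[of "norm (\<phi> j)"] norm_ge_zero[of "\<phi> j"] by linarith
qed

lemma cinner_basis_sum:
  assumes "finite I"
  shows "cinner (\<phi> k) (\<Sum>i\<in>I. c i *\<^sub>C \<phi> i) = (if k \<in> I then c k else 0)"
proof -
  have "cinner (\<phi> k) (\<Sum>i\<in>I. c i *\<^sub>C \<phi> i) = (\<Sum>i\<in>I. if k = i then c i else 0)"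
    by (simp add: cinner_sum_scaleC_right cinner_basis if_distrib cong: if_cong)
  then show ?thesis using assms by simp
qed

lemma norm_basis_sum:
  assumes "finite I"
  shows "(norm (\<Sum>i\<in>I. c i *\<^sub>C \<phi> i))\<^sup>2 = (\<Sum>i\<in>I. (cmod (c i))\<^sup>2)"
proof -
  have "complex_of_real ((norm (\<Sum>i\<in>I. c i *\<^sub>C \<phi> i))\<^sup>2)
      = (\<Sum>i\<in>I. cnj (c i) * cinner (\<phi> i) (\<Sum>i\<in>I. c i *\<^sub>C \<phi> i))"
    by (simp only: cinner_same[symmetric] cinner_sum_scaleC_left)
  also have "\<dots> = (\<Sum>i\<in>I. cnj (c i) * c i)"
    using assms by (intro sum.cong) (auto simp: cinner_basis_sum)
  also have "\<dots> = complex_of_real (\<Sum>i\<in>I. (cmod (c i))\<^sup>2)"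
    by (simp add: complex_norm_square[symmetric] mult.commute[of "cnj _"])
  finally show ?thesis by (rule of_real_eq_iff[THEN iffD1])
qed

lemma norm_basis_sum_mono:
  assumes "finite I" and "\<And>i. i \<in> I \<Longrightarrow> cmod (c i) \<le> cmod (e i)"
  shows "norm (\<Sum>i\<in>I. c i *\<^sub>C \<phi> i) \<le> norm (\<Sum>i\<in>I. e i *\<^sub>C \<phi> i)"
proof -
  have "(norm (\<Sum>i\<in>I. c i *\<^sub>C \<phi> i))\<^sup>2 \<le> (norm (\<Sum>i\<in>I. e i *\<^sub>C \<phi> i))\<^sup>2"
    unfolding norm_basis_sum[OF assms(1)] using assms(2)
    by (intro sum_mono power_mono) auto
  then show ?thesis by (rule power2_le_imp_le) simp
qed

lemma cinner_basis_proj: "cinner (\<phi> k) (P N x) = (if k \<le> N then cinner (\<phi> k) x else 0)"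
  unfolding galerkin_proj_def by (subst cinner_basis_sum) simp_all

lemma proj_linear: "linear (P N)"
proof (rule linearI)
  show "P N (x + y) = P N x + P N y" for x y
    unfolding galerkin_proj_def by (simp only: cinner_add_right scaleC_add_left sum.distrib)
  show "P N (r *\<^sub>R x) = r *\<^sub>R P N x" for r x
    unfolding galerkin_proj_def
    by (simp only: cinner_scaleR_right scaleC.scaleR_left scaleR_sum_right)
qed

lemmas proj_add = linear_add[OF proj_linear]
  and proj_diff = linear_diff[OF proj_linear]
  and proj_zero [simp] = linear_0[OF proj_linear]
  and proj_scaleR = linear_scale[OF proj_linear]

lemma proj_scaleC: "P N (z *\<^sub>C x) = z *\<^sub>C P N x"
  unfolding galerkin_proj_def by (simp add: cinner_scaleC_right scaleC.sum_right scaleC_scaleC)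

lemma proj_proj: "P M (P N x) = P (min M N) x"
proof -
  have "P M (P N x) = (\<Sum>j\<le>M. (if j \<le> N then cinner (\<phi> j) x else 0) *\<^sub>C \<phi> j)"
    unfolding galerkin_proj_def[of \<phi> M] cinner_basis_proj ..
  also have "\<dots> = (\<Sum>j\<in>{..M}. if j \<in> {..N} then cinner (\<phi> j) x *\<^sub>C \<phi> j else 0)"
    by (intro sum.cong) (auto simp: scaleC.zero_left)
  also have "\<dots> = (\<Sum>j\<in>{..M} \<inter> {..N}. cinner (\<phi> j) x *\<^sub>C \<phi> j)"
    by (rule sum.inter_restrict[symmetric]) simp
  also have "{..M} \<inter> {..N} = {..min M N}" by auto
  finally show ?thesis unfolding galerkin_proj_def .
qed

lemma proj_idem [simp]: "P N (P N x) = P N x"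
  by (simp add: proj_proj)

lemma proj_absorb: "N \<le> M \<Longrightarrow> P M (P N x) = P N x"
  by (simp add: proj_proj min_def)

lemma proj_basis: "P N (\<phi> j) = (if j \<le> N then \<phi> j else 0)"
proof -
  have "P N (\<phi> j) = (\<Sum>i\<le>N. if i = j then \<phi> i else 0)"
    unfolding galerkin_proj_def cinner_basis
    by (intro sum.cong) (auto simp: scaleC.zero_left)
  then show ?thesis by simp
qed

lemma proj_symmetric: "cinner (P N x) y = cinner x (P N y)"
proof -
  have "cinner (P N x) y = (\<Sum>j\<le>N. cnj (cinner (\<phi> j) x) * cinner (\<phi> j) y)"
    unfolding galerkin_proj_def by (rule cinner_sum_scaleC_left)
  also have "\<dots> = (\<Sum>j\<le>N. cinner (\<phi> j) y * cinner x (\<phi> j))"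
    by (intro sum.cong) (auto simp: mult.commute cinner_commute[of x])
  also have "\<dots> = cinner x (P N y)"
    unfolding galerkin_proj_def by (rule cinner_sum_scaleC_right[symmetric])
  finally show ?thesis .
qed

lemma norm_proj_pythagoras: "(norm x)\<^sup>2 = (norm (P N x))\<^sup>2 + (norm (x - P N x))\<^sup>2"
proof -
  have "cinner (P N x) (x - P N x) = 0"
    by (simp add: proj_symmetric proj_diff)
  then show ?thesis using norm_add_squared[of "P N x" "x - P N x"] by simp
qed

lemma norm_proj_le: "norm (P N x) \<le> norm x"
proof -
  have "(norm (P N x))\<^sup>2 \<le> (norm x)\<^sup>2"
    using norm_proj_pythagoras[of x N] by simp
  then show ?thesis by (rule power2_le_imp_le) simp
qed

lemma norm_proj_compl_le: "norm (x - P N x) \<le> norm x"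
proof -
  have "(norm (x - P N x))\<^sup>2 \<le> (norm x)\<^sup>2"
    using norm_proj_pythagoras[of x N] by simp
  then show ?thesis by (rule power2_le_imp_le) simp
qed

lemma proj_bounded_linear: "bounded_linear (P N)"
  using proj_linear norm_proj_le
  by (intro bounded_linear_intro[where K = 1]) (auto simp: linear_add linear_scale)

text \<open>The vectors on which the projections converge form a closed subspace containing the basis.\<close>

lemma proj_tendsto: "(\<lambda>N. P N x) \<longlonglongrightarrow> x"
proof -
  have span: "\<exists>N0. \<forall>N\<ge>N0. P N y = y" if "y \<in> cvs.span (range \<phi>)" for y
    using that
  proof (induction rule: cvs.span_induct_alt)
    case base
    then show ?case by simp
  next
    case (step c w y)
    then obtain j N0 where w: "w = \<phi> j" and N0: "\<forall>N\<ge>N0. P N y = y" by auto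
    then show ?case
      by (intro exI[of _ "max j N0"]) (auto simp: proj_add proj_scaleC proj_basis)
  qed
  show ?thesis
  proof (rule LIMSEQ_I)
    fix e :: real assume e: "e > 0"
    have "x \<in> closure (cvs.span (range \<phi>))" using span_basis_dense by simp
    then obtain y where y: "y \<in> cvs.span (range \<phi>)" "dist y x < e"
      using e unfolding closure_approachable by blast
    then obtain N0 where N0: "\<forall>N\<ge>N0. P N y = y" using span by blast
    have "norm (P N x - x) < e" if "N \<ge> N0" for N
    proof -
      have "x - P N x = (x - y) - P N (x - y)" using N0 that by (simp add: proj_diff)
      then have "norm (x - P N x) \<le> norm (x - y)" using norm_proj_compl_le[of "x - y" N] by metis
      then show ?thesis using y(2) by (simp add: dist_norm norm_minus_commute)
    qed
    then show "\<exists>N0. \<forall>N\<ge>N0. norm (P N x - x) < e" by blast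
  qed
qed

lemma basis_eqI: "(\<And>j. cinner (\<phi> j) x = cinner (\<phi> j) y) \<Longrightarrow> x = y"
proof -
  assume "\<And>j. cinner (\<phi> j) x = cinner (\<phi> j) y"
  then have "P N x = P N y" for N unfolding galerkin_proj_def by simp
  then show "x = y" using proj_tendsto[of x] proj_tendsto[of y] LIMSEQ_unique by auto
qed

text \<open>Riesz-Fischer: the partial sums are Cauchy by the theorem of Pythagoras.\<close>

lemma basis_series_converges:
  assumes "summable (\<lambda>j. (cmod (c j))\<^sup>2)"
  shows "convergent (\<lambda>n. \<Sum>j\<le>n. c j *\<^sub>C \<phi> j)"
proof (rule Cauchy_convergent, rule CauchyI')
  fix e :: real assume e: "e > 0"
  from summable_Cauchy[THEN iffD1, OF assms, rule_format, of "e\<^sup>2"] e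
  obtain N where N: "\<And>m n. m \<ge> N \<Longrightarrow> norm (\<Sum>j\<in>{m..<n}. (cmod (c j))\<^sup>2) < e\<^sup>2" by auto
  have "dist (\<Sum>j\<le>m. c j *\<^sub>C \<phi> j) (\<Sum>j\<le>n. c j *\<^sub>C \<phi> j) < e" if "m \<ge> N" "m < n" for m n
  proof -
    have "(\<Sum>j\<le>n. c j *\<^sub>C \<phi> j) - (\<Sum>j\<le>m. c j *\<^sub>C \<phi> j) = (\<Sum>j\<in>{..n} - {..m}. c j *\<^sub>C \<phi> j)"
      using that by (subst sum_diff) auto
    also have "{..n} - {..m} = {Suc m..<Suc n}" by auto
    finally have "(norm ((\<Sum>j\<le>n. c j *\<^sub>C \<phi> j) - (\<Sum>j\<le>m. c j *\<^sub>C \<phi> j)))\<^sup>2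
        = (\<Sum>j\<in>{Suc m..<Suc n}. (cmod (c j))\<^sup>2)"
      by (simp only: norm_basis_sum finite_atLeastLessThan)
    also have "\<dots> \<le> norm (\<Sum>j\<in>{Suc m..<Suc n}. (cmod (c j))\<^sup>2)" by simp
    also have "\<dots> < e\<^sup>2" using that by (intro N) simp
    finally have "norm ((\<Sum>j\<le>n. c j *\<^sub>C \<phi> j) - (\<Sum>j\<le>m. c j *\<^sub>C \<phi> j)) < e"
      using e by (simp add: power_less_imp_less_base)
    then show ?thesis by (simp add: dist_norm norm_minus_commute)
  qed
  then show "\<exists>N. \<forall>m\<ge>N. \<forall>n>m. dist (\<Sum>j\<le>m. c j *\<^sub>C \<phi> j) (\<Sum>j\<le>n. c j *\<^sub>C \<phi> j) < e"
    by blast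
qed

end

section \<open>Controls of bounded variation\<close>

definition list_variation :: "(real \<Rightarrow> real) \<Rightarrow> real list \<Rightarrow> real" where
  "list_variation u xs = (\<Sum>i<length xs - 1. \<bar>u (xs ! Suc i) - u (xs ! i)\<bar>)"

lemma list_variation_snoc:
  assumes "xs \<noteq> []"
  shows "list_variation u (xs @ [m]) = list_variation u xs + \<bar>u m - u (last xs)\<bar>"
proof -
  obtain n where n: "length xs = Suc n" using assms by (cases xs) auto
  have "list_variation u (xs @ [m]) = (\<Sum>i<Suc n. \<bar>u ((xs @ [m]) ! Suc i) - u ((xs @ [m]) ! i)\<bar>)"
    unfolding list_variation_def by (simp add: n)
  also have "\<dots> = (\<Sum>i<n. \<bar>u (xs ! Suc i) - u (xs ! i)\<bar>) + \<bar>u m - u (xs ! n)\<bar>"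
    by (simp add: nth_append n)
  finally show ?thesis
    using assms n by (simp add: list_variation_def last_conv_nth)
qed

lemma list_variation_le_total_variation:
  "sorted xs \<Longrightarrow> set xs \<subseteq> I \<Longrightarrow> ennreal (list_variation u xs) \<le> total_variation I u"
  unfolding total_variation_def list_variation_def by (rule SUP_upper) simp

lemma total_variation_le:
  "(\<And>xs. sorted xs \<Longrightarrow> set xs \<subseteq> I \<Longrightarrow> ennreal (list_variation u xs) \<le> c) \<Longrightarrow> total_variation I u \<le> c"
  unfolding total_variation_def list_variation_def by (rule SUP_least) simp

lemma total_variation_subset: "I \<subseteq> J \<Longrightarrow> total_variation I u \<le> total_variation J u"
  by (rule total_variation_le, rule list_variation_le_total_variation) auto

text \<open>The image of a sorted list under a monotone function is again sorted, so every sum for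
  \<open>u \<circ> q\<close> is also a sum for \<open>u\<close>.\<close>

lemma total_variation_reparametrize:
  assumes "mono_on I q" and "q ` I \<subseteq> I"
  shows "total_variation I (u \<circ> q) \<le> total_variation I u"
proof (rule total_variation_le)
  fix xs :: "real list" assume xs: "sorted xs" "set xs \<subseteq> I"
  have "sorted (map q xs)"
    using xs assms(1) unfolding sorted_map
    by (auto intro: sorted_wrt_mono_rel[of xs "(\<le>)"] simp: mono_on_def subset_iff)
  moreover have "set (map q xs) \<subseteq> I" using xs(2) assms(2) by auto
  moreover have "list_variation (u \<circ> q) xs = list_variation u (map q xs)"
    unfolding list_variation_def by (auto intro!: sum.cong)
  ultimately show "ennreal (list_variation (u \<circ> q) xs) \<le> total_variation I u"
    by (simp add: list_variation_le_total_variation)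
qed

locale bounded_variation =
  fixes u :: "real \<Rightarrow> real"
  assumes finite_variation: "total_variation UNIV u < \<infinity>"
begin

definition "variation_upto s = enn2real (total_variation {..s} u)"

lemma ennreal_variation_upto: "ennreal (variation_upto s) = total_variation {..s} u"
  unfolding variation_upto_def
  using total_variation_subset[of "{..s}" UNIV u] finite_variation
  by (intro ennreal_enn2real) (auto simp: less_top)

lemma increment_le_variation_upto:
  assumes "x \<le> y"
  shows "\<bar>u y - u x\<bar> \<le> variation_upto y - variation_upto x"
proof -
  have fin: "total_variation {..y} u \<ge> ennreal \<bar>u y - u x\<bar>"
    using list_variation_le_total_variation[of "[x, y]" "{..y}" u] assms
    by (simp add: list_variation_def)
  have "total_variation {..x} u \<le> total_variation {..y} u - ennreal \<bar>u y - u x\<bar>"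
  proof (rule total_variation_le)
    fix xs :: "real list" assume xs: "sorted xs" "set xs \<subseteq> {..x}"
    define c where "c = list_variation u xs"
    have c0: "c \<ge> 0" unfolding c_def list_variation_def by (simp add: sum_nonneg)
    have "c + \<bar>u y - u x\<bar> \<le> list_variation u (xs @ [x] @ [y])"
    proof (cases "xs = []")
      case True
      then show ?thesis by (simp add: list_variation_def c_def)
    next
      case False
      then show ?thesis
        using list_variation_snoc[of "xs @ [x]" u y] list_variation_snoc[of xs u x]
        by (simp add: c_def)
    qed
    moreover have "ennreal (list_variation u (xs @ [x] @ [y])) \<le> total_variation {..y} u"
      using xs assms by (intro list_variation_le_total_variation) (auto simp: sorted_append)
    ultimately have "ennreal (c + \<bar>u y - u x\<bar>) \<le> total_variation {..y} u"
      by (metis dual_order.trans ennreal_leI)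
    then have "ennreal (c + \<bar>u y - u x\<bar>) \<le> ennreal (variation_upto y)" by (simp add: ennreal_variation_upto)
    then have "c + \<bar>u y - u x\<bar> \<le> variation_upto y"
      using c0 by (subst (asm) ennreal_le_iff) (auto simp: variation_upto_def)
    then show "ennreal c \<le> total_variation {..y} u - ennreal \<bar>u y - u x\<bar>"
      by (simp add: ennreal_variation_upto[symmetric] ennreal_minus ennreal_leI)
  qed
  then have "ennreal (variation_upto x) \<le> ennreal (variation_upto y - \<bar>u y - u x\<bar>)"
    by (simp add: ennreal_variation_upto[symmetric] ennreal_minus)
  moreover have "\<bar>u y - u x\<bar> \<le> variation_upto y"
    using fin by (simp add: ennreal_variation_upto[symmetric]) (subst (asm) ennreal_le_iff, auto simp: variation_upto_def)
  ultimately show ?thesis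
    by (subst (asm) ennreal_le_iff) auto
qed

lemma variation_upto_mono: "x \<le> y \<Longrightarrow> variation_upto x \<le> variation_upto y"
  using increment_le_variation_upto[of x y] by linarith

lemma variation_upto_nonneg: "0 \<le> variation_upto s"
  by (simp add: variation_upto_def)

lemma variation_upto_bounded: "variation_upto s \<le> enn2real (total_variation UNIV u)"
  unfolding variation_upto_def using finite_variation
  by (intro enn2real_mono total_variation_subset) auto

lemma variation_upto_nonpos_eq:
  assumes "\<And>t. t \<le> 0 \<Longrightarrow> u t = 0" and "s \<le> 0"
  shows "variation_upto s = 0"
proof -
  have "total_variation {..s} u \<le> 0"
  proof (rule total_variation_le)
    fix xs :: "real list" assume xs: "sorted xs" "set xs \<subseteq> {..s}"
    have "u (xs ! i) = 0" if "i < length xs" for i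
    proof (rule assms(1))
      have "xs ! i \<in> set xs" using that by simp
      then show "xs ! i \<le> 0" using xs(2) assms(2) by auto
    qed
    then have "list_variation u xs = 0" unfolding list_variation_def by (intro sum.neutral) auto
    then show "ennreal (list_variation u xs) \<le> 0" by simp
  qed
  then show ?thesis by (simp add: variation_upto_def)
qed

text \<open>By the Jordan decomposition \<open>u\<close> is a difference of two monotone functions.\<close>

lemma borel_measurable_control: "u \<in> borel_measurable borel"
proof -
  have "mono variation_upto" by (rule monoI) (rule variation_upto_mono)
  moreover have "mono (\<lambda>s. variation_upto s - u s)"
  proof (rule monoI)
    fix x y :: real assume "x \<le> y"
    then show "variation_upto x - u x \<le> variation_upto y - u y" using increment_le_variation_upto[of x y] by linarith
  qed
  ultimately have "(\<lambda>s. variation_upto s - (variation_upto s - u s)) \<in> borel_measurable borel"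
    by (intro borel_measurable_diff borel_measurable_mono)
  then show ?thesis by simp
qed

end

lemma controls_bounded_variation: "u \<in> controls \<delta> a \<Longrightarrow> bounded_variation u"
  by unfold_locales (simp add: controls_def)

lemma controls_measurable: "u \<in> controls \<delta> a \<Longrightarrow> u \<in> borel_measurable borel"
  by (rule bounded_variation.borel_measurable_control[OF controls_bounded_variation])

lemma controls_abs_le: "u \<in> controls \<delta> a \<Longrightarrow> \<bar>u s\<bar> \<le> (1 - \<delta>) / a"
  unfolding controls_def abs_le_iff minus_le_iff[of "u s"] by (auto intro: less_imp_le)

lemma controls_zero: "u \<in> controls \<delta> a \<Longrightarrow> s \<le> 0 \<Longrightarrow> u s = 0"
  unfolding controls_def by simp

text \<open>Reparametrizing \<open>u\<close> by a monotone function with finitely many values cannot increase the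
  variation. Such a function is obtained by choosing one point in each level set of the variation
  function, rounded to multiples of \<open>\<epsilon>\<close>; then \<open>u\<close> moves by at most \<open>\<epsilon>\<close>. The points \<open>0\<close> and \<open>T\<close>
  are chosen whenever possible, so that \<open>[0, T]\<close> is mapped to itself.\<close>

lemma controls_uniform_approximation:
  assumes u: "u \<in> controls \<delta> a" and T: "0 \<le> T" and \<epsilon>: "\<epsilon> > 0"
  shows "\<exists>v\<in>controls \<delta> a. piecewise_constant v \<and>
           total_variation {0..T} v \<le> total_variation {0..T} u \<and> (\<forall>s. \<bar>v s - u s\<bar> \<le> \<epsilon>)"
proof -
  interpret bounded_variation u by (rule controls_bounded_variation[OF u])
  define k where "k s = \<lfloor>variation_upto s / \<epsilon>\<rfloor>" for s
  define q where "q s = (if k s = k 0 then 0 else if k s = k T then T else (SOME r. k r = k s))" for s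
  have k_mono: "k x \<le> k y" if "x \<le> y" for x y
    unfolding k_def by (intro floor_mono divide_right_mono variation_upto_mono that less_imp_le[OF \<epsilon>])
  have k_less: "x < y" if "k x < k y" for x y
    using k_mono[of y x] that by linarith
  have kq: "k (q s) = k s" for s
    unfolding q_def by (auto intro: someI[of "\<lambda>r. k r = k s" s])
  have q_eq: "q x = q y" if "k x = k y" for x y
    unfolding q_def that ..
  have q_mono: "q x \<le> q y" if "x \<le> y" for x y
  proof (cases "k x = k y")
    case True
    then show ?thesis by (simp add: q_eq[OF True])
  next
    case False
    then have "k (q x) < k (q y)" using k_mono[OF that] by (simp add: kq)
    then show ?thesis by (intro less_imp_le k_less)
  qed
  have q_nonpos: "q s = 0" if "s \<le> 0" for s
  proof -
    have "variation_upto s = 0" "variation_upto 0 = 0" using variation_upto_nonpos_eq controls_zero[OF u] that by auto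
    then show ?thesis by (simp add: q_def k_def)
  qed
  have q_T: "q ` {0..T} \<subseteq> {0..T}"
  proof
    fix r assume "r \<in> q ` {0..T}"
    then obtain s where s: "0 \<le> s" "s \<le> T" "r = q s" by auto
    show "r \<in> {0..T}"
    proof (cases "k s = k 0 \<or> k s = k T")
      case True
      then show ?thesis using T by (auto simp: s(3) q_def)
    next
      case False
      then have "k 0 < k (q s)" "k (q s) < k T"
        using k_mono[OF s(1)] k_mono[OF s(2)] by (auto simp: kq)
      then show ?thesis using k_less[of 0 "q s"] k_less[of "q s" T] by (simp add: s(3))
    qed
  qed
  define v where "v = u \<circ> q"
  have close: "\<bar>v s - u s\<bar> \<le> \<epsilon>" for s
  proof -
    have "\<bar>v s - u s\<bar> \<le> \<bar>variation_upto (q s) - variation_upto s\<bar>"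
      unfolding v_def using increment_le_variation_upto[of s "q s"] increment_le_variation_upto[of "q s" s]
      by (cases "s \<le> q s") auto
    also have "\<bar>variation_upto (q s) / \<epsilon> - variation_upto s / \<epsilon>\<bar> \<le> 1"
      using kq[of s] unfolding k_def by linarith
    then have "\<bar>variation_upto (q s) - variation_upto s\<bar> \<le> \<epsilon>"
      using \<epsilon> by (simp add: diff_divide_distrib[symmetric] abs_divide)
    finally show ?thesis .
  qed
  have "total_variation UNIV v \<le> total_variation UNIV u"
    unfolding v_def by (intro total_variation_reparametrize) (auto simp: mono_on_def q_mono)
  then have v: "v \<in> controls \<delta> a"
    using u q_nonpos unfolding controls_def v_def by (auto intro: le_less_trans)
  have TV: "total_variation {0..T} v \<le> total_variation {0..T} u"
    unfolding v_def by (intro total_variation_reparametrize) (auto simp: mono_on_def q_mono q_T)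
  have "piecewise_constant v"
    unfolding piecewise_constant_def
  proof (intro exI conjI allI impI)
    \<comment> \<open>the points at which the rounded variation reaches a new level\<close>
    define Q where "Q = (\<lambda>m. Sup {s. k s < m}) ` range k"
    have "range k \<subseteq> {0..\<lfloor>enn2real (total_variation UNIV u) / \<epsilon>\<rfloor>}"
    proof -
      have "0 \<le> variation_upto s / \<epsilon>" for s using variation_upto_nonneg \<epsilon> by simp
      moreover have "variation_upto s / \<epsilon> \<le> enn2real (total_variation UNIV u) / \<epsilon>" for s
        using variation_upto_bounded \<epsilon> by (intro divide_right_mono) auto
      ultimately show ?thesis unfolding k_def by (simp add: image_subset_iff floor_mono)
    qed
    then show "finite Q" unfolding Q_def using finite_subset by blast
    fix x y assume xy: "x \<le> y \<and> {x..y} \<inter> Q = {}"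
    show "v x = v y"
    proof (cases "k x = k y")
      case True
      then show ?thesis unfolding v_def by (simp add: q_eq[OF True])
    next
      case False
      then have x: "k x < k y" using k_mono xy by (simp add: order_less_le)
      have le: "s \<le> y" if "k s < k y" for s using k_less[OF that] by simp
      have "x \<le> Sup {s. k s < k y}" using x le by (intro cSup_upper) (auto intro!: bdd_aboveI)
      moreover have "Sup {s. k s < k y} \<le> y" using x le by (intro cSup_least) auto
      ultimately show ?thesis using xy unfolding Q_def by auto
    qed
  qed
  then show ?thesis using v TV close by blast
qed

lemma bounded_borel_integrable_on:
  fixes f :: "real \<Rightarrow> real"
  assumes "f \<in> borel_measurable borel" and "\<And>s. \<bar>f s\<bar> \<le> c"
  shows "f integrable_on {x..y}"
proof -
  have "set_integrable lborel {x..y} f"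
    unfolding set_integrable_def using assms
    by (intro integrableI_bounded_set_indicator[where B = c])
      (auto simp: emeasure_lborel_Icc_eq)
  then show ?thesis by (rule set_borel_integral_eq_integral(1))
qed

lemma controls_abs_diff_integrable:
  assumes "u \<in> controls \<delta> a" and "w \<in> controls \<delta> a"
  shows "(\<lambda>s. \<bar>u s - w s\<bar>) integrable_on {x..y}"
proof (rule bounded_borel_integrable_on)
  show "(\<lambda>s. \<bar>u s - w s\<bar>) \<in> borel_measurable borel"
    using controls_measurable[OF assms(1)] controls_measurable[OF assms(2)] by measurable
  show "\<bar>\<bar>u s - w s\<bar>\<bar> \<le> 2 * ((1 - \<delta>) / a)" for s
    using controls_abs_le[OF assms(1), of s] controls_abs_le[OF assms(2), of s] by linarith
qed

text \<open>Dominated convergence. The Galerkin solutions depend continuously on the control in \<open>L\<^sup>1\<close>, whereas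
  the approximating controls converge only pointwise.\<close>

lemma controls_L1_convergence:
  fixes v :: "nat \<Rightarrow> real \<Rightarrow> real" and x y :: real
  assumes u: "u \<in> controls \<delta> a" and v: "\<And>n. v n \<in> controls \<delta> a"
    and lim: "\<And>s. (\<lambda>n. v n s) \<longlonglongrightarrow> u s"
  shows "(\<lambda>n. integral {x..y} (\<lambda>s. \<bar>v n s - u s\<bar>)) \<longlonglongrightarrow> 0"
proof -
  have "(\<lambda>n. integral {x..y} (\<lambda>s. \<bar>v n s - u s\<bar>)) \<longlonglongrightarrow> integral {x..y} (\<lambda>s. 0)"
  proof (rule dominated_convergence(2)[where h = "\<lambda>_. 2 * ((1 - \<delta>) / a)"])
    show "norm \<bar>v n s - u s\<bar> \<le> 2 * ((1 - \<delta>) / a)" for n s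
      using controls_abs_le[OF u, of s] controls_abs_le[OF v[of n], of s]
      unfolding real_norm_def by linarith
    show "(\<lambda>n. \<bar>v n s - u s\<bar>) \<longlonglongrightarrow> 0" for s
      using lim[of s] by (intro tendsto_rabs_zero) (simp add: LIM_zero_iff)
  qed (auto intro: controls_abs_diff_integrable[OF v u])
  then show ?thesis by simp
qed

section \<open>Piecewise constant controls\<close>

lemma pc_steps_Nil: "pc_steps u t [] \<longleftrightarrow> t = 0"
  unfolding pc_steps_def by auto

text \<open>Inductions over steps remove the last step, so that the state before it is known.\<close>

lemma pc_steps_snoc:
  "pc_steps u t (xs @ [(\<tau>, v)]) \<longleftrightarrow>
     0 < \<tau> \<and> pc_steps u (t - \<tau>) xs \<and> (\<forall>s. t - \<tau> < s \<and> s < t \<longrightarrow> u s = v)"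
  unfolding pc_steps_def by (auto simp: All_less_Suc nth_append)

lemma pc_steps_nonneg:
  assumes "pc_steps u t xs"
  shows "0 \<le> t"
proof -
  have "0 \<le> sum_list (map fst xs)"
  proof (rule sum_list_nonneg)
    fix \<tau> assume "\<tau> \<in> set (map fst xs)"
    then show "0 \<le> \<tau>" using assms unfolding pc_steps_def by force
  qed
  then show ?thesis using assms unfolding pc_steps_def by simp
qed

text \<open>The last break point of \<open>u\<close> in \<open>(0, t)\<close> starts the last step; before it fewer break points
  remain.\<close>

lemma pc_steps_exist:
  assumes "piecewise_constant u" and "0 \<le> t"
  shows "\<exists>xs. pc_steps u t xs"
proof -
  obtain Q where Q: "finite Q" and const: "\<And>x y. x \<le> y \<Longrightarrow> {x..y} \<inter> Q = {} \<Longrightarrow> u x = u y"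
    using assms(1) unfolding piecewise_constant_def by blast
  have const_on: "u x = u y" if "{r<..<t} \<inter> Q = {}" "r < x" "x < t" "r < y" "y < t" for r t x y
  proof -
    have "u (min x y) = u (max x y)" using that by (intro const) (auto simp: set_eq_iff)
    then show ?thesis by (cases "x \<le> y") auto
  qed
  show ?thesis
    using assms(2)
  proof (induction "card (Q \<inter> {0<..<t})" arbitrary: t rule: less_induct)
    case less
    show ?case
    proof (cases "Q \<inter> {0<..<t} = {}")
      case True
      show ?thesis
      proof (cases "t = 0")
        case True
        then show ?thesis using pc_steps_Nil by blast
      next
        case False
        then have "pc_steps u t ([] @ [(t, u (t / 2))])"
          unfolding pc_steps_snoc using True less.prems
          by (auto simp: pc_steps_Nil intro!: const_on[of 0 t])
        then show ?thesis by blast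
      qed
    next
      case False
      define p where "p = Max (Q \<inter> {0<..<t})"
      have p: "p \<in> Q \<inter> {0<..<t}" unfolding p_def using False Q by (intro Max_in) auto
      have max: "r \<le> p" if "r \<in> Q \<inter> {0<..<t}" for r unfolding p_def using that Q by (intro Max_ge) auto
      have "Q \<inter> {0<..<p} \<subset> Q \<inter> {0<..<t}" using p by auto
      then have "card (Q \<inter> {0<..<p}) < card (Q \<inter> {0<..<t})"
        using Q by (intro psubset_card_mono) auto
      then obtain xs where xs: "pc_steps u p xs" using less.hyps[of p] p by auto
      have "{p<..<t} \<inter> Q = {}" using max p by force
      then have "pc_steps u t (xs @ [(t - p, u ((p + t) / 2))])"
        unfolding pc_steps_snoc using xs p by (auto intro!: const_on[of p t])
      then show ?thesis by blast
    qed
  qed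
qed

lemma pc_steps_has_integral_abs:
  assumes "pc_steps u t xs"
  shows "((\<lambda>s. \<bar>u s\<bar>) has_integral (\<Sum>(\<tau>, v)\<leftarrow>xs. \<tau> * \<bar>v\<bar>)) {0..t}"
  using assms
proof (induction xs arbitrary: t rule: rev_induct)
  case Nil
  then show ?case using has_integral_refl(2)[of "\<lambda>s. \<bar>u s\<bar>" 0] by (simp add: pc_steps_Nil)
next
  case (snoc x xs)
  obtain \<tau> v where x: "x = (\<tau>, v)" by (cases x)
  note st = snoc.prems[unfolded x pc_steps_snoc]
  have "((\<lambda>_. \<bar>v\<bar>) has_integral (\<tau> * \<bar>v\<bar>)) {t - \<tau>..t}"
    using has_integral_const_real[of "\<bar>v\<bar>" "t - \<tau>" t] st by simp
  then have "((\<lambda>s. \<bar>u s\<bar>) has_integral (\<tau> * \<bar>v\<bar>)) {t - \<tau>..t}"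
    using st by (elim has_integral_spike_finite[rotated 2, where S = "{t - \<tau>, t}"]) auto
  then have "((\<lambda>s. \<bar>u s\<bar>) has_integral ((\<Sum>(\<tau>, v)\<leftarrow>xs. \<tau> * \<bar>v\<bar>) + \<tau> * \<bar>v\<bar>)) {0..t}"
    using snoc.IH st pc_steps_nonneg[of u "t - \<tau>" xs]
    by (intro has_integral_combine[where c = "t - \<tau>"]) auto
  then show ?case by (simp add: x)
qed

section \<open>Groups generated by bounded skew-symmetric operators\<close>

text \<open>The source of all isometry and uniqueness statements below: for skew \<open>G\<close> the inner product of two
  solutions of \<open>x' = G x\<close> has derivative zero.\<close>

lemma cinner_constant:
  fixes f g :: "real \<Rightarrow> 'a::complex_hilbert_space"
  assumes "convex S"
    and f: "\<And>s. s \<in> S \<Longrightarrow> (f has_vector_derivative f' s) (at s within S)"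
    and g: "\<And>s. s \<in> S \<Longrightarrow> (g has_vector_derivative g' s) (at s within S)"
    and zero: "\<And>s. s \<in> S \<Longrightarrow> cinner (f s) (g' s) + cinner (f' s) (g s) = 0"
    and "s \<in> S" "t \<in> S"
  shows "cinner (f s) (g s) = cinner (f t) (g t)"
proof -
  have "((\<lambda>s. cinner (f s) (g s)) has_vector_derivative 0) (at s within S)" if "s \<in> S" for s
    using cinner.has_vector_derivative[OF f[OF that] g[OF that]] zero[OF that] by simp
  then obtain c where "\<And>s. s \<in> S \<Longrightarrow> cinner (f s) (g s) = c"
    using has_vector_derivative_zero_constant[OF \<open>convex S\<close>] by blast
  then show ?thesis using assms(5,6) by simp
qed

lemma differentiable_bound_vector:
  fixes f :: "real \<Rightarrow> 'a::real_normed_vector"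
  assumes "\<And>s. s \<in> closed_segment x y \<Longrightarrow> (f has_vector_derivative f' s) (at s)"
    and "\<And>s. s \<in> closed_segment x y \<Longrightarrow> norm (f' s) \<le> c"
  shows "norm (f y - f x) \<le> c * \<bar>y - x\<bar>"
proof -
  have "norm (f y - f x) \<le> c * norm (y - x)"
  proof (rule differentiable_bound[where S = "closed_segment x y" and f' = "\<lambda>s h. h *\<^sub>R f' s"])
    show "(f has_derivative (\<lambda>h. h *\<^sub>R f' s)) (at s within closed_segment x y)"
      if "s \<in> closed_segment x y" for s
      using assms(1)[OF that] has_derivative_at_withinI unfolding has_vector_derivative_def by blast
    show "onorm (\<lambda>h. h *\<^sub>R f' s) \<le> c" if "s \<in> closed_segment x y" for s
      using assms(2)[OF that] by (intro onorm_le) (simp add: mult.commute[of c] mult_left_mono)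
  qed auto
  then show ?thesis by simp
qed

definition oexp_sum :: "('a \<Rightarrow> 'a) \<Rightarrow> nat \<Rightarrow> real \<Rightarrow> 'a::banach \<Rightarrow> 'a" where
  "oexp_sum G n t x = (\<Sum>k<n. (t ^ k / fact k) *\<^sub>R (G ^^ k) x)"

text \<open>The exponential of \<open>t G\<close> applied to \<open>x\<close>, as a series of vectors: the operators need no norm of
  their own.\<close>

definition oexp :: "('a \<Rightarrow> 'a) \<Rightarrow> real \<Rightarrow> 'a::banach \<Rightarrow> 'a" where
  "oexp G t x = (\<Sum>k. (t ^ k / fact k) *\<^sub>R (G ^^ k) x)"

locale bounded_operator =
  fixes G :: "'a::banach \<Rightarrow> 'a"
  assumes bounded_linear: "bounded_linear G"
begin

lemma oexp_sum_derivative: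
  "((\<lambda>t. oexp_sum G (Suc n) t x) has_vector_derivative G (oexp_sum G n t x)) (at t within S)"
proof (induction n)
  case 0
  then show ?case
    using has_vector_derivative_const[of x] by (simp add: oexp_sum_def linear_simps[OF bounded_linear])
next
  case (Suc n)
  have eq: "real (Suc n) * t ^ n / fact (Suc n) = t ^ n / fact n"
    by (simp add: field_simps del: of_nat_Suc)
  have "((\<lambda>t. t ^ Suc n / fact (Suc n)) has_field_derivative
      real (Suc n) * t ^ n / fact (Suc n)) (at t within S)"
    by (rule derivative_eq_intros refl | simp del: fact_Suc power_Suc of_nat_Suc)+
  then have "((\<lambda>t. t ^ Suc n / fact (Suc n)) has_field_derivative t ^ n / fact n) (at t within S)"
    unfolding eq .
  then have "((\<lambda>t. (t ^ Suc n / fact (Suc n)) *\<^sub>R (G ^^ Suc n) x)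
      has_vector_derivative (t ^ n / fact n) *\<^sub>R (G ^^ Suc n) x) (at t within S)"
    unfolding has_real_derivative_iff_has_vector_derivative
    by (rule bounded_linear.has_vector_derivative[OF bounded_linear_scaleR_left])
  from has_vector_derivative_add[OF Suc this] show ?case
    by (simp add: oexp_sum_def linear_simps[OF bounded_linear])
qed

lemma oexp_sum_uniform_limit:
  assumes "0 \<le> r"
  shows "uniform_limit {-r<..<r} (\<lambda>n t. oexp_sum G n t x) (\<lambda>t. oexp G t x) sequentially"
proof -
  obtain K where K: "\<And>y. norm (G y) \<le> norm y * K" "K > 0"
    using bounded_linear.pos_bounded[OF bounded_linear] by blast
  have pow: "norm ((G ^^ k) x) \<le> K ^ k * norm x" for k
  proof (induction k)
    case (Suc k)
    have "norm ((G ^^ Suc k) x) \<le> norm ((G ^^ k) x) * K" using K by simp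
    also have "\<dots> \<le> K ^ k * norm x * K" using Suc K by (intro mult_right_mono) auto
    finally show ?case by (simp add: mult_ac)
  qed simp
  have "norm ((t ^ k / fact k) *\<^sub>R (G ^^ k) x) \<le> inverse (fact k) * (r * K) ^ k * norm x"
    if "t \<in> {-r<..<r}" for k t
  proof -
    have "\<bar>t\<bar> ^ k \<le> r ^ k" using that by (intro power_mono) auto
    then have "norm ((t ^ k / fact k) *\<^sub>R (G ^^ k) x) \<le> (r ^ k / fact k) * (K ^ k * norm x)"
      using pow[of k] assms K
      by (simp only: norm_scaleR) (intro mult_mono, auto simp: power_abs divide_right_mono)
    then show ?thesis by (simp add: power_mult_distrib divide_inverse mult_ac)
  qed
  moreover have "summable (\<lambda>k. inverse (fact k) * (r * K) ^ k * norm x)"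
    by (intro summable_mult2 summable_exp)
  ultimately show ?thesis
    unfolding oexp_sum_def oexp_def by (rule Weierstrass_m_test)
qed

text \<open>Differentiation term by term. The derivative of a partial sum is \<open>G\<close> applied to the preceding
  one, so locally uniform convergence of the series gives that of the derivatives.\<close>

lemma oexp_derivative:
  "((\<lambda>t. oexp G t x) has_vector_derivative G (oexp G t x)) (at t)"
proof -
  define r where "r = \<bar>t\<bar> + 1"
  define S where "S = {-r<..<r}"
  have t: "t \<in> S" unfolding S_def r_def by auto
  have lim: "uniform_limit S (\<lambda>n t. oexp_sum G n t x) (\<lambda>t. oexp G t x) sequentially"
    unfolding S_def by (rule oexp_sum_uniform_limit) (simp add: r_def)
  obtain K where K: "\<And>y. norm (G y) \<le> norm y * K" "K > 0"
    using bounded_linear.pos_bounded[OF bounded_linear] by blast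
  have "\<exists>g. \<forall>s\<in>S. (\<lambda>n. oexp_sum G (Suc n) s x) \<longlonglongrightarrow> g s \<and>
      (g has_derivative (\<lambda>h. h *\<^sub>R G (oexp G s x))) (at s within S)"
  proof (rule has_derivative_sequence)
    show "convex S" "t \<in> S" using t by (auto simp: S_def)
    show "((\<lambda>t. oexp_sum G (Suc n) t x) has_derivative (\<lambda>h. h *\<^sub>R G (oexp_sum G n s x))) (at s within S)"
      for n s
      using oexp_sum_derivative unfolding has_vector_derivative_def .
    show "(\<lambda>n. oexp_sum G (Suc n) t x) \<longlonglongrightarrow> oexp G t x"
      using tendsto_uniform_limitI[OF lim t] by (rule LIMSEQ_Suc)
    fix e :: real assume e: "e > 0"
    have "\<forall>\<^sub>F n in sequentially. \<forall>s\<in>S. dist (oexp_sum G n s x) (oexp G s x) < e / K"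
      using uniform_limitD[OF lim] e K by simp
    then show "\<forall>\<^sub>F n in sequentially. \<forall>s\<in>S. \<forall>h.
        norm (h *\<^sub>R G (oexp_sum G n s x) - h *\<^sub>R G (oexp G s x)) \<le> e * norm h"
    proof eventually_elim
      case (elim n)
      show ?case
      proof (intro ballI allI)
        fix s and h :: real assume "s \<in> S"
        with elim have "norm (oexp_sum G n s x - oexp G s x) * K \<le> e"
          using K by (simp add: dist_norm field_simps less_imp_le)
        then have "norm (G (oexp_sum G n s x - oexp G s x)) \<le> e"
          using K(1) order_trans by blast
        then show "norm (h *\<^sub>R G (oexp_sum G n s x) - h *\<^sub>R G (oexp G s x)) \<le> e * norm h"
          by (simp add: scaleR_diff_right[symmetric] linear_simps[OF bounded_linear] mult.commute[of e]
              mult_left_mono)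
      qed
    qed
  qed
  then obtain g where g: "\<And>s. s \<in> S \<Longrightarrow> (\<lambda>n. oexp_sum G (Suc n) s x) \<longlonglongrightarrow> g s"
    and g': "(g has_derivative (\<lambda>h. h *\<^sub>R G (oexp G t x))) (at t within S)" using t by blast
  have eq: "oexp G s x = g s" if "s \<in> S" for s
    using LIMSEQ_unique[OF LIMSEQ_Suc[OF tendsto_uniform_limitI[OF lim that]] g[OF that]] .
  have "((\<lambda>t. oexp G t x) has_derivative (\<lambda>h. h *\<^sub>R G (oexp G t x))) (at t within S)"
    using g' t by (rule has_derivative_transform[rotated 2]) (rule eq)
  moreover have "at t within S = at t"
    using t by (rule at_within_open) (simp add: S_def)
  ultimately show ?thesis
    unfolding has_vector_derivative_def by simp
qed

lemma oexp_zero: "oexp G 0 x = x"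
proof -
  have "oexp G 0 x = (\<Sum>k\<in>{0}. (0 ^ k / fact k) *\<^sub>R (G ^^ k) x)"
    unfolding oexp_def by (intro suminf_finite) auto
  then show ?thesis by simp
qed

end

locale skew_bounded = bounded_operator G for G :: "'a::complex_hilbert_space \<Rightarrow> 'a" +
  assumes scaleC: "G (z *\<^sub>C x) = z *\<^sub>C G x"
    and skew: "cinner (G x) y = - cinner x (G y)"
begin

sublocale bounded_linear G by (rule bounded_linear)

lemma Re_cinner_skew: "Re (cinner x (G x)) = 0"
proof -
  have "Re (cinner x (G x)) = Re (cinner (G x) x)"
    by (subst cinner_commute) simp
  then show ?thesis by (simp add: skew)
qed

text \<open>The difference of two solutions is a solution, hence has constant norm. The algebraic properties of
  the exponential follow, since in each case both sides solve the same equation.\<close>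

lemma ode_unique:
  assumes "convex S"
    and x: "\<And>s. s \<in> S \<Longrightarrow> (x has_vector_derivative G (x s)) (at s within S)"
    and y: "\<And>s. s \<in> S \<Longrightarrow> (y has_vector_derivative G (y s)) (at s within S)"
    and "s0 \<in> S" "x s0 = y s0" "s \<in> S"
  shows "x s = y s"
proof -
  have d: "((\<lambda>s. x s - y s) has_vector_derivative G (x s - y s)) (at s within S)" if "s \<in> S" for s
    using has_vector_derivative_diff[OF x[OF that] y[OF that]] by (simp add: diff)
  have "cinner (x s - y s) (x s - y s) = cinner (x s0 - y s0) (x s0 - y s0)"
    by (rule cinner_constant[OF \<open>convex S\<close> d d]) (use assms skew in auto)
  then show ?thesis using assms(5) by (simp add: cinner_eq_zero_iff)
qed

lemma oexp_unique:
  assumes "\<And>s. (x has_vector_derivative G (x s)) (at s)"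
  shows "x s = oexp G s (x 0)"
  by (rule ode_unique[of UNIV x "\<lambda>s. oexp G s (x 0)" 0])
    (simp_all add: assms oexp_derivative oexp_zero)

lemma oexp_plus: "oexp G (s + t) x = oexp G s (oexp G t x)"
proof -
  have "((\<lambda>r. oexp G (r + t) x) has_vector_derivative G (oexp G (r + t) x)) (at r)" for r
  proof -
    have "((\<lambda>r. r + t) has_vector_derivative 1) (at r)"
      by (auto intro!: derivative_eq_intros)
    from vector_diff_chain_at[OF this oexp_derivative] show ?thesis by (simp add: o_def)
  qed
  from oexp_unique[OF this, of s] show ?thesis by simp
qed

lemma oexp_add: "oexp G t (x + y) = oexp G t x + oexp G t y"
proof -
  have "((\<lambda>r. oexp G r x + oexp G r y) has_vector_derivative G (oexp G r x + oexp G r y)) (at r)" for r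
    using has_vector_derivative_add[OF oexp_derivative oexp_derivative] by (simp add: add)
  from oexp_unique[OF this, of t] show ?thesis by (simp add: oexp_zero)
qed

lemma oexp_scaleC: "oexp G t (z *\<^sub>C x) = z *\<^sub>C oexp G t x"
proof -
  have "((\<lambda>r. z *\<^sub>C oexp G r x) has_vector_derivative G (z *\<^sub>C oexp G r x)) (at r)" for r
    using bounded_linear.has_vector_derivative[OF scaleC.bounded_linear_right oexp_derivative]
    by (simp add: scaleC)
  from oexp_unique[OF this, of t] show ?thesis by (simp add: oexp_zero)
qed

lemma oexp_diff: "oexp G t (x - y) = oexp G t x - oexp G t y"
  using oexp_add[of t "x - y" y] by simp

lemma oexp_commute: "G (oexp G t x) = oexp G t (G x)"
proof -
  have "((\<lambda>r. G (oexp G r x)) has_vector_derivative G (G (oexp G r x))) (at r)" for r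
    using bounded_linear.has_vector_derivative[OF bounded_linear oexp_derivative] .
  from oexp_unique[OF this, of t] show ?thesis by (simp add: oexp_zero)
qed

lemma cinner_oexp: "cinner (oexp G t x) (oexp G t y) = cinner x y"
proof -
  have "cinner (oexp G t x) (oexp G t y) = cinner (oexp G 0 x) (oexp G 0 y)"
    by (rule cinner_constant[of UNIV _ "\<lambda>t. G (oexp G t x)" _ "\<lambda>t. G (oexp G t y)"])
      (use oexp_derivative skew in auto)
  then show ?thesis by (simp add: oexp_zero)
qed

lemma norm_oexp [simp]: "norm (oexp G t x) = norm x"
proof -
  have "complex_of_real ((norm (oexp G t x))\<^sup>2) = complex_of_real ((norm x)\<^sup>2)"
    by (simp only: cinner_same[symmetric] cinner_oexp)
  then have "(norm (oexp G t x))\<^sup>2 = (norm x)\<^sup>2" by (rule of_real_eq_iff[THEN iffD1])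
  then show ?thesis by (simp add: power2_eq_iff_nonneg)
qed

lemma oexp_lipschitz: "norm (oexp G t x - oexp G s x) \<le> norm (G x) * \<bar>t - s\<bar>"
  by (rule differentiable_bound_vector[OF oexp_derivative]) (simp add: oexp_commute)

text \<open>The bound involves no second power of \<open>G\<close>. This matters because it is applied to the
  compressions, whose norms grow with the order.\<close>

lemma oexp_remainder:
  assumes "\<And>s. \<bar>s\<bar> \<le> \<bar>h\<bar> \<Longrightarrow> norm (oexp G s (G x) - G x) \<le> c"
  shows "norm (oexp G h x - x - h *\<^sub>R G x) \<le> c * \<bar>h\<bar>"
proof -
  have "norm ((oexp G h x - h *\<^sub>R G x) - (oexp G 0 x - 0 *\<^sub>R G x)) \<le> c * \<bar>h - 0\<bar>"
  proof (rule differentiable_bound_vector)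
    show "((\<lambda>h. oexp G h x - h *\<^sub>R G x) has_vector_derivative oexp G s (G x) - G x) (at s)" for s
      by (auto intro!: derivative_eq_intros oexp_derivative simp: oexp_commute)
    show "norm (oexp G s (G x) - G x) \<le> c" if "s \<in> closed_segment 0 h" for s
      using that by (intro assms) (auto simp: closed_segment_eq_real_ivl split: if_splits)
  qed
  then show ?thesis by (simp add: oexp_zero algebra_simps)
qed

text \<open>The skew part of the equation does not contribute to the growth of the norm. The norm is
  smoothed by \<open>\<kappa>\<close> because it is not differentiable at the origin.\<close>

lemma inhomogeneous_ode_bound:
  assumes z: "\<And>s. (z has_vector_derivative G (z s) + g s) (at s)"
    and g: "\<And>s. norm (g s) \<le> \<eta>" and "z 0 = 0"
  shows "norm (z t) \<le> \<eta> * \<bar>t\<bar>"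
proof -
  have \<eta>: "0 \<le> \<eta>" using g[of 0] norm_ge_zero order_trans by blast
  have "norm (z t) \<le> \<eta> * \<bar>t\<bar> + \<kappa>" if \<kappa>: "\<kappa> > 0" for \<kappa>
  proof -
    define h where "h s = sqrt ((norm (z s))\<^sup>2 + \<kappa>\<^sup>2)" for s
    have pos: "0 < (norm (z s))\<^sup>2 + \<kappa>\<^sup>2" for s using \<kappa> by (simp add: add_nonneg_pos)
    have hpos: "h s > 0" for s unfolding h_def using pos by simp
    have zh: "norm (z s) \<le> h s" for s unfolding h_def by (rule real_le_rsqrt) simp
    have "((\<lambda>s. (norm (z s))\<^sup>2) has_vector_derivative 2 * Re (cinner (z s) (g s))) (at s)" for s
    proof -
      have "((\<lambda>s. Re (cinner (z s) (z s))) has_vector_derivative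
          Re (cinner (z s) (G (z s) + g s) + cinner (G (z s) + g s) (z s))) (at s)"
        by (rule bounded_linear.has_vector_derivative[OF bounded_linear_Re
              cinner.has_vector_derivative[OF z z]])
      moreover have "Re (cinner (G (z s) + g s) (z s)) = Re (cinner (z s) (G (z s) + g s))"
        by (subst cinner_commute) simp
      ultimately show ?thesis by (simp add: cinner_same cinner_add_right Re_cinner_skew)
    qed
    then have d2: "((\<lambda>s. (norm (z s))\<^sup>2) has_real_derivative 2 * Re (cinner (z s) (g s))) (at s)" for s
      by (simp add: has_real_derivative_iff_has_vector_derivative)
    have h': "(h has_vector_derivative Re (cinner (z s) (g s)) / h s) (at s)" for s
    proof -
      have "((\<lambda>s. (norm (z s))\<^sup>2 + \<kappa>\<^sup>2) has_real_derivative 2 * Re (cinner (z s) (g s))) (at s)"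
        using DERIV_add[OF d2 DERIV_const[of "\<kappa>\<^sup>2"]] by simp
      from DERIV_chain2[OF DERIV_real_sqrt[OF pos] this]
      have "(h has_real_derivative
          inverse (sqrt ((norm (z s))\<^sup>2 + \<kappa>\<^sup>2)) / 2 * (2 * Re (cinner (z s) (g s)))) (at s)"
        unfolding h_def[abs_def] .
      moreover have "inverse (sqrt ((norm (z s))\<^sup>2 + \<kappa>\<^sup>2)) / 2 * (2 * Re (cinner (z s) (g s)))
          = Re (cinner (z s) (g s)) / h s"
        unfolding h_def by (simp add: inverse_eq_divide)
      ultimately show ?thesis
        by (simp only: has_real_derivative_iff_has_vector_derivative)
    qed
    have "norm (h t - h 0) \<le> \<eta> * \<bar>t - 0\<bar>"
    proof (rule differentiable_bound_vector[OF h'])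
      fix s
      have "\<bar>Re (cinner (z s) (g s))\<bar> \<le> norm (z s) * norm (g s)"
        using abs_Re_le_cmod norm_cinner_le order_trans by blast
      also have "\<dots> \<le> h s * \<eta>" using zh g hpos[of s] by (intro mult_mono) auto
      finally show "norm (Re (cinner (z s) (g s)) / h s) \<le> \<eta>"
        using hpos[of s] by (simp add: field_simps)
    qed
    moreover have "h 0 = \<kappa>" unfolding h_def using \<kappa> assms(3) by simp
    ultimately show ?thesis using zh[of t] by (simp add: abs_le_iff)
  qed
  then show ?thesis by (rule field_le_epsilon)
qed

text \<open>Duhamel's formula as an inequality. The perturbation is evaluated along the flow of \<open>G\<close> only, so
  regularity needs to be known for one of the two flows.\<close>

lemma oexp_compare:
  assumes "skew_bounded G'"
    and "\<And>s. norm (G (oexp G s x) - G' (oexp G s x)) \<le> \<eta>"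
  shows "norm (oexp G t x - oexp G' t x) \<le> \<eta> * \<bar>t\<bar>"
proof -
  interpret G': skew_bounded G' by fact
  show ?thesis
  proof (rule G'.inhomogeneous_ode_bound)
    show "((\<lambda>s. oexp G s x - oexp G' s x) has_vector_derivative
        G' (oexp G s x - oexp G' s x) + (G (oexp G s x) - G' (oexp G s x))) (at s)" for s
      using has_vector_derivative_diff[OF oexp_derivative[of x s] G'.oexp_derivative[of x s]]
      by (simp add: G'.diff)
  qed (use assms in \<open>auto simp: oexp_zero G'.oexp_zero\<close>)
qed

end

section \<open>The pair of operators and its compressions\<close>

lemma linear_operator_sum:
  assumes "linear_operator D T" and "finite I" and "\<And>i. i \<in> I \<Longrightarrow> f i \<in> D"
  shows "(\<Sum>i\<in>I. c i *\<^sub>C f i) \<in> D" and "T (\<Sum>i\<in>I. c i *\<^sub>C f i) = (\<Sum>i\<in>I. c i *\<^sub>C T (f i))"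
proof -
  note sub = assms(1)[unfolded linear_operator_def]
  have zero: "T 0 = 0"
    using sub cvs.subspace_0[of D] by (metis scaleC.zero_left)
  have "(\<Sum>i\<in>I. c i *\<^sub>C f i) \<in> D \<and> T (\<Sum>i\<in>I. c i *\<^sub>C f i) = (\<Sum>i\<in>I. c i *\<^sub>C T (f i))"
    using assms(2,3)
  proof (induction I)
    case empty
    then show ?case using sub zero cvs.subspace_0 by auto
  next
    case (insert i I)
    then have "f i \<in> D" "(\<Sum>i\<in>I. c i *\<^sub>C f i) \<in> D"
      "T (\<Sum>i\<in>I. c i *\<^sub>C f i) = (\<Sum>i\<in>I. c i *\<^sub>C T (f i))" by auto
    moreover from this have "c i *\<^sub>C f i \<in> D" using sub cvs.subspace_scale by blast
    ultimately show ?case using insert.hyps sub by (simp add: cvs.subspace_add)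
  qed
  then show "(\<Sum>i\<in>I. c i *\<^sub>C f i) \<in> D"
    and "T (\<Sum>i\<in>I. c i *\<^sub>C f i) = (\<Sum>i\<in>I. c i *\<^sub>C T (f i))" by auto
qed

locale galerkin_setting = hilbert_basis_setting \<phi>
  for \<phi> :: "nat \<Rightarrow> 'a::complex_hilbert_space" +
  fixes A B :: "'a \<Rightarrow> 'a" and DA DB :: "'a set" and a b d \<alpha> :: real and lam :: "nat \<Rightarrow> real"
  assumes a_pos: "a > 0" and b_nonneg: "b \<ge> 0" and d_nonneg: "d \<ge> 0" and \<alpha>_less: "\<alpha> < 1"
    and A_skew_adjoint: "skew_adjoint DA A" and B_skew_symmetric: "skew_symmetric DB B"
    and DA_subset_DB: "DA \<subseteq> DB"
    and B_bound: "\<And>x. x \<in> DA \<Longrightarrow> norm (B x) \<le> a * norm (A x) + b * norm x"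
    and B_fractional_bound: "\<And>x. x \<in> abs_pow_dom \<phi> lam \<alpha> \<Longrightarrow> norm (B x) \<le> d * norm (abs_pow \<phi> lam \<alpha> x)"
    and A_spectrum: "op_spectrum DA A = range (\<lambda>j. - \<i> * complex_of_real (lam j))"
    and lam_at_top: "filterlim lam at_top sequentially"
    and eigen: "\<And>j. \<phi> j \<in> DA \<and> A (\<phi> j) = (- \<i> * complex_of_real (lam j)) *\<^sub>C \<phi> j"
begin

lemma A_linear: "linear_operator DA A" and DA_dense: "closure DA = UNIV"
  using A_skew_adjoint unfolding skew_adjoint_def by auto

lemma B_linear: "linear_operator DA B"
  using B_skew_symmetric A_linear DA_subset_DB
  unfolding skew_symmetric_def linear_operator_def by blast

lemma subspace_DA: "cvs.subspace DA"
  using A_linear unfolding linear_operator_def by auto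

lemma DA_diff: "x \<in> DA \<Longrightarrow> y \<in> DA \<Longrightarrow> x - y \<in> DA"
  by (rule cvs.subspace_diff[OF subspace_DA])

lemma linear_operator_diff:
  assumes "linear_operator DA T" "x \<in> DA" "y \<in> DA"
  shows "T (x - y) = T x - T y"
  using assms DA_diff[of x y] unfolding linear_operator_def
  by (metis diff_add_cancel add_diff_cancel)

lemmas A_diff = linear_operator_diff[OF A_linear]
  and B_diff = linear_operator_diff[OF B_linear]

lemma A_scaleC: "x \<in> DA \<Longrightarrow> A (z *\<^sub>C x) = z *\<^sub>C A x"
  and B_add: "x \<in> DA \<Longrightarrow> y \<in> DA \<Longrightarrow> B (x + y) = B x + B y"
  and B_scaleC: "x \<in> DA \<Longrightarrow> B (z *\<^sub>C x) = z *\<^sub>C B x"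
  using A_linear B_linear unfolding linear_operator_def by auto

text \<open>The witness in the definition of the adjoint domain is unique by density, hence equal to \<open>- A x\<close>.\<close>

lemma A_skew:
  assumes "x \<in> DA" "y \<in> DA"
  shows "cinner (A x) y = - cinner x (A y)"
proof -
  have "x \<in> adjoint_dom DA A" using A_skew_adjoint assms unfolding skew_adjoint_def by auto
  then obtain z where z: "\<forall>w\<in>DA. cinner x (A w) = cinner z w"
    unfolding adjoint_dom_def by auto
  have "adjoint_op DA A x = z"
    unfolding adjoint_op_def
  proof (rule the_equality)
    fix z' assume "\<forall>w\<in>DA. cinner x (A w) = cinner z' w"
    with z show "z' = z" by (intro cinner_right_eqI_dense[OF DA_dense]) auto
  qed (rule z)
  moreover have "adjoint_op DA A x = - A x"
    using A_skew_adjoint assms unfolding skew_adjoint_def by auto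
  ultimately show ?thesis using z assms by (auto simp: cinner_minus_left)
qed

lemma B_skew: "x \<in> DA \<Longrightarrow> y \<in> DA \<Longrightarrow> cinner (B x) y = - cinner x (B y)"
  using B_skew_symmetric DA_subset_DB unfolding skew_symmetric_def by blast

lemma basis_DA: "\<phi> j \<in> DA"
  using eigen by simp

lemma proj_DA [simp]: "P N x \<in> DA"
  unfolding galerkin_proj_def
  by (rule linear_operator_sum(1)[OF A_linear]) (auto simp: basis_DA)

lemma linear_operator_proj:
  assumes "linear_operator DA T"
  shows "T (P N x) = (\<Sum>j\<le>N. cinner (\<phi> j) x *\<^sub>C T (\<phi> j))"
  unfolding galerkin_proj_def
  by (rule linear_operator_sum(2)[OF assms]) (auto simp: basis_DA)

lemma cinner_basis_A:
  assumes "x \<in> DA"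
  shows "cinner (\<phi> j) (A x) = - \<i> * complex_of_real (lam j) * cinner (\<phi> j) x"
  using A_skew[OF basis_DA assms, of j] eigen[of j]
  by (simp add: cinner_scaleC_left cinner_minus_left scaleC.minus_left minus_equation_iff)

text \<open>The projections are spectral projections of \<open>A\<close>.\<close>

lemma A_proj: "x \<in> DA \<Longrightarrow> A (P N x) = P N (A x)"
  unfolding linear_operator_proj[OF A_linear] galerkin_proj_def[of \<phi> N "A x"]
  using eigen by (intro sum.cong) (simp_all add: cinner_basis_A scaleC_scaleC mult_ac)

lemma proj_A_proj: "P N (A (P N x)) = A (P N x)"
  using A_proj[of "P N x" N] by simp

text \<open>If \<open>\<Sum>\<^sub>j \<bar>\<lambda>\<^sub>j x\<^sub>j\<bar>\<^sup>2\<close> is finite, the vectors \<open>A \<pi>\<^sub>n x\<close> converge to some \<open>w\<close>, and \<open>-w\<close> witnesses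
  that \<open>x\<close> belongs to the domain of the adjoint of \<open>A\<close>, which is the domain of \<open>A\<close>.\<close>

lemma abs_pow_dom_1_subset: "abs_pow_dom \<phi> lam 1 \<subseteq> DA"
proof
  fix x assume "x \<in> abs_pow_dom \<phi> lam 1"
  then have sm: "summable (\<lambda>j. (cmod (cinner (\<phi> j) x * (- \<i> * complex_of_real (lam j))))\<^sup>2)"
    by (simp add: diag_dom_def abs_pow_entry_def norm_mult mult.commute)
  then obtain w where w: "(\<lambda>n. \<Sum>j\<le>n. (cinner (\<phi> j) x * (- \<i> * complex_of_real (lam j))) *\<^sub>C \<phi> j) \<longlonglongrightarrow> w"
    using basis_series_converges[OF sm] unfolding convergent_def by blast
  have "(\<Sum>j\<le>n. (cinner (\<phi> j) x * (- \<i> * complex_of_real (lam j))) *\<^sub>C \<phi> j) = A (P n x)" for n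
    unfolding linear_operator_proj[OF A_linear] using eigen by (simp add: scaleC_scaleC)
  with w have w: "(\<lambda>n. A (P n x)) \<longlonglongrightarrow> w" by simp
  have "cinner x (A y) = cinner (- w) y" if y: "y \<in> DA" for y
  proof (rule LIMSEQ_unique)
    show "(\<lambda>n. cinner (P n x) (A y)) \<longlonglongrightarrow> cinner x (A y)"
      by (intro cinner.tendsto proj_tendsto tendsto_const)
    have "cinner (P n x) (A y) = cinner (- A (P n x)) y" for n
      using A_skew[OF proj_DA y] by (simp add: cinner_minus_left)
    then show "(\<lambda>n. cinner (P n x) (A y)) \<longlonglongrightarrow> cinner (- w) y"
      using w by (auto intro!: cinner.tendsto tendsto_minus tendsto_const)
  qed
  then have "x \<in> adjoint_dom DA A" unfolding adjoint_dom_def by blast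
  then show "x \<in> DA" using A_skew_adjoint unfolding skew_adjoint_def by simp
qed

subsection \<open>Compactness of the perturbation relative to \<open>A\<close>\<close>

lemma B_bound_basis_sum:
  assumes "finite I"
  shows "norm (B (\<Sum>j\<in>I. c j *\<^sub>C \<phi> j)) \<le> d * norm (\<Sum>j\<in>I. (abs_pow_entry lam \<alpha> j * c j) *\<^sub>C \<phi> j)"
proof -
  define y where "y = (\<Sum>j\<in>I. c j *\<^sub>C \<phi> j)"
  have c: "cinner (\<phi> j) y = (if j \<in> I then c j else 0)" for j
    unfolding y_def by (rule cinner_basis_sum[OF assms])
  have "y \<in> abs_pow_dom \<phi> lam \<alpha>"
    unfolding diag_dom_def mem_Collect_eq by (rule summable_finite[OF assms]) (simp add: c)
  moreover have "abs_pow \<phi> lam \<alpha> y = (\<Sum>j\<in>I. (abs_pow_entry lam \<alpha> j * cinner (\<phi> j) y) *\<^sub>C \<phi> j)"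
    unfolding diag_op_def by (rule suminf_finite[OF assms]) (simp add: c)
  ultimately have "norm (B y) \<le> d * norm (\<Sum>j\<in>I. (abs_pow_entry lam \<alpha> j * cinner (\<phi> j) y) *\<^sub>C \<phi> j)"
    using B_fractional_bound[of y] by simp
  moreover have "(\<Sum>j\<in>I. (abs_pow_entry lam \<alpha> j * cinner (\<phi> j) y) *\<^sub>C \<phi> j)
      = (\<Sum>j\<in>I. (abs_pow_entry lam \<alpha> j * c j) *\<^sub>C \<phi> j)"
    by (intro sum.cong) (simp_all add: c)
  ultimately show ?thesis unfolding y_def by simp
qed

lemma fractional_power_negligible:
  assumes "\<eta> > 0"
  shows "\<forall>\<^sub>F j in sequentially. d * cmod (abs_pow_entry lam \<alpha> j) \<le> \<eta> * \<bar>lam j\<bar>"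
proof -
  have "((\<lambda>j. d * lam j powr (\<alpha> - 1)) \<longlongrightarrow> d * 0) sequentially"
    using \<alpha>_less by (intro tendsto_mult tendsto_const tendsto_neg_powr lam_at_top) auto
  then have "\<forall>\<^sub>F j in sequentially. d * lam j powr (\<alpha> - 1) < \<eta>"
    using assms by (intro order_tendstoD(2)) auto
  moreover have "\<forall>\<^sub>F j in sequentially. lam j > 0"
    using lam_at_top by (simp add: filterlim_at_top_dense)
  ultimately show ?thesis
  proof eventually_elim
    case (elim j)
    have "cmod (abs_pow_entry lam \<alpha> j) = lam j powr (\<alpha> - 1) * lam j"
      using elim(2) by (simp add: abs_pow_entry_def powr_diff)
    then have "d * cmod (abs_pow_entry lam \<alpha> j) = d * lam j powr (\<alpha> - 1) * lam j" by simp
    also have "\<dots> \<le> \<eta> * lam j" using elim by (intro mult_right_mono) auto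
    finally show ?case using elim(2) by simp
  qed
qed

text \<open>High modes are controlled because \<open>\<bar>\<lambda>\<^sub>j\<bar>\<^sup>\<alpha>\<close> is small compared to \<open>\<bar>\<lambda>\<^sub>j\<bar>\<close>, and the low modes
  form a space of finite dimension. So \<open>B\<close> maps graph-bounded sets to totally bounded sets,
  on which the projections converge uniformly.\<close>

lemma proj_B_uniform:
  assumes "\<eta> > 0"
  shows "\<exists>N0. \<forall>N\<ge>N0. \<forall>K x. P K x = x \<longrightarrow> norm (B x - P N (B x)) \<le> \<eta> * (norm (A x) + norm x)"
proof -
  obtain L where L: "\<And>j. j \<ge> L \<Longrightarrow> d * cmod (abs_pow_entry lam \<alpha> j) \<le> \<eta> * \<bar>lam j\<bar>"
    using fractional_power_negligible[OF assms] unfolding eventually_sequentially by blast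
  have "(\<lambda>N. \<Sum>j\<le>L. norm (B (\<phi> j) - P N (B (\<phi> j)))) \<longlonglongrightarrow> (\<Sum>j\<le>L. norm (B (\<phi> j) - B (\<phi> j)))"
    by (intro tendsto_sum tendsto_norm tendsto_diff tendsto_const proj_tendsto)
  then have "\<forall>\<^sub>F N in sequentially. (\<Sum>j\<le>L. norm (B (\<phi> j) - P N (B (\<phi> j)))) < \<eta>"
    using assms by (intro order_tendstoD(2)) auto
  then obtain N0 where N0: "\<And>N. N \<ge> N0 \<Longrightarrow> (\<Sum>j\<le>L. norm (B (\<phi> j) - P N (B (\<phi> j)))) < \<eta>"
    unfolding eventually_sequentially by blast
  have "norm (B x - P N (B x)) \<le> \<eta> * (norm (A x) + norm x)" if "N \<ge> N0" and x: "P K x = x" for N K x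
  proof -
    have xD: "x \<in> DA" using proj_DA[of K x] x by simp
    define y where "y = x - P L x"
    have yD: "y \<in> DA" unfolding y_def using xD by (intro DA_diff) auto
    have coeff: "cinner (\<phi> j) y = (if j \<in> {L<..K} then cinner (\<phi> j) x else 0)" for j
      using cinner_basis_proj[of j K x] unfolding x
      by (auto simp: y_def cinner.diff_right cinner_basis_proj split: if_splits)
    have y: "y = (\<Sum>j\<in>{L<..K}. cinner (\<phi> j) x *\<^sub>C \<phi> j)"
      by (rule basis_eqI) (simp only: coeff cinner_basis_sum finite_greaterThanAtMost)
    have Ay: "A y = (\<Sum>j\<in>{L<..K}. (- \<i> * complex_of_real (lam j) * cinner (\<phi> j) x) *\<^sub>C \<phi> j)"
      by (rule basis_eqI)
        (simp only: cinner_basis_A[OF yD] coeff cinner_basis_sum finite_greaterThanAtMost, simp)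
    have "norm (B y) \<le> d * norm (\<Sum>j\<in>{L<..K}. (abs_pow_entry lam \<alpha> j * cinner (\<phi> j) x) *\<^sub>C \<phi> j)"
      unfolding y by (rule B_bound_basis_sum) simp
    also have "\<dots> = norm (\<Sum>j\<in>{L<..K}. (d * (abs_pow_entry lam \<alpha> j * cinner (\<phi> j) x)) *\<^sub>C \<phi> j)"
    proof -
      have "(\<Sum>j\<in>{L<..K}. (d * (abs_pow_entry lam \<alpha> j * cinner (\<phi> j) x)) *\<^sub>C \<phi> j)
          = complex_of_real d *\<^sub>C (\<Sum>j\<in>{L<..K}. (abs_pow_entry lam \<alpha> j * cinner (\<phi> j) x) *\<^sub>C \<phi> j)"
        by (simp add: scaleC.sum_right scaleC_scaleC)
      then show ?thesis using d_nonneg by (simp add: norm_scaleC)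
    qed
    also have "\<dots> \<le> norm (\<Sum>j\<in>{L<..K}. (\<eta> * (- \<i> * complex_of_real (lam j) * cinner (\<phi> j) x)) *\<^sub>C \<phi> j)"
    proof (rule norm_basis_sum_mono)
      fix j assume "j \<in> {L<..K}"
      then have "d * cmod (abs_pow_entry lam \<alpha> j) \<le> \<eta> * \<bar>lam j\<bar>" using L by auto
      then have "d * cmod (abs_pow_entry lam \<alpha> j) * cmod (cinner (\<phi> j) x) \<le> \<eta> * \<bar>lam j\<bar> * cmod (cinner (\<phi> j) x)"
        by (rule mult_right_mono) simp
      then show "cmod (d * (abs_pow_entry lam \<alpha> j * cinner (\<phi> j) x))
          \<le> cmod (\<eta> * (- \<i> * complex_of_real (lam j) * cinner (\<phi> j) x))"
        using d_nonneg assms by (simp add: norm_mult)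
    qed simp
    also have "\<dots> = \<eta> * norm (A y)"
    proof -
      have "(\<Sum>j\<in>{L<..K}. (\<eta> * (- \<i> * complex_of_real (lam j) * cinner (\<phi> j) x)) *\<^sub>C \<phi> j)
          = complex_of_real \<eta> *\<^sub>C A y"
        unfolding Ay by (simp add: scaleC.sum_right scaleC_scaleC)
      then show ?thesis using assms by (simp add: norm_scaleC)
    qed
    also have "A y = A x - P L (A x)"
      unfolding y_def using xD by (simp add: A_diff A_proj)
    also have "\<eta> * norm (A x - P L (A x)) \<le> \<eta> * norm (A x)"
      using assms norm_proj_compl_le by (intro mult_left_mono) auto
    finally have high: "norm (B y) \<le> \<eta> * norm (A x)" .
    have "B (P L x) - P N (B (P L x)) = (\<Sum>j\<le>L. cinner (\<phi> j) x *\<^sub>C (B (\<phi> j) - P N (B (\<phi> j))))"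
      unfolding linear_operator_proj[OF B_linear]
      by (simp add: linear_sum[OF proj_linear] proj_scaleC scaleC.diff_right sum_subtractf)
    also have "norm \<dots> \<le> (\<Sum>j\<le>L. norm x * norm (B (\<phi> j) - P N (B (\<phi> j))))"
      using norm_cinner_le[of "\<phi> _" x]
      by (intro sum_norm_le) (simp add: norm_scaleC mult_right_mono)
    also have "\<dots> \<le> norm x * \<eta>"
      unfolding sum_distrib_left[symmetric] using N0[OF \<open>N \<ge> N0\<close>] by (intro mult_left_mono) auto
    finally have low: "norm (B (P L x) - P N (B (P L x))) \<le> norm x * \<eta>" .
    have "x = y + P L x" unfolding y_def by simp
    then have "B x = B y + B (P L x)" using B_add[OF yD proj_DA] by metis
    then have "B x - P N (B x) = (B y - P N (B y)) + (B (P L x) - P N (B (P L x)))"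
      by (simp add: proj_add)
    then have "norm (B x - P N (B x)) \<le> norm (B y - P N (B y)) + norm (B (P L x) - P N (B (P L x)))"
      using norm_triangle_ineq by metis
    then show ?thesis using high low norm_proj_compl_le[of "B y" N] by (simp add: algebra_simps)
  qed
  then show ?thesis by blast
qed

subsection \<open>Compressions\<close>

text \<open>The compression of \<open>A + v B\<close>, extended by zero to the orthogonal complement of the range of the
  projection. In this way all orders act on the same space, and each generates a group of isometries
  of the whole space.\<close>

definition Gop :: "nat \<Rightarrow> real \<Rightarrow> 'a \<Rightarrow> 'a" where
  "Gop N v x = P N (A (P N x)) + v *\<^sub>R P N (B (P N x))"

lemma bounded_linear_proj_op:
  assumes "linear_operator DA T"
  shows "bounded_linear (\<lambda>x. P N (T (P N x)))"
  unfolding linear_operator_proj[OF assms]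
  by (intro bounded_linear_compose[OF proj_bounded_linear] bounded_linear_sum
      bounded_linear_compose[OF scaleC.bounded_linear_left] cinner.bounded_linear_right)

lemma Gop_skew_bounded: "skew_bounded (Gop N v)"
proof (intro skew_bounded.intro bounded_operator.intro skew_bounded_axioms.intro)
  show "bounded_linear (Gop N v)"
    unfolding Gop_def
    by (intro bounded_linear_add bounded_linear_compose[OF bounded_linear_scaleR_right]
        bounded_linear_proj_op A_linear B_linear)
  show "Gop N v (z *\<^sub>C x) = z *\<^sub>C Gop N v x" for z x
    unfolding Gop_def
    by (simp add: proj_scaleC A_scaleC B_scaleC scaleC_add_right scaleC.scaleR_right)
  show "cinner (Gop N v x) y = - cinner x (Gop N v y)" for x y
  proof -
    have "cinner (P N (A (P N x))) y = - cinner x (P N (A (P N y)))"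
      by (metis proj_symmetric A_skew proj_DA)
    moreover have "cinner (P N (B (P N x))) y = - cinner x (P N (B (P N y)))"
      by (metis proj_symmetric B_skew proj_DA)
    ultimately show ?thesis
      unfolding Gop_def
      by (simp only: cinner_add_left cinner_add_right cinner_scaleR_left cinner_scaleR_right) simp
  qed
qed

text \<open>The flow of the Galerkin system of order \<open>N\<close> with constant control value \<open>v\<close>.\<close>

definition E :: "nat \<Rightarrow> real \<Rightarrow> real \<Rightarrow> 'a \<Rightarrow> 'a" where
  "E N v = oexp (Gop N v)"

lemma Gop_proj: "Gop N v (P N x) = Gop N v x" and proj_Gop: "P N (Gop N v x) = Gop N v x"
  by (simp_all add: Gop_def proj_add proj_scaleR)

lemma E_proj: "P N x = x \<Longrightarrow> P N (E N v t x) = E N v t x"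
proof -
  assume x: "P N x = x"
  interpret skew_bounded "Gop N v" by (rule Gop_skew_bounded)
  have "((\<lambda>t. P N (oexp (Gop N v) t x)) has_vector_derivative Gop N v (P N (oexp (Gop N v) t x))) (at t)" for t
    using bounded_linear.has_vector_derivative[OF proj_bounded_linear oexp_derivative, of N x t]
    by (simp add: Gop_proj proj_Gop)
  from oexp_unique[OF this, of t] show ?thesis by (simp add: E_def oexp_zero x)
qed

text \<open>Convergence holds in the graph norm of \<open>A\<close>, which dominates \<open>B\<close>.\<close>

lemma B_proj_tendsto:
  assumes "x \<in> DA"
  shows "(\<lambda>N. B (P N x)) \<longlonglongrightarrow> B x"
proof -
  have "(\<lambda>N. a * norm (P N (A x) - A x) + b * norm (P N x - x)) \<longlonglongrightarrow> a * norm (A x - A x) + b * norm (x - x)"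
    by (intro tendsto_intros proj_tendsto)
  then have "(\<lambda>N. a * norm (P N (A x) - A x) + b * norm (P N x - x)) \<longlonglongrightarrow> 0" by simp
  moreover have "norm (B (P N x) - B x) \<le> a * norm (P N (A x) - A x) + b * norm (P N x - x)" for N
    using B_bound[OF DA_diff[OF proj_DA[of N x] assms]] assms by (simp add: A_diff B_diff A_proj)
  ultimately have "(\<lambda>N. B (P N x) - B x) \<longlonglongrightarrow> 0"
    by (intro Lim_null_comparison[of "\<lambda>N. B (P N x) - B x"
          "\<lambda>N. a * norm (P N (A x) - A x) + b * norm (P N x - x)"] always_eventually allI)
  then show ?thesis by (simp add: LIM_zero_iff)
qed

lemma Gop_tendsto:
  assumes "x \<in> DA"
  shows "(\<lambda>N. Gop N v x) \<longlonglongrightarrow> A x + v *\<^sub>R B x"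
proof -
  have B: "(\<lambda>N. P N (B (P N x))) \<longlonglongrightarrow> B x"
  proof -
    have "(\<lambda>N. P N (B (P N x) - B x)) \<longlonglongrightarrow> 0"
    proof (rule Lim_null_comparison)
      show "\<forall>\<^sub>F N in sequentially. norm (P N (B (P N x) - B x)) \<le> norm (B (P N x) - B x)"
        using norm_proj_le by (intro always_eventually) blast
      show "(\<lambda>N. norm (B (P N x) - B x)) \<longlonglongrightarrow> 0"
        using B_proj_tendsto[OF assms] by (simp add: tendsto_norm_zero LIM_zero)
    qed
    from tendsto_add[OF this proj_tendsto[of "B x"]] show ?thesis by (simp add: proj_diff)
  qed
  have A: "P N (A (P N x)) = P N (A x)" for N using assms by (simp add: A_proj)
  show ?thesis unfolding Gop_def A by (intro tendsto_intros proj_tendsto B)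
qed

end

section \<open>Unitary groups and their generators\<close>

lemma norm_eq_if_cinner_eq: "cinner x x = cinner y y \<Longrightarrow> norm x = norm (y::'a::complex_hilbert_space)"
  by (simp add: cinner_same power2_eq_iff_nonneg flip: of_real_power)

lemma unitary_group_norm: "unitary_group W \<Longrightarrow> norm (W t x) = norm x"
  unfolding unitary_group_def by (rule norm_eq_if_cinner_eq) simp

lemma unitary_group_bounded_linear:
  assumes "unitary_group W"
  shows "bounded_linear (W t)"
proof (rule bounded_linear_intro[where K = 1])
  have lin: "linear_operator UNIV (W t)" using assms unfolding unitary_group_def by auto
  then show "W t (x + y) = W t x + W t y" for x y unfolding linear_operator_def by auto
  show "W t (r *\<^sub>R x) = r *\<^sub>R W t x" for r x
    using lin unfolding linear_operator_def by (metis UNIV_I scaleC_of_real)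
  show "norm (W t x) \<le> norm x * 1" for x by (simp add: unitary_group_norm[OF assms])
qed

text \<open>Translates the difference quotients of \<open>has_generator\<close> into derivatives.\<close>

lemma has_vector_derivative_if_difference_quotient:
  fixes f :: "real \<Rightarrow> 'a::real_normed_vector"
  assumes "((\<lambda>h. (f (t + h) - f t) /\<^sub>R h) \<longlongrightarrow> y) (at 0)"
  shows "(f has_vector_derivative y) (at t)"
  unfolding has_vector_derivative_def has_derivative_at
proof
  show "bounded_linear (\<lambda>h. h *\<^sub>R y)" by (rule bounded_linear_scaleR_left)
  have "((\<lambda>h. norm ((f (t + h) - f t) /\<^sub>R h - y)) \<longlongrightarrow> 0) (at 0)"
    using assms by (intro tendsto_norm_zero LIM_zero)
  moreover have "norm ((f (t + h) - f t) /\<^sub>R h - y) = norm (f (t + h) - f t - h *\<^sub>R y) / norm h"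
    if "h \<noteq> 0" for h
  proof -
    have "(f (t + h) - f t) /\<^sub>R h - y = (f (t + h) - f t - h *\<^sub>R y) /\<^sub>R h"
      using that by (simp add: scaleR_diff_right)
    then show ?thesis by (simp add: divide_inverse mult.commute)
  qed
  ultimately show "(\<lambda>h. norm (f (t + h) - f t - h *\<^sub>R y) / norm h) \<midarrow>0\<rightarrow> 0"
    by (elim Lim_transform_eventually) (auto simp: eventually_at_filter)
qed

text \<open>The difference quotient of the orbit at time \<open>t\<close> is at once the image under \<open>W t\<close> of the quotient
  at time \<open>0\<close> and the quotient at time \<open>0\<close> of the orbit of \<open>W t x\<close>.\<close>

lemma generator_commute:
  assumes W: "unitary_group W" and S: "has_generator W D S" and x: "x \<in> D"
  shows "W t x \<in> D" "S (W t x) = W t (S x)"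
    and "((\<lambda>t. W t x) has_vector_derivative W t (S x)) (at t)"
proof -
  interpret bounded_linear "W t" by (rule unitary_group_bounded_linear[OF W])
  have plus: "W (r + s) y = W r (W s y)" for r s y
    using W unfolding unitary_group_def by auto
  have "((\<lambda>h. (W h x - x) /\<^sub>R h) \<longlongrightarrow> S x) (at 0)"
    using S x unfolding has_generator_def by auto
  then have lim: "((\<lambda>h. W t ((W h x - x) /\<^sub>R h)) \<longlongrightarrow> W t (S x)) (at 0)"
    by (rule tendsto)
  have "W t ((W h x - x) /\<^sub>R h) = (W (t + h) x - W t x) /\<^sub>R h" for h
    by (simp add: scaleR diff plus)
  with lim have lim1: "((\<lambda>h. (W (t + h) x - W t x) /\<^sub>R h) \<longlongrightarrow> W t (S x)) (at 0)" by simp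
  then show "((\<lambda>t. W t x) has_vector_derivative W t (S x)) (at t)"
    by (rule has_vector_derivative_if_difference_quotient)
  have "W (t + h) x = W h (W t x)" for h using plus[of h t x] by (simp add: add.commute)
  with lim1 have lim2: "((\<lambda>h. (W h (W t x) - W t x) /\<^sub>R h) \<longlongrightarrow> W t (S x)) (at 0)" by simp
  then show D: "W t x \<in> D" using S unfolding has_generator_def by blast
  then have "((\<lambda>h. (W h (W t x) - W t x) /\<^sub>R h) \<longlongrightarrow> S (W t x)) (at 0)"
    using S unfolding has_generator_def by blast
  with lim2 show "S (W t x) = W t (S x)" using LIM_unique by blast
qed

text \<open>On the domain of the generator, the difference of two orbits solves \<open>z' = S z\<close> with \<open>S\<close> skew, so its
  norm is constant.\<close>

lemma unitary_group_unique:
  assumes W: "unitary_group W" "has_generator W D S" and V: "unitary_group V" "has_generator V D S"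
    and dense: "closure D = UNIV"
    and diff: "\<And>x y. x \<in> D \<Longrightarrow> y \<in> D \<Longrightarrow> x - y \<in> D \<and> S (x - y) = S x - S y"
    and skew: "\<And>x. x \<in> D \<Longrightarrow> cinner x (S x) + cinner (S x) x = 0"
  shows "W = V"
proof (intro ext)
  fix t x
  have eq: "W t y = V t y" if y: "y \<in> D" for y
  proof -
    note w = generator_commute[OF W y] and v = generator_commute[OF V y]
    have z: "((\<lambda>t. W t y - V t y) has_vector_derivative S (W t y - V t y)) (at t within UNIV)" for t
      using has_vector_derivative_diff[OF w(3) v(3)] diff w(1,2) v(1,2) by simp
    have "cinner (W t y - V t y) (S (W t y - V t y)) + cinner (S (W t y - V t y)) (W t y - V t y) = 0"
      for t
      using skew diff w(1) v(1) by blast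
    then have "cinner (W t y - V t y) (W t y - V t y) = cinner (W 0 y - V 0 y) (W 0 y - V 0 y)"
      by (intro cinner_constant[OF convex_UNIV z z]) auto
    also have "\<dots> = 0" using W(1) V(1) unfolding unitary_group_def by simp
    finally show ?thesis by (simp add: cinner_eq_zero_iff)
  qed
  have "closed {y. W t y = V t y}"
    using unitary_group_bounded_linear[OF W(1)] unitary_group_bounded_linear[OF V(1)]
    by (intro closed_Collect_eq linear_continuous_on) auto
  moreover have "D \<subseteq> {y. W t y = V t y}" using eq by auto
  ultimately show "W t x = V t x" using dense closure_minimal by blast
qed

text \<open>A generator can have no positive eigenvalue, because the group preserves the norm.\<close>

lemma unitary_group_eigenvector_zero:
  assumes W: "unitary_group W" and \<mu>: "\<mu> > 0"
    and lim: "((\<lambda>h. (W h w - w) /\<^sub>R h) \<longlongrightarrow> \<mu> *\<^sub>R w) (at 0)"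
  shows "w = 0"
proof -
  have "((\<lambda>h. Re (cinner w ((W h w - w) /\<^sub>R h))) \<longlongrightarrow> Re (cinner w (\<mu> *\<^sub>R w))) (at_right 0)"
    by (intro tendsto_Re cinner.tendsto tendsto_const tendsto_mono[OF _ lim] at_le) auto
  moreover have "\<forall>\<^sub>F h in at_right 0. Re (cinner w ((W h w - w) /\<^sub>R h)) \<le> 0"
    unfolding eventually_at_filter
  proof (intro always_eventually allI impI)
    fix h :: real assume h: "h \<noteq> 0" "h \<in> {0<..}"
    have "Re (cinner w (W h w)) \<le> norm w * norm (W h w)"
      using complex_Re_le_cmod norm_cinner_le order_trans by blast
    also have "\<dots> = Re (cinner w w)"
      by (simp add: unitary_group_norm[OF W] cinner_same power2_eq_square)
    finally have "Re (cinner w (W h w - w)) \<le> 0" by (simp add: cinner.diff_right)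
    then show "Re (cinner w ((W h w - w) /\<^sub>R h)) \<le> 0"
      using h by (simp add: cinner_scaleR_right mult_nonneg_nonpos)
  qed
  ultimately have "Re (cinner w (\<mu> *\<^sub>R w)) \<le> 0"
    by (rule tendsto_upperbound) simp
  then have "\<mu> * (norm w)\<^sup>2 \<le> 0" by (simp add: cinner_scaleR_right cinner_same)
  then show ?thesis using \<mu> by (simp add: mult_le_0_iff)
qed

section \<open>Conservation of energy\<close>

locale bounded_control_setting = galerkin_setting +
  fixes \<delta> :: real
  assumes \<delta>_pos: "\<delta> > 0" and \<delta>_less: "\<delta> < 1"
begin

text \<open>Along the flow with a constant value \<open>v\<close> of the control this quantity is constant, and it
  controls the graph norm of \<open>A\<close> uniformly in \<open>v\<close> and in the order \<open>N\<close>.\<close>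

definition energy :: "nat \<Rightarrow> real \<Rightarrow> 'a \<Rightarrow> real" where
  "energy N v x = norm (Gop N v x) + b / a * norm x"

abbreviation "admissible v \<equiv> \<bar>v\<bar> * a \<le> 1 - \<delta>"

lemma energy_nonneg: "0 \<le> energy N v x"
  unfolding energy_def using a_pos b_nonneg by simp

lemma mem_DA_if_proj: "P N x = x \<Longrightarrow> x \<in> DA"
  using proj_DA[of N x] by simp

text \<open>This is where the distance \<open>\<delta>\<close> of \<open>\<bar>v\<bar> a\<close> from \<open>1\<close> is used: the part \<open>\<bar>v\<bar> a \<parallel>A x\<parallel>\<close> of the bound
  on \<open>v B x\<close> is absorbed on the left, and \<open>\<bar>v\<bar> b \<parallel>x\<parallel>\<close> by the second term of the energy.\<close>

lemma norm_A_le_energy: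
  assumes "P N x = x" and "admissible v"
  shows "\<delta> * norm (A x) \<le> energy N v x"
proof -
  have "A x = Gop N v x - v *\<^sub>R P N (B x)"
    using proj_A_proj[of N x] assms(1) by (simp add: Gop_def)
  then have "norm (A x) \<le> norm (Gop N v x) + norm (v *\<^sub>R P N (B x))"
    using norm_triangle_ineq4 by metis
  also have "norm (v *\<^sub>R P N (B x)) \<le> \<bar>v\<bar> * norm (B x)"
    by (simp add: mult_left_mono norm_proj_le)
  also have "\<bar>v\<bar> * norm (B x) \<le> \<bar>v\<bar> * (a * norm (A x) + b * norm x)"
    using B_bound[OF mem_DA_if_proj[OF assms(1)]] by (intro mult_left_mono) auto
  also have "\<dots> = (\<bar>v\<bar> * a) * norm (A x) + (\<bar>v\<bar> * a) * (b / a * norm x)"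
    using a_pos by (simp add: algebra_simps)
  also have "\<dots> \<le> (1 - \<delta>) * norm (A x) + 1 * (b / a * norm x)"
    using assms(2) \<delta>_pos a_pos b_nonneg by (intro add_mono mult_right_mono) auto
  finally show ?thesis unfolding energy_def by (simp add: algebra_simps)
qed

lemma norm_B_le_energy:
  assumes "P N x = x" and "admissible v"
  shows "norm (B x) \<le> 2 * a / \<delta> * energy N v x"
proof -
  have "norm (B x) \<le> a * norm (A x) + a * (b / a * norm x)"
    using B_bound[OF mem_DA_if_proj[OF assms(1)]] a_pos by simp
  also have "\<dots> \<le> a * (energy N v x / \<delta>) + a * (energy N v x / \<delta>)"
  proof (intro add_mono mult_left_mono)
    show "norm (A x) \<le> energy N v x / \<delta>"
      using norm_A_le_energy[OF assms] \<delta>_pos by (simp add: field_simps)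
    have "b / a * norm x \<le> energy N v x" unfolding energy_def by simp
    also have "\<dots> \<le> energy N v x / \<delta>"
      using \<delta>_pos \<delta>_less mult_left_le_one_le[OF energy_nonneg, of \<delta> N v x]
      by (simp add: field_simps)
    finally show "b / a * norm x \<le> energy N v x / \<delta>" .
  qed (use a_pos in auto)
  finally show ?thesis by simp
qed

text \<open>The generator changes by \<open>(w - v) \<pi>\<^sub>N B\<close>, and \<open>B x\<close> is controlled by the energy. The factor is
  written as an exponential so that the contributions of successive jumps add up.\<close>

lemma energy_jump:
  assumes "P N x = x" and "admissible v"
  shows "energy N w x \<le> exp (2 * a / \<delta> * \<bar>w - v\<bar>) * energy N v x"
proof -
  have "Gop N w x = Gop N v x + (w - v) *\<^sub>R P N (B x)"
    unfolding Gop_def using assms(1) by (simp add: algebra_simps)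
  then have "norm (Gop N w x) \<le> norm (Gop N v x) + norm ((w - v) *\<^sub>R P N (B x))"
    using norm_triangle_ineq by metis
  also have "norm ((w - v) *\<^sub>R P N (B x)) \<le> \<bar>w - v\<bar> * norm (B x)"
    by (simp add: mult_left_mono norm_proj_le)
  also have "\<dots> \<le> \<bar>w - v\<bar> * (2 * a / \<delta> * energy N v x)"
    by (intro mult_left_mono norm_B_le_energy assms) auto
  finally have "norm (Gop N w x) \<le> norm (Gop N v x) + \<bar>w - v\<bar> * (2 * a / \<delta> * energy N v x)"
    by simp
  then have "energy N w x \<le> energy N v x + \<bar>w - v\<bar> * (2 * a / \<delta> * energy N v x)"
    using energy_def[of N w x] energy_def[of N v x] by linarith
  also have "\<dots> = (1 + 2 * a / \<delta> * \<bar>w - v\<bar>) * energy N v x"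
    by (simp only: ring_distribs mult_1_left mult.assoc mult.left_commute[of "\<bar>w - v\<bar>"])
  also have "\<dots> \<le> exp (2 * a / \<delta> * \<bar>w - v\<bar>) * energy N v x"
    using exp_ge_add_one_self energy_nonneg by (intro mult_right_mono) auto
  finally show ?thesis .
qed

lemma norm_E [simp]: "norm (E N v t x) = norm x"
  unfolding E_def by (rule skew_bounded.norm_oexp[OF Gop_skew_bounded])

lemma E_diff: "E N v t (x - y) = E N v t x - E N v t y"
  unfolding E_def by (rule skew_bounded.oexp_diff[OF Gop_skew_bounded])

lemma energy_conserved: "energy N v (E N v t x) = energy N v x"
  unfolding energy_def norm_E
  by (simp add: E_def skew_bounded.oexp_commute[OF Gop_skew_bounded]
      skew_bounded.norm_oexp[OF Gop_skew_bounded])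

lemma energy_proj_le:
  assumes "x \<in> DA"
  shows "energy N v (P N x) \<le> norm (A x) + \<bar>v\<bar> * (a * norm (A x) + b * norm x) + b / a * norm x"
proof -
  have A: "norm (A (P N x)) \<le> norm (A x)" using assms by (simp add: A_proj norm_proj_le)
  have "norm (B (P N x)) \<le> a * norm (A (P N x)) + b * norm (P N x)"
    by (rule B_bound) simp
  also have "\<dots> \<le> a * norm (A x) + b * norm x"
    using A norm_proj_le a_pos b_nonneg by (intro add_mono mult_left_mono) auto
  finally have B: "norm (B (P N x)) \<le> a * norm (A x) + b * norm x" .
  have "norm (Gop N v (P N x)) \<le> norm (P N (A (P N x))) + norm (v *\<^sub>R P N (B (P N x)))"
    unfolding Gop_def proj_idem by (rule norm_triangle_ineq)
  also have "\<dots> \<le> norm (A x) + \<bar>v\<bar> * (a * norm (A x) + b * norm x)"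
    using A B norm_proj_le[of N "A (P N x)"] norm_proj_le[of N "B (P N x)"]
    by (intro add_mono) (auto intro!: mult_left_mono)
  finally show ?thesis
    unfolding energy_def using norm_proj_le a_pos b_nonneg by (intro add_mono mult_left_mono) auto
qed

text \<open>The orders \<open>N\<close> at which \<open>B\<close> is well approximated by its projections, on vectors of
  bounded graph norm and arbitrary finite order.\<close>

definition good_order :: "nat \<Rightarrow> real \<Rightarrow> bool" where
  "good_order N \<eta> \<longleftrightarrow> (\<forall>K x. P K x = x \<longrightarrow> norm (B x - P N (B x)) \<le> \<eta> * (norm (A x) + norm x))"

lemma good_order_eventually: "\<eta> > 0 \<Longrightarrow> \<forall>\<^sub>F N in sequentially. good_order N \<eta>"
  unfolding good_order_def eventually_sequentially by (rule proj_B_uniform)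

text \<open>On the flow of order \<open>N\<close>, the two generators differ by \<open>v\<close> times the image of \<open>(1 - \<pi>\<^sub>N) B\<close> under
  the projection of order \<open>M\<close>, and the graph norm is bounded by conservation of energy.\<close>

lemma E_compare:
  assumes "good_order N \<eta>" and "\<eta> \<ge> 0" and "N \<le> M" and x: "P N x = x" and v: "admissible v"
  shows "norm (E N v t x - E M v t x) \<le> \<bar>v\<bar> * (\<eta> * (energy N v x / \<delta> + norm x)) * \<bar>t\<bar>"
  unfolding E_def
proof (rule skew_bounded.oexp_compare[OF Gop_skew_bounded Gop_skew_bounded])
  fix s
  define y where "y = oexp (Gop N v) s x"
  have y: "P N y = y" and en: "energy N v y = energy N v x" and ny: "norm y = norm x"
    using E_proj[OF x] energy_conserved norm_E unfolding y_def E_def by auto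
  have yM: "P M y = y" using proj_absorb[OF \<open>N \<le> M\<close>, of y] y by simp
  have "P M (A y) = A y" using proj_A_proj[of M y] yM by simp
  moreover have "P N (A y) = A y" using proj_A_proj[of N y] y by simp
  ultimately have "Gop N v y - Gop M v y = v *\<^sub>R (P M (P N (B y)) - P M (B y))"
    unfolding Gop_def y yM by (simp add: proj_absorb[OF \<open>N \<le> M\<close>] scaleR_diff_right)
  also have "\<dots> = - (v *\<^sub>R P M (B y - P N (B y)))" by (simp add: proj_diff scaleR_diff_right)
  finally have "norm (Gop N v y - Gop M v y) = \<bar>v\<bar> * norm (P M (B y - P N (B y)))" by simp
  also have "\<dots> \<le> \<bar>v\<bar> * norm (B y - P N (B y))"
    using norm_proj_le by (intro mult_left_mono) auto
  also have "\<dots> \<le> \<bar>v\<bar> * (\<eta> * (norm (A y) + norm y))"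
    using assms(1) y unfolding good_order_def by (intro mult_left_mono) auto
  also have "\<dots> \<le> \<bar>v\<bar> * (\<eta> * (energy N v x / \<delta> + norm x))"
    using norm_A_le_energy[OF y v] \<delta>_pos \<open>\<eta> \<ge> 0\<close>
    by (intro mult_left_mono) (auto simp: en ny field_simps)
  finally show "norm (Gop N v (oexp (Gop N v) s x) - Gop M v (oexp (Gop N v) s x))
      \<le> \<bar>v\<bar> * (\<eta> * (energy N v x / \<delta> + norm x))" unfolding y_def .
qed

section \<open>The unitary group of \<open>A + v B\<close>\<close>

text \<open>Replacing \<open>x\<close> by its projection of order \<open>N\<close> costs little because the flows are isometric; on the
  projection the two flows are compared directly.\<close>

lemma E_Cauchy_DA:
  assumes x: "x \<in> DA" and v: "admissible v" and e: "e > 0"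
  shows "\<exists>N. \<forall>M\<ge>N. norm (E N v t x - E M v t x) < e"
proof -
  define C where "C = norm (A x) + \<bar>v\<bar> * (a * norm (A x) + b * norm x) + b / a * norm x"
  have C: "0 \<le> C" unfolding C_def using a_pos b_nonneg by auto
  define Q where "Q = \<bar>v\<bar> * (C / \<delta> + norm x) * \<bar>t\<bar>"
  have Q: "0 \<le> Q" unfolding Q_def using C \<delta>_pos by auto
  obtain \<eta> where \<eta>: "\<eta> > 0" "\<eta> * Q < e / 4"
    using small_factor[OF Q, of "e / 4"] e by auto
  have "\<forall>\<^sub>F N in sequentially. dist (P N x) x < e / 4"
    using tendstoD[OF proj_tendsto, of "e / 4" x] e by simp
  with good_order_eventually[OF \<eta>(1)] have "\<forall>\<^sub>F N in sequentially. good_order N \<eta> \<and> dist (P N x) x < e / 4"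
    by (rule eventually_conj)
  then obtain N where N: "good_order N \<eta>" "dist (P N x) x < e / 4"
    using eventually_happens by force
  have "norm (E N v t x - E M v t x) < e" if "N \<le> M" for M
  proof -
    have "norm (E N v t (P N x) - E M v t (P N x)) \<le> \<bar>v\<bar> * (\<eta> * (energy N v (P N x) / \<delta> + norm (P N x))) * \<bar>t\<bar>"
      using N \<eta> that v by (intro E_compare) auto
    also have "\<dots> \<le> \<bar>v\<bar> * (\<eta> * (C / \<delta> + norm x)) * \<bar>t\<bar>"
      using energy_proj_le[OF x] \<delta>_pos \<eta> norm_proj_le
      by (intro mult_right_mono mult_left_mono add_mono divide_right_mono) (auto simp: C_def)
    also have "\<dots> = \<eta> * Q" unfolding Q_def by simp
    also have "\<dots> < e / 4" by (rule \<eta>(2))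
    finally have 1: "norm (E N v t (P N x) - E M v t (P N x)) < e / 4" .
    have 2: "norm (E K v t x - E K v t (P N x)) < e / 4" for K
      using N(2) by (simp add: E_diff[symmetric] dist_norm norm_minus_commute)
    have "E N v t x - E M v t x = (E N v t x - E N v t (P N x))
        + (E N v t (P N x) - E M v t (P N x)) - (E M v t x - E M v t (P N x))" by simp
    then have "norm (E N v t x - E M v t x) \<le> norm (E N v t x - E N v t (P N x))
        + norm (E N v t (P N x) - E M v t (P N x)) + norm (E M v t x - E M v t (P N x))"
      using norm_add_diff_le by metis
    then show ?thesis using 1 2[of N] 2[of M] e by linarith
  qed
  then show ?thesis by blast
qed

lemma DA_approximation: "e > 0 \<Longrightarrow> \<exists>y\<in>DA. norm (x - y) < e"
  using closure_approachable[of x DA] DA_dense by (auto simp: dist_norm norm_minus_commute)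

lemma E_convergent:
  assumes v: "admissible v"
  shows "convergent (\<lambda>N. E N v t x)"
proof (rule Cauchy_convergent)
  show "Cauchy (\<lambda>N. E N v t x)"
    unfolding Cauchy_altdef2
  proof (intro allI impI)
    fix e :: real assume e: "e > 0"
    obtain y where y: "y \<in> DA" "norm (x - y) < e / 4" using DA_approximation[of "e / 4" x] e by auto
    obtain N where N: "\<And>M. M \<ge> N \<Longrightarrow> norm (E N v t y - E M v t y) < e / 4"
      using E_Cauchy_DA[OF y(1) v, of "e / 4" t] e by auto
    have "dist (E M v t x) (E N v t x) < e" if "M \<ge> N" for M
    proof -
      have "E N v t x - E M v t x = E N v t (x - y) + (E N v t y - E M v t y) - E M v t (x - y)"
        by (simp add: E_diff)
      then have "norm (E N v t x - E M v t x)
          \<le> norm (E N v t (x - y)) + norm (E N v t y - E M v t y) + norm (E M v t (x - y))"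
        using norm_add_diff_le by metis
      then show ?thesis using y(2) N[OF that] e by (simp add: dist_norm norm_minus_commute)
    qed
    then show "\<exists>N. \<forall>M\<ge>N. dist (E M v t x) (E N v t x) < e" by blast
  qed
qed

text \<open>The limit of the Galerkin flows; it is shown below to be the group generated by \<open>A + v B\<close>.\<close>

definition U :: "real \<Rightarrow> real \<Rightarrow> 'a \<Rightarrow> 'a" where
  "U v t x = lim (\<lambda>N. E N v t x)"

lemma E_tendsto_U: "admissible v \<Longrightarrow> (\<lambda>N. E N v t x) \<longlonglongrightarrow> U v t x"
  using E_convergent convergent_LIMSEQ_iff unfolding U_def by blast

text \<open>Strong limits of isometries may be composed.\<close>

lemma E_tendsto_U_moving:
  assumes "admissible v" and "y \<longlonglongrightarrow> x"
  shows "(\<lambda>N. E N v t (y N)) \<longlonglongrightarrow> U v t x"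
proof -
  have "(\<lambda>N. E N v t (y N - x)) \<longlonglongrightarrow> 0"
    using assms(2) by (intro tendsto_norm_zero_cancel[of "\<lambda>N. E N v t (y N - x)"])
      (simp add: tendsto_norm_zero LIM_zero)
  from tendsto_add[OF this E_tendsto_U[OF assms(1), of t x]] show ?thesis by (simp add: E_diff)
qed

context
  fixes v :: real
  assumes v: "admissible v"
begin

lemma cinner_U: "cinner (U v t x) (U v t y) = cinner x y"
proof (rule LIMSEQ_unique)
  show "(\<lambda>N. cinner (E N v t x) (E N v t y)) \<longlonglongrightarrow> cinner (U v t x) (U v t y)"
    by (intro cinner.tendsto E_tendsto_U v)
  show "(\<lambda>N. cinner (E N v t x) (E N v t y)) \<longlonglongrightarrow> cinner x y"
    unfolding E_def skew_bounded.cinner_oexp[OF Gop_skew_bounded] by (rule tendsto_const)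
qed

lemma norm_U: "norm (U v t x) = norm x"
  by (rule norm_eq_if_cinner_eq) (rule cinner_U)

lemma U_add: "U v t (x + y) = U v t x + U v t y"
proof (rule LIMSEQ_unique)
  show "(\<lambda>N. E N v t x + E N v t y) \<longlonglongrightarrow> U v t x + U v t y"
    by (intro tendsto_add E_tendsto_U v)
  show "(\<lambda>N. E N v t x + E N v t y) \<longlonglongrightarrow> U v t (x + y)"
    using E_tendsto_U[OF v, of t "x + y"] unfolding E_def skew_bounded.oexp_add[OF Gop_skew_bounded] .
qed

lemma U_scaleC: "U v t (z *\<^sub>C x) = z *\<^sub>C U v t x"
proof (rule LIMSEQ_unique)
  show "(\<lambda>N. z *\<^sub>C E N v t x) \<longlonglongrightarrow> z *\<^sub>C U v t x"
    by (intro scaleC.tendsto tendsto_const E_tendsto_U v)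
  show "(\<lambda>N. z *\<^sub>C E N v t x) \<longlonglongrightarrow> U v t (z *\<^sub>C x)"
    using E_tendsto_U[OF v, of t "z *\<^sub>C x"] unfolding E_def skew_bounded.oexp_scaleC[OF Gop_skew_bounded] .
qed

lemma U_diff: "U v t (x - y) = U v t x - U v t y"
  using U_add[of t "x - y" y] by simp

lemma U_zero: "U v 0 x = x"
  using E_tendsto_U[OF v, of 0 x] Gop_skew_bounded
  by (simp add: E_def bounded_operator.oexp_zero skew_bounded.axioms(1) LIMSEQ_const_iff)

lemma U_plus: "U v (s + t) x = U v s (U v t x)"
proof (rule LIMSEQ_unique)
  show "(\<lambda>N. E N v (s + t) x) \<longlonglongrightarrow> U v (s + t) x" by (rule E_tendsto_U[OF v])
  show "(\<lambda>N. E N v (s + t) x) \<longlonglongrightarrow> U v s (U v t x)"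
    using E_tendsto_U_moving[OF v E_tendsto_U[OF v, of t x], of s]
    unfolding E_def skew_bounded.oexp_plus[OF Gop_skew_bounded] .
qed

lemma U_lipschitz:
  assumes "x \<in> DA"
  shows "norm (U v t x - U v s x) \<le> norm (A x + v *\<^sub>R B x) * \<bar>t - s\<bar>"
proof (rule LIMSEQ_le)
  show "(\<lambda>N. norm (E N v t x - E N v s x)) \<longlonglongrightarrow> norm (U v t x - U v s x)"
    by (intro tendsto_norm tendsto_diff E_tendsto_U v)
  show "(\<lambda>N. norm (Gop N v x) * \<bar>t - s\<bar>) \<longlonglongrightarrow> norm (A x + v *\<^sub>R B x) * \<bar>t - s\<bar>"
    by (intro tendsto_mult_right tendsto_norm Gop_tendsto assms)
  show "\<exists>N. \<forall>n\<ge>N. norm (E n v t x - E n v s x) \<le> norm (Gop n v x) * \<bar>t - s\<bar>"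
    unfolding E_def using skew_bounded.oexp_lipschitz[OF Gop_skew_bounded] by blast
qed

lemma U_continuous: "continuous_on UNIV (\<lambda>t. U v t x)"
  unfolding continuous_on_iff
proof (intro ballI allI impI)
  fix t e :: real assume e: "e > 0"
  obtain y where y: "y \<in> DA" "norm (x - y) < e / 4" using DA_approximation[of "e / 4" x] e by auto
  define L where "L = norm (A y + v *\<^sub>R B y) + 1"
  have L: "L > 0" unfolding L_def by (simp add: add_nonneg_pos)
  have "dist (U v s x) (U v t x) < e" if "dist s t < e / (4 * L)" for s
  proof -
    have "norm (U v s y - U v t y) \<le> L * \<bar>s - t\<bar>"
      using U_lipschitz[OF y(1), of s t] unfolding L_def by (simp add: algebra_simps)
    also have "\<dots> < e / 2"
      using that L e by (simp add: dist_real_def field_simps)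
    finally have 1: "norm (U v s y - U v t y) < e / 2" .
    have "U v s x - U v t x = U v s (x - y) + (U v s y - U v t y) - U v t (x - y)"
      by (simp add: U_diff)
    then have "norm (U v s x - U v t x)
        \<le> norm (U v s (x - y)) + norm (U v s y - U v t y) + norm (U v t (x - y))"
      using norm_add_diff_le by metis
    then show ?thesis using 1 y(2) by (simp add: norm_U dist_norm)
  qed
  then show "\<exists>r>0. \<forall>s\<in>UNIV. dist s t < r \<longrightarrow> dist (U v s x) (U v t x) < e"
    using e L by (intro exI[of _ "e / (4 * L)"]) auto
qed

lemma U_unitary_group: "unitary_group (U v)"
  unfolding unitary_group_def
proof (intro conjI allI)
  fix t
  show "linear_operator UNIV (U v t)"
    unfolding linear_operator_def by (simp add: cvs.subspace_UNIV U_add U_scaleC)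
  show "surj (U v t)"
    using U_plus[of t "- t"] U_zero by (intro surjI[of _ "U v (- t)"]) simp
qed (auto simp: cinner_U U_zero U_plus U_continuous)

text \<open>For each \<open>N\<close> the difference quotient is close to \<open>Gop N v x\<close> as long as the flow hardly moves
  that vector. Since \<open>Gop N v x\<close> converges, it suffices to approximate its limit by one vector
  on which all flows are uniformly Lipschitz.\<close>

lemma U_derivative_zero:
  assumes x: "x \<in> DA"
  shows "((\<lambda>h. (U v h x - x) /\<^sub>R h) \<longlongrightarrow> A x + v *\<^sub>R B x) (at 0)"
proof (rule LIM_I)
  fix e :: real assume e: "e > 0"
  define y where "y = A x + v *\<^sub>R B x"
  obtain z where z: "z \<in> DA" "norm (y - z) < e / 4" using DA_approximation[of "e / 4" y] e by auto
  define L where "L = norm (A z + v *\<^sub>R B z) + 1"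
  have L: "L > 0" unfolding L_def by (simp add: add_nonneg_pos)
  have "norm ((U v h x - x) /\<^sub>R h - y) < e" if h: "h \<noteq> 0" "norm (h - 0) < e / (4 * L)" for h
  proof -
    have bound: "norm (E N v h x - x - h *\<^sub>R Gop N v x)
        \<le> (2 * norm (Gop N v x - z) + norm (Gop N v z) * \<bar>h\<bar>) * \<bar>h\<bar>" for N
      unfolding E_def
    proof (rule skew_bounded.oexp_remainder[OF Gop_skew_bounded])
      fix s assume s: "\<bar>s\<bar> \<le> \<bar>h\<bar>"
      interpret G: skew_bounded "Gop N v" by (rule Gop_skew_bounded)
      define g where "g = Gop N v x"
      have "oexp (Gop N v) s g - g = oexp (Gop N v) s (g - z) + (oexp (Gop N v) s z - z) - (g - z)"
        by (simp add: G.oexp_diff)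
      then have "norm (oexp (Gop N v) s g - g)
          \<le> norm (oexp (Gop N v) s (g - z)) + norm (oexp (Gop N v) s z - z) + norm (g - z)"
        using norm_add_diff_le by metis
      moreover have "norm (oexp (Gop N v) s z - z) \<le> norm (Gop N v z) * \<bar>s\<bar>"
        using G.oexp_lipschitz[of s z 0] by (simp add: G.oexp_zero)
      moreover have "norm (Gop N v z) * \<bar>s\<bar> \<le> norm (Gop N v z) * \<bar>h\<bar>"
        using s by (intro mult_left_mono) auto
      ultimately show "norm (oexp (Gop N v) s (Gop N v x) - Gop N v x)
          \<le> 2 * norm (Gop N v x - z) + norm (Gop N v z) * \<bar>h\<bar>"
        unfolding g_def by simp
    qed
    have "norm (U v h x - x - h *\<^sub>R y) \<le> (2 * norm (y - z) + norm (A z + v *\<^sub>R B z) * \<bar>h\<bar>) * \<bar>h\<bar>"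
    proof (rule LIMSEQ_le)
      show "(\<lambda>N. norm (E N v h x - x - h *\<^sub>R Gop N v x)) \<longlonglongrightarrow> norm (U v h x - x - h *\<^sub>R y)"
        unfolding y_def by (intro tendsto_intros E_tendsto_U v Gop_tendsto x)
      show "(\<lambda>N. (2 * norm (Gop N v x - z) + norm (Gop N v z) * \<bar>h\<bar>) * \<bar>h\<bar>)
          \<longlonglongrightarrow> (2 * norm (y - z) + norm (A z + v *\<^sub>R B z) * \<bar>h\<bar>) * \<bar>h\<bar>"
        unfolding y_def by (intro tendsto_intros Gop_tendsto x z(1))
    qed (use bound in blast)
    also have "\<dots> \<le> (2 * norm (y - z) + L * \<bar>h\<bar>) * \<bar>h\<bar>"
      unfolding L_def by (intro mult_right_mono add_left_mono) auto
    also have "\<dots> < e * \<bar>h\<bar>"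
    proof (rule mult_strict_right_mono)
      have "L * \<bar>h\<bar> < e / 2" using h L e by (simp add: field_simps)
      then show "2 * norm (y - z) + L * \<bar>h\<bar> < e" using z(2) by simp
    qed (use h in simp)
    finally have "norm (U v h x - x - h *\<^sub>R y) < e * \<bar>h\<bar>" .
    moreover have "(U v h x - x) /\<^sub>R h - y = (U v h x - x - h *\<^sub>R y) /\<^sub>R h"
      using h by (simp add: scaleR_diff_right)
    moreover have "norm ((U v h x - x - h *\<^sub>R y) /\<^sub>R h) = norm (U v h x - x - h *\<^sub>R y) / \<bar>h\<bar>"
      by (simp add: divide_inverse mult.commute)
    ultimately show ?thesis using h(1) by (metis pos_divide_less_eq zero_less_abs_iff)
  qed
  then show "\<exists>s>0. \<forall>h. h \<noteq> 0 \<and> norm (h - 0) < s \<longrightarrow> norm ((U v h x - x) /\<^sub>R h - (A x + v *\<^sub>R B x)) < e"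
    using e L unfolding y_def by (intro exI[of _ "e / (4 * L)"]) auto
qed

text \<open>The Kato-Rellich argument: with \<open>R = (A - \<mu>)\<^sup>-\<^sup>1\<close> the operator \<open>v B R\<close> is a contraction
  when \<open>\<mu>\<close> is large, so \<open>1 + v B R\<close> is onto.\<close>

lemma resolvent_surjective:
  assumes \<mu>: "\<mu> > 0" and large: "\<bar>v\<bar> * b < \<delta> * \<mu>"
  shows "\<exists>x\<in>DA. A x + v *\<^sub>R B x - \<mu> *\<^sub>R x = f"
proof -
  define R where "R = inv_into DA (\<lambda>x. A x - complex_of_real \<mu> *\<^sub>C x)"
  have "complex_of_real \<mu> \<notin> op_spectrum DA A"
    unfolding A_spectrum using \<mu> by (auto simp: complex_eq_iff)
  then have bij: "bij_betw (\<lambda>x. A x - complex_of_real \<mu> *\<^sub>C x) DA UNIV"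
    unfolding op_spectrum_def by auto
  have R: "R w \<in> DA" "A (R w) - \<mu> *\<^sub>R R w = w" for w
    using bij_betw_inv_into_right[OF bij, of w] bij_betwE[OF bij_betw_inv_into[OF bij]]
    unfolding R_def by (auto simp: scaleC_of_real)
  have est: "norm (B x) \<le> (a + b / \<mu>) * norm (A x - \<mu> *\<^sub>R x)" if x: "x \<in> DA" for x
  proof -
    have "Re (cinner (A x) x) = Re (cinner x (A x))"
      by (subst cinner_commute) simp
    then have "Re (cinner (A x) x) = 0" using A_skew[OF x x] by simp
    then have "(norm (A x - \<mu> *\<^sub>R x))\<^sup>2 = (norm (A x))\<^sup>2 + (\<mu> * norm x)\<^sup>2"
      using norm_add_squared[of "A x" "- (\<mu> *\<^sub>R x)"] \<mu>
      by (simp add: cinner_minus_right cinner_scaleR_right power_mult_distrib)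
    then have "(norm (A x))\<^sup>2 \<le> (norm (A x - \<mu> *\<^sub>R x))\<^sup>2" "(\<mu> * norm x)\<^sup>2 \<le> (norm (A x - \<mu> *\<^sub>R x))\<^sup>2"
      by auto
    then have "norm (A x) \<le> norm (A x - \<mu> *\<^sub>R x)" "\<mu> * norm x \<le> norm (A x - \<mu> *\<^sub>R x)"
      by (auto elim!: power2_le_imp_le)
    then have "a * norm (A x) + b * norm x \<le> a * norm (A x - \<mu> *\<^sub>R x) + b * (norm (A x - \<mu> *\<^sub>R x) / \<mu>)"
      using a_pos b_nonneg \<mu> by (intro add_mono mult_left_mono) (auto simp: field_simps)
    then show ?thesis using B_bound[OF x] by (simp add: algebra_simps)
  qed
  define c where "c = \<bar>v\<bar> * (a + b / \<mu>)"
  have "\<bar>v\<bar> * b / \<mu> < \<delta>" using large \<mu> by (simp add: field_simps)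
  then have c: "0 \<le> c" "c < 1"
    unfolding c_def using v a_pos b_nonneg \<mu> by (auto simp: distrib_left)
  have "\<exists>!w. w \<in> UNIV \<and> f - v *\<^sub>R B (R w) = w"
  proof (rule Banach_fix[where c = c])
    show "\<And>w w'. dist (f - v *\<^sub>R B (R w)) (f - v *\<^sub>R B (R w')) \<le> c * dist w w'"
    proof -
      fix w w'
      have D: "R w - R w' \<in> DA" by (intro DA_diff R(1))
      have "A (R w - R w') - \<mu> *\<^sub>R (R w - R w') = (A (R w) - \<mu> *\<^sub>R R w) - (A (R w') - \<mu> *\<^sub>R R w')"
        using R(1) by (simp add: A_diff scaleR_diff_right)
      also have "\<dots> = w - w'" by (simp only: R(2))
      finally have "norm (B (R w - R w')) \<le> (a + b / \<mu>) * norm (w - w')"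
        using est[OF D] by simp
      then have "\<bar>v\<bar> * norm (B (R w - R w')) \<le> \<bar>v\<bar> * ((a + b / \<mu>) * norm (w - w'))"
        by (intro mult_left_mono) auto
      moreover have "dist (f - v *\<^sub>R B (R w)) (f - v *\<^sub>R B (R w')) = \<bar>v\<bar> * norm (B (R w - R w'))"
      proof -
        have "f - v *\<^sub>R B (R w) - (f - v *\<^sub>R B (R w')) = - (v *\<^sub>R B (R w - R w'))"
          using B_diff[OF R(1)[of w] R(1)[of w']] by (simp add: scaleR_diff_right)
        then show ?thesis unfolding dist_norm by simp
      qed
      ultimately show "dist (f - v *\<^sub>R B (R w)) (f - v *\<^sub>R B (R w')) \<le> c * dist w w'"
        by (simp add: c_def dist_norm mult.assoc)
    qed
  qed (use c in \<open>auto simp: complete_UNIV\<close>)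
  then obtain w where "f - v *\<^sub>R B (R w) = w" by auto
  then have "A (R w) + v *\<^sub>R B (R w) - \<mu> *\<^sub>R R w = f" using R(2)[of w] by (metis add_diff_eq diff_add_cancel add.commute)
  then show ?thesis using R(1) by blast
qed

text \<open>A vector \<open>x\<close> at which the group is differentiable belongs to the domain of \<open>A\<close>: surjectivity gives
  \<open>x'\<close> in this domain such that \<open>x - x'\<close> is an eigenvector of the generator with eigenvalue \<open>\<mu> > 0\<close>.\<close>

lemma U_generator: "has_generator (U v) DA (\<lambda>x. A x + v *\<^sub>R B x)"
proof -
  define S where "S x = A x + v *\<^sub>R B x" for x
  have lim: "((\<lambda>h. (U v h x - x) /\<^sub>R h) \<longlongrightarrow> S x) (at 0)" if "x \<in> DA" for x
    unfolding S_def by (rule U_derivative_zero[OF that])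
  have "x \<in> DA" if y: "((\<lambda>h. (U v h x - x) /\<^sub>R h) \<longlongrightarrow> y) (at 0)" for x y
  proof -
    \<comment> \<open>any \<open>\<mu>\<close> large enough for \<open>resolvent_surjective\<close>\<close>
    define \<mu> where "\<mu> = (\<bar>v\<bar> * b + 1) / \<delta>"
    have \<mu>: "\<mu> > 0" "\<bar>v\<bar> * b < \<delta> * \<mu>"
      unfolding \<mu>_def using \<delta>_pos b_nonneg by (auto intro!: divide_pos_pos add_nonneg_pos)
    obtain x' where x': "x' \<in> DA" "S x' - \<mu> *\<^sub>R x' = y - \<mu> *\<^sub>R x"
      using resolvent_surjective[OF \<mu>] unfolding S_def by blast
    have "((\<lambda>h. (U v h x - x) /\<^sub>R h - (U v h x' - x') /\<^sub>R h) \<longlongrightarrow> y - S x') (at 0)"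
      by (intro tendsto_diff y lim x'(1))
    moreover have "(U v h x - x) /\<^sub>R h - (U v h x' - x') /\<^sub>R h = (U v h (x - x') - (x - x')) /\<^sub>R h" for h
      by (simp add: U_diff scaleR_diff_right)
    moreover have "y - S x' = \<mu> *\<^sub>R (x - x')"
      using x'(2) by (simp add: scaleR_diff_right algebra_simps)
    ultimately have "((\<lambda>h. (U v h (x - x') - (x - x')) /\<^sub>R h) \<longlongrightarrow> \<mu> *\<^sub>R (x - x')) (at 0)" by simp
    then have "x - x' = 0" by (rule unitary_group_eigenvector_zero[OF U_unitary_group \<mu>(1)])
    then show ?thesis using x'(1) by simp
  qed
  then show ?thesis
    unfolding has_generator_def S_def[symmetric] using lim by auto
qed

lemma exp_group_eq_U: "exp_group DA (\<lambda>x. A x + v *\<^sub>R B x) = U v"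
  unfolding exp_group_def
proof (rule the_equality)
  show "unitary_group (U v) \<and> has_generator (U v) DA (\<lambda>x. A x + v *\<^sub>R B x)"
    using U_unitary_group U_generator by blast
  fix W assume "unitary_group W \<and> has_generator W DA (\<lambda>x. A x + v *\<^sub>R B x)"
  then show "W = U v"
  proof (intro unitary_group_unique[OF _ _ U_unitary_group U_generator DA_dense])
    show "x - y \<in> DA \<and> A (x - y) + v *\<^sub>R B (x - y) = A x + v *\<^sub>R B x - (A y + v *\<^sub>R B y)"
      if "x \<in> DA" "y \<in> DA" for x y
      using that by (simp add: DA_diff A_diff B_diff scaleR_diff_right)
    show "cinner x (A x + v *\<^sub>R B x) + cinner (A x + v *\<^sub>R B x) x = 0" if "x \<in> DA" for x
      using A_skew[OF that that] B_skew[OF that that]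
      by (simp add: cinner_add_left cinner_add_right cinner_scaleR_left cinner_scaleR_right)
  qed auto
qed

end

end

section \<open>Propagators of piecewise constant controls\<close>

lemma pc_steps_values:
  assumes "pc_steps u t xs" and "(\<tau>, v) \<in> set xs"
  shows "\<exists>s. u s = v"
  using assms
proof (induction xs arbitrary: t rule: rev_induct)
  case (snoc x xs)
  obtain \<sigma> w where x: "x = (\<sigma>, w)" by (cases x)
  note st = snoc.prems(1)[unfolded x pc_steps_snoc]
  then have "\<exists>s. u s = w" by (intro exI[of _ "t - \<sigma> / 2"]) auto
  then show ?case using snoc.IH st snoc.prems(2) x by auto
qed simp

context bounded_control_setting
begin

text \<open>The Galerkin evolution of order \<open>N\<close> along a list of steps, for all initial data at once.\<close>

definition X :: "nat \<Rightarrow> (real \<times> real) list \<Rightarrow> 'a \<Rightarrow> 'a" where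
  "X N xs = fold (\<lambda>(\<tau>, v). E N v \<tau>) xs"

text \<open>The exact evolution along a list of steps.\<close>

definition W :: "(real \<times> real) list \<Rightarrow> 'a \<Rightarrow> 'a" where
  "W xs = fold (\<lambda>(\<tau>, v). U v \<tau>) xs"

lemma X_Nil [simp]: "X N [] y = y" and X_snoc: "X N (xs @ [(\<tau>, v)]) y = E N v \<tau> (X N xs y)"
  by (simp_all add: X_def)

lemma W_Nil [simp]: "W [] y = y" and W_snoc: "W (xs @ [(\<tau>, v)]) y = U v \<tau> (W xs y)"
  by (simp_all add: W_def)

lemma norm_X: "norm (X N xs y) = norm y"
  by (induction xs rule: rev_induct) (auto simp: X_snoc)

lemma X_proj: "P N y = y \<Longrightarrow> P N (X N xs y) = X N xs y"
  by (induction xs rule: rev_induct) (auto simp: X_snoc E_proj)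

abbreviation "\<kappa> \<equiv> 2 * a / \<delta>"

lemma \<kappa>_nonneg: "0 \<le> \<kappa>"
  using a_pos \<delta>_pos by simp

text \<open>The sample times \<open>ys\<close> witness that the energy of \<open>z\<close>, reached from \<open>y\<close>, is accounted for by the
  variation of \<open>u\<close> up to time \<open>t\<close>. Keeping the list rather than the total variation makes the
  induction over steps elementary.\<close>

definition energy_certificate :: "(real \<Rightarrow> real) \<Rightarrow> nat \<Rightarrow> real \<Rightarrow> 'a \<Rightarrow> 'a \<Rightarrow> real list \<Rightarrow> bool" where
  "energy_certificate u N t y z ys \<longleftrightarrow> ys \<noteq> [] \<and> sorted ys \<and> set ys \<subseteq> {0..t} \<and>
     energy N (u (last ys)) z \<le> exp (\<kappa> * list_variation u ys) * energy N 0 y"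

text \<open>The midpoint of a step samples the value of \<open>u\<close> on it; break points carry arbitrary values.\<close>

lemma energy_certificate_extend:
  assumes cert: "energy_certificate u N (t - \<tau>) y z ys"
    and \<tau>: "0 < \<tau>" and v: "\<And>s. t - \<tau> < s \<Longrightarrow> s < t \<Longrightarrow> u s = v"
    and adm: "\<And>s. admissible (u s)" and z: "P N z = z"
  shows "energy_certificate u N t y z (ys @ [t - \<tau> / 2])" and "u (t - \<tau> / 2) = v"
proof -
  note c = cert[unfolded energy_certificate_def]
  show uv: "u (t - \<tau> / 2) = v" using v \<tau> by auto
  have "energy N v z \<le> exp (\<kappa> * \<bar>v - u (last ys)\<bar>) * energy N (u (last ys)) z"
    by (rule energy_jump[OF z adm])
  also have "\<dots> \<le> exp (\<kappa> * \<bar>v - u (last ys)\<bar>) * (exp (\<kappa> * list_variation u ys) * energy N 0 y)"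
    using c by (intro mult_left_mono) auto
  also have "\<dots> = exp (\<kappa> * \<bar>v - u (last ys)\<bar> + \<kappa> * list_variation u ys) * energy N 0 y"
    by (simp only: exp_add mult.assoc)
  also have "\<kappa> * \<bar>v - u (last ys)\<bar> + \<kappa> * list_variation u ys = \<kappa> * list_variation u (ys @ [t - \<tau> / 2])"
    using c list_variation_snoc[of ys u "t - \<tau> / 2"] unfolding uv by (simp add: distrib_left)
  finally have "energy N v z \<le> exp (\<kappa> * list_variation u (ys @ [t - \<tau> / 2])) * energy N 0 y" .
  moreover have "r \<in> {0..t - \<tau>}" if "r \<in> set ys" for r using c that by auto
  moreover have "0 \<le> t - \<tau>" using c by (cases ys) auto
  ultimately show "energy_certificate u N t y z (ys @ [t - \<tau> / 2])"
    using c \<tau> uv unfolding energy_certificate_def by (auto simp: sorted_append) fastforce+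
qed

text \<open>Energy is conserved within a step, and the growth at the jumps accumulates to the
  exponential of the variation.\<close>

lemma energy_certificate_exists:
  assumes "pc_steps u t xs" and "u 0 = 0" and adm: "\<And>s. admissible (u s)" and y: "P N y = y"
  shows "\<exists>ys. energy_certificate u N t y (X N xs y) ys"
  using assms(1)
proof (induction xs arbitrary: t rule: rev_induct)
  case Nil
  then show ?case
    using assms(2) unfolding energy_certificate_def pc_steps_Nil
    by (intro exI[of _ "[0]"]) (auto simp: list_variation_def)
next
  case (snoc x xs)
  obtain \<tau> v where x: "x = (\<tau>, v)" by (cases x)
  note st = snoc.prems[unfolded x pc_steps_snoc]
  then obtain ys where "energy_certificate u N (t - \<tau>) y (X N xs y) ys"
    using snoc.IH by blast
  then have "energy_certificate u N t y (X N xs y) (ys @ [t - \<tau> / 2])" "u (t - \<tau> / 2) = v"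
    using st adm X_proj[OF y] by (auto intro: energy_certificate_extend)
  then have "energy_certificate u N t y (X N (xs @ [x]) y) (ys @ [t - \<tau> / 2])"
    unfolding energy_certificate_def x X_snoc by (simp add: energy_conserved)
  then show ?case by blast
qed

text \<open>The bound refers to the beginning of the last step, but by conservation it holds throughout it.\<close>

lemma energy_along_steps:
  assumes "pc_steps u t (xs @ [(\<tau>, v)])" and "u 0 = 0" and adm: "\<And>s. admissible (u s)"
    and y: "P N y = y" and TV: "total_variation {0..t} u \<le> ennreal K" and K: "0 \<le> K"
  shows "energy N v (X N xs y) \<le> exp (\<kappa> * K) * energy N 0 y"
proof -
  note st = assms(1)[unfolded pc_steps_snoc]
  then obtain ys where "energy_certificate u N (t - \<tau>) y (X N xs y) ys"
    using energy_certificate_exists[of u "t - \<tau>" xs N y] assms(2) adm y by blast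
  then have c: "energy_certificate u N t y (X N xs y) (ys @ [t - \<tau> / 2])" and v: "u (t - \<tau> / 2) = v"
    using st adm X_proj[OF y] by (auto intro: energy_certificate_extend)
  have "ennreal (list_variation u (ys @ [t - \<tau> / 2])) \<le> total_variation {0..t} u"
    using c unfolding energy_certificate_def by (intro list_variation_le_total_variation) auto
  with TV have "ennreal (list_variation u (ys @ [t - \<tau> / 2])) \<le> ennreal K" by simp
  then have "list_variation u (ys @ [t - \<tau> / 2]) \<le> K"
    using K by (simp add: ennreal_le_iff)
  then have "exp (\<kappa> * list_variation u (ys @ [t - \<tau> / 2])) \<le> exp (\<kappa> * K)"
    using \<kappa>_nonneg by (simp only: exp_le_cancel_iff) (rule mult_left_mono)
  then have "exp (\<kappa> * list_variation u (ys @ [t - \<tau> / 2])) * energy N 0 y \<le> exp (\<kappa> * K) * energy N 0 y"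
    using energy_nonneg by (rule mult_right_mono)
  then show ?thesis using c v unfolding energy_certificate_def by simp
qed

text \<open>Each step transports the previous error isometrically and adds the error of \<open>E_compare\<close>. The bound
  on the energy is needed for the lower order only, and is uniform in the number of steps.\<close>

lemma X_compare:
  assumes "pc_steps u t xs" and "u 0 = 0" and adm: "\<And>s. admissible (u s)"
    and y: "P N y = y" and TV: "total_variation {0..t} u \<le> ennreal K" and K: "0 \<le> K"
    and good: "good_order N \<eta>" and \<eta>: "0 \<le> \<eta>" and "N \<le> M"
  shows "norm (X N xs y - X M xs y)
    \<le> \<eta> * (exp (\<kappa> * K) * energy N 0 y / \<delta> + norm y) * (\<Sum>(\<tau>, v)\<leftarrow>xs. \<tau> * \<bar>v\<bar>)"
  using assms(1) TV
proof (induction xs arbitrary: t rule: rev_induct)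
  case Nil
  then show ?case by simp
next
  case (snoc x xs)
  define C where "C = exp (\<kappa> * K) * energy N 0 y / \<delta> + norm y"
  obtain \<tau> v where x: "x = (\<tau>, v)" by (cases x)
  note st = snoc.prems(1)[unfolded x pc_steps_snoc]
  have v: "admissible v" using adm[of "t - \<tau> / 2"] st by auto
  define z where "z = X N xs y"
  have z: "P N z = z" unfolding z_def by (rule X_proj[OF y])
  have "total_variation {0..t - \<tau>} u \<le> ennreal K"
    using total_variation_subset[of "{0..t - \<tau>}" "{0..t}" u] st snoc.prems(2) by auto
  then have IH: "norm (z - X M xs y) \<le> \<eta> * C * (\<Sum>(\<tau>, v)\<leftarrow>xs. \<tau> * \<bar>v\<bar>)"
    using snoc.IH st unfolding C_def z_def by blast
  have en: "energy N v z \<le> exp (\<kappa> * K) * energy N 0 y"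
    unfolding z_def using snoc.prems adm y K assms(2) by (intro energy_along_steps) (auto simp: x)
  have "norm (E N v \<tau> z - E M v \<tau> z) \<le> \<bar>v\<bar> * (\<eta> * (energy N v z / \<delta> + norm z)) * \<bar>\<tau>\<bar>"
    by (rule E_compare[OF good \<eta> \<open>N \<le> M\<close> z v])
  also have "\<dots> \<le> \<bar>v\<bar> * (\<eta> * C) * \<bar>\<tau>\<bar>"
    unfolding C_def using en \<delta>_pos \<eta>
    by (intro mult_right_mono mult_left_mono add_mono divide_right_mono) (auto simp: z_def norm_X)
  finally have 1: "norm (E N v \<tau> z - E M v \<tau> z) \<le> \<eta> * C * (\<tau> * \<bar>v\<bar>)"
    using st by (simp add: mult_ac)
  have "norm (X N (xs @ [x]) y - X M (xs @ [x]) y)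
      = norm ((E N v \<tau> z - E M v \<tau> z) + E M v \<tau> (z - X M xs y))"
    unfolding x X_snoc z_def by (simp add: E_diff)
  also have "\<dots> \<le> norm (E N v \<tau> z - E M v \<tau> z) + norm (E M v \<tau> (z - X M xs y))"
    by (rule norm_triangle_ineq)
  also have "\<dots> \<le> \<eta> * C * (\<tau> * \<bar>v\<bar>) + \<eta> * C * (\<Sum>(\<tau>, v)\<leftarrow>xs. \<tau> * \<bar>v\<bar>)"
    unfolding norm_E by (rule add_mono[OF 1 IH])
  finally show ?case unfolding C_def[symmetric] x by (simp add: distrib_left add.commute)
qed

lemma W_isometry:
  assumes "\<And>\<tau> v. (\<tau>, v) \<in> set xs \<Longrightarrow> admissible v"
  shows "norm (W xs x - W xs y) = norm (x - y)"
  using assms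
proof (induction xs rule: rev_induct)
  case (snoc p xs)
  obtain \<tau> v where p: "p = (\<tau>, v)" by (cases p)
  then have v: "admissible v" using snoc.prems by auto
  have "norm (W xs x - W xs y) = norm (x - y)"
    using snoc.prems by (intro snoc.IH) auto
  then show ?case
    unfolding p W_snoc by (simp add: U_diff[OF v, symmetric] norm_U[OF v])
qed simp

lemma X_tendsto_W:
  assumes "\<And>\<tau> v. (\<tau>, v) \<in> set xs \<Longrightarrow> admissible v"
  shows "(\<lambda>N. X N xs y) \<longlonglongrightarrow> W xs y"
  using assms
proof (induction xs rule: rev_induct)
  case Nil
  then show ?case by simp
next
  case (snoc p xs)
  obtain \<tau> v where p: "p = (\<tau>, v)" by (cases p)
  then have v: "admissible v" using snoc.prems by auto
  show ?case
    unfolding p X_snoc W_snoc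
    using snoc by (intro E_tendsto_U_moving[OF v]) auto
qed

lemma control_admissible: "u \<in> controls \<delta> a \<Longrightarrow> admissible (u s)"
  using controls_abs_le[of u \<delta> a s] a_pos by (simp add: field_simps)

text \<open>The constant in front of \<open>\<eta>\<close> in the error estimates.\<close>

definition growth :: "real \<Rightarrow> 'a \<Rightarrow> real" where
  "growth K x = exp (\<kappa> * K) * (norm (A x) + b / a * norm x) / \<delta> + norm x"

lemma growth_nonneg: "0 \<le> growth K x"
  unfolding growth_def using a_pos b_nonneg \<delta>_pos by auto

text \<open>Let \<open>M\<close> tend to infinity in \<open>X_compare\<close>.\<close>

lemma pc_propagator_galerkin_error:
  assumes u: "u \<in> controls \<delta> a" "piecewise_constant u" and t: "0 \<le> t" and x: "x \<in> DA"
    and TV: "total_variation {0..t} u \<le> ennreal K" and K: "0 \<le> K"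
    and good: "good_order N \<eta>" and \<eta>: "0 \<le> \<eta>" and steps: "pc_steps u t xs"
  shows "norm (W xs x - X N xs (P N x))
    \<le> norm (x - P N x) + \<eta> * growth K x * integral {0..t} (\<lambda>s. \<bar>u s\<bar>)"
proof -
  note adm = control_admissible[OF u(1)]
  have xs: "admissible v" if "(\<tau>, v) \<in> set xs" for \<tau> v
    using pc_steps_values[OF steps that] adm by auto
  have "norm (W xs (P N x) - X N xs (P N x))
      \<le> \<eta> * growth K x * integral {0..t} (\<lambda>s. \<bar>u s\<bar>)"
  proof (rule LIMSEQ_le_const2)
    show "(\<lambda>M. norm (X M xs (P N x) - X N xs (P N x))) \<longlonglongrightarrow> norm (W xs (P N x) - X N xs (P N x))"
      using xs by (intro tendsto_intros X_tendsto_W)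
    have "norm (X M xs (P N x) - X N xs (P N x)) \<le> \<eta> * growth K x * integral {0..t} (\<lambda>s. \<bar>u s\<bar>)"
      if "N \<le> M" for M
    proof -
      have sum: "(\<Sum>(\<tau>, v)\<leftarrow>xs. \<tau> * \<bar>v\<bar>) = integral {0..t} (\<lambda>s. \<bar>u s\<bar>)"
        using pc_steps_has_integral_abs[OF steps] by (simp add: integral_unique)
      have int: "0 \<le> integral {0..t} (\<lambda>s. \<bar>u s\<bar>)"
        using pc_steps_has_integral_abs[OF steps] by (intro integral_nonneg) auto
      have "norm (X N xs (P N x) - X M xs (P N x))
          \<le> \<eta> * (exp (\<kappa> * K) * energy N 0 (P N x) / \<delta> + norm (P N x)) * integral {0..t} (\<lambda>s. \<bar>u s\<bar>)"
        unfolding sum[symmetric] using controls_zero[OF u(1), of 0]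
        by (intro X_compare[OF steps _ adm _ TV K good \<eta> that]) auto
      also have "\<dots> \<le> \<eta> * growth K x * integral {0..t} (\<lambda>s. \<bar>u s\<bar>)"
        unfolding growth_def using energy_proj_le[OF x, of N 0] \<delta>_pos \<eta> int norm_proj_le
        by (intro mult_right_mono mult_left_mono add_mono divide_right_mono) auto
      finally show ?thesis by (simp add: norm_minus_commute)
    qed
    then show "\<exists>M0. \<forall>M\<ge>M0. norm (X M xs (P N x) - X N xs (P N x))
        \<le> \<eta> * growth K x * integral {0..t} (\<lambda>s. \<bar>u s\<bar>)" by blast
  qed
  moreover have "norm (W xs x - W xs (P N x)) = norm (x - P N x)"
    using xs by (rule W_isometry)
  moreover have "norm (W xs x - X N xs (P N x))
      \<le> norm (W xs x - W xs (P N x)) + norm (W xs (P N x) - X N xs (P N x))"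
    using norm_triangle_ineq[of "W xs x - W xs (P N x)" "W xs (P N x) - X N xs (P N x)"] by simp
  ultimately show ?thesis by linarith
qed

lemma pc_propagator_eq_W:
  assumes u: "u \<in> controls \<delta> a" "piecewise_constant u" and t: "0 \<le> t"
  shows "\<exists>xs. pc_steps u t xs \<and> pc_propagator DA A B u t = W xs"
proof -
  define xs where "xs = (SOME xs. pc_steps u t xs)"
  have xs: "pc_steps u t xs"
    unfolding xs_def using pc_steps_exist[OF u(2) t] by (rule someI_ex)
  have "fold (\<lambda>(\<tau>, v). exp_group DA (\<lambda>x. A x + v *\<^sub>R B x) \<tau>) xs = fold (\<lambda>(\<tau>, v). U v \<tau>) xs"
  proof (rule ext, rule List.fold_cong)
    fix p assume p: "p \<in> set xs"
    obtain \<tau> v where pv: "p = (\<tau>, v)" by (cases p)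
    then have "admissible v"
      using pc_steps_values[OF xs] p control_admissible[OF u(1)] by blast
    then show "(case p of (\<tau>, v) \<Rightarrow> exp_group DA (\<lambda>x. A x + v *\<^sub>R B x) \<tau>) = (case p of (\<tau>, v) \<Rightarrow> U v \<tau>)"
      by (simp add: pv exp_group_eq_U)
  qed auto
  then show ?thesis
    using xs unfolding pc_propagator_def W_def xs_def[symmetric] by blast
qed

end

section \<open>Solutions of the Galerkin systems\<close>

text \<open>The function \<open>exp (- M r) (c + M \<integral>\<^sub>0\<^sup>r f)\<close> does not increase.\<close>

lemma gronwall:
  fixes f :: "real \<Rightarrow> real"
  assumes f: "continuous_on {0..t} f" and M: "0 \<le> M"
    and le: "\<And>r. r \<in> {0..t} \<Longrightarrow> f r \<le> c + M * integral {0..r} f"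
    and r: "r \<in> {0..t}"
  shows "f r \<le> c * exp (M * r)"
proof -
  define F where "F r = c + M * integral {0..r} f" for r
  have F': "(F has_real_derivative M * f s) (at s within {0..t})" if "s \<in> {0..t}" for s
    unfolding F_def[abs_def]
    using integral_has_real_derivative[OF f that]
    by (auto intro!: derivative_eq_intros)
  have "F r * exp (- M * r) \<le> F 0 * exp (- M * 0)"
  proof (rule DERIV_nonpos_imp_decreasing_open[where f = "\<lambda>s. F s * exp (- M * s)"])
    show "0 \<le> r" using r by simp
    fix s assume s: "0 < s" "s < r"
    have "(F has_real_derivative M * f s) (at s)"
      using F'[of s] s r by (simp add: at_within_Icc_at)
    then have "((\<lambda>s. F s * exp (- M * s)) has_real_derivative
        M * f s * exp (- M * s) + (exp (- M * s) * - M) * F s) (at s)"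
      by (auto intro!: derivative_eq_intros)
    moreover have "M * f s * exp (- M * s) + (exp (- M * s) * - M) * F s = M * exp (- M * s) * (f s - F s)"
      by (simp add: algebra_simps)
    moreover have "M * exp (- M * s) * (f s - F s) \<le> 0"
      using le[of s] s r M unfolding F_def by (intro mult_nonneg_nonpos) auto
    ultimately show "\<exists>y. ((\<lambda>s. F s * exp (- M * s)) has_real_derivative y) (at s) \<and> y \<le> 0" by metis
  next
    have "continuous_on {0..t} F"
      using F' by (intro DERIV_continuous_on)
    then show "continuous_on {0..r} (\<lambda>s. F s * exp (- M * s))"
      using r by (auto intro!: continuous_intros elim: continuous_on_subset)
  qed
  then have "F r * exp (- M * r) \<le> c" by (simp add: F_def)
  then have "F r \<le> c * exp (M * r)"
    by (simp add: exp_minus field_simps)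
  then show ?thesis using le[OF r] unfolding F_def by simp
qed

text \<open>Gauge integrals of functions with values in a Banach space are compatible with uniform convergence.\<close>

lemma has_integral_limit:
  fixes f :: "nat \<Rightarrow> real \<Rightarrow> 'a::banach"
  assumes int: "\<And>n. (f n has_integral I n) {x..y}" and "I \<longlonglongrightarrow> L"
    and close: "\<And>n s. s \<in> {x..y} \<Longrightarrow> norm (f n s - g s) \<le> \<epsilon> n" and \<epsilon>: "\<epsilon> \<longlonglongrightarrow> 0"
  shows "(g has_integral L) {x..y}"
proof (cases "x \<le> y")
  case False
  then have "I n = 0" for n using int[of n] has_integral_unique[of "f n" "I n" "{x..y}" 0] by simp
  then have "I = (\<lambda>_. 0)" by (simp add: fun_eq_iff)
  then have "L = 0" using \<open>I \<longlonglongrightarrow> L\<close> by (simp add: LIMSEQ_const_iff)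
  then show ?thesis using False by simp
next
  case True
  have g: "g integrable_on cbox x y"
  proof (rule integrable_uniform_limit)
    fix e :: real assume "e > 0"
    then obtain n where "\<epsilon> n < e"
      using order_tendstoD(2)[OF \<epsilon>] eventually_happens[of _ sequentially] by force
    then have "norm (g s - f n s) \<le> e" if "s \<in> cbox x y" for s
      using close[of s n] that by (simp add: norm_minus_commute)
    then show "\<exists>h. (\<forall>s\<in>cbox x y. norm (g s - h s) \<le> e) \<and> h integrable_on cbox x y"
      using int[of n] by (intro exI[of _ "f n"]) (auto simp: integrable_on_def)
  qed
  have "norm (I n - integral {x..y} g) \<le> \<epsilon> n * (y - x)" for n
  proof -
    have "((\<lambda>s. f n s - g s) has_integral (I n - integral {x..y} g)) {x..y}"
      using g by (intro has_integral_diff int) (simp add: has_integral_iff)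
    moreover have "norm (integral {x..y} (\<lambda>s. f n s - g s)) \<le> integral {x..y} (\<lambda>_. \<epsilon> n)"
      using calculation close by (intro integral_norm_bound_integral) auto
    ultimately show ?thesis using True by (simp add: integral_unique mult.commute)
  qed
  moreover have "(\<lambda>n. \<epsilon> n * (y - x)) \<longlonglongrightarrow> 0" using tendsto_mult_right[OF \<epsilon>, of "y - x"] by simp
  ultimately have "(\<lambda>n. I n - integral {x..y} g) \<longlonglongrightarrow> 0"
    using Lim_null_comparison[of "\<lambda>n. I n - integral {x..y} g" "\<lambda>n. \<epsilon> n * (y - x)"] by auto
  then have "I \<longlonglongrightarrow> integral {x..y} g" by (simp add: LIM_zero_iff)
  then have "integral {x..y} g = L" using \<open>I \<longlonglongrightarrow> L\<close> LIMSEQ_unique by blast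
  then show ?thesis using g by (simp add: has_integral_iff)
qed

context bounded_control_setting
begin

abbreviation "solution N u t x \<equiv> galerkin_solution \<phi> N A B u 0 t x"

text \<open>On the range of the projection, the right-hand side of the Galerkin system is given by \<open>Gop\<close>.\<close>

lemma galerkin_solution_iff:
  "solution N u t x \<longleftrightarrow> continuous_on {0..t} x \<and> (\<forall>r\<in>{0..t}. P N (x r) = x r) \<and>
     (\<forall>r\<in>{0..t}. ((\<lambda>s. Gop N (u s) (x s)) has_integral (x r - x 0)) {0..r})"
proof -
  have range: "x ` {0..t} \<subseteq> range (P N) \<longleftrightarrow> (\<forall>r\<in>{0..t}. P N (x r) = x r)"
  proof -
    have "z \<in> range (P N) \<longleftrightarrow> P N z = z" for z
    proof
      assume "P N z = z"
      then show "z \<in> range (P N)" by (rule range_eqI[OF sym])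
    qed auto
    then show ?thesis by (simp add: image_subset_iff)
  qed
  have "((\<lambda>s. compression \<phi> N A (x s) + u s *\<^sub>R compression \<phi> N B (x s)) has_integral I) {0..r} \<longleftrightarrow>
      ((\<lambda>s. Gop N (u s) (x s)) has_integral I) {0..r}"
    if "\<forall>r\<in>{0..t}. P N (x r) = x r" "r \<in> {0..t}" for r I
    using that by (intro has_integral_cong) (auto simp: compression_def Gop_def)
  then show ?thesis unfolding galerkin_solution_def range by auto
qed

definition Bc :: "nat \<Rightarrow> 'a \<Rightarrow> 'a" where
  "Bc N x = P N (B (P N x))"

lemma Bc_bounded_linear: "bounded_linear (Bc N)"
  unfolding Bc_def by (rule bounded_linear_proj_op[OF B_linear])

lemma Gop_bounded_linear: "bounded_linear (Gop N v)"
  using Gop_skew_bounded by (simp add: skew_bounded_def bounded_operator_def)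

lemma Gop_diff_values: "Gop N v x - Gop N w x = (v - w) *\<^sub>R Bc N x"
  unfolding Gop_def Bc_def by (simp add: scaleR_diff_left)

text \<open>A Lipschitz constant of the Galerkin system which is valid for all values of a control.\<close>

definition rate :: "nat \<Rightarrow> real" where
  "rate N = onorm (Gop N 0) + (1 - \<delta>) / a * onorm (Bc N)"

lemma rate_nonneg: "0 \<le> rate N"
  unfolding rate_def
  using onorm_pos_le[OF Gop_bounded_linear] onorm_pos_le[OF Bc_bounded_linear] a_pos \<delta>_less by simp

lemma norm_Gop_le:
  assumes "\<bar>v\<bar> \<le> (1 - \<delta>) / a"
  shows "norm (Gop N v x) \<le> rate N * norm x"
proof -
  have "Gop N v x = Gop N 0 x + v *\<^sub>R Bc N x"
    using Gop_diff_values[of N v x 0] by (simp add: algebra_simps)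
  then have "norm (Gop N v x) \<le> norm (Gop N 0 x) + \<bar>v\<bar> * norm (Bc N x)"
    using norm_triangle_ineq[of "Gop N 0 x" "v *\<^sub>R Bc N x"] by simp
  also have "\<dots> \<le> onorm (Gop N 0) * norm x + (1 - \<delta>) / a * (onorm (Bc N) * norm x)"
    using assms a_pos \<delta>_less
    by (intro add_mono mult_mono onorm Gop_bounded_linear Bc_bounded_linear) auto
  finally show ?thesis unfolding rate_def by (simp add: algebra_simps)
qed

text \<open>Gronwall's inequality for the difference of two solutions. It yields uniqueness, the a priori bound
  and continuity with respect to the control in \<open>L\<^sup>1\<close>.\<close>

lemma solution_stability:
  assumes u: "u \<in> controls \<delta> a" and w: "w \<in> controls \<delta> a"
    and x: "solution N u t x" and y: "solution N w t y"
    and C: "\<And>s. s \<in> {0..t} \<Longrightarrow> norm (y s) \<le> C"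
    and r: "r \<in> {0..t}"
  shows "norm (x r - y r) \<le> (norm (x 0 - y 0) +
    onorm (Bc N) * C * integral {0..t} (\<lambda>s. \<bar>u s - w s\<bar>)) * exp (rate N * r)"
proof (rule gronwall[OF _ rate_nonneg _ r])
  note X = x[unfolded galerkin_solution_iff] and Y = y[unfolded galerkin_solution_iff]
  show cont: "continuous_on {0..t} (\<lambda>r. norm (x r - y r))"
    using X Y by (intro continuous_intros) auto
  fix r assume r: "r \<in> {0..t}"
  have C0: "0 \<le> C" using C[OF r] norm_ge_zero order_trans by blast
  have B0: "0 \<le> onorm (Bc N)" by (rule onorm_pos_le[OF Bc_bounded_linear])
  define k where "k = onorm (Bc N) * C"
  have k: "0 \<le> k" unfolding k_def using B0 C0 by simp
  have uw: "(\<lambda>s. \<bar>u s - w s\<bar>) integrable_on {0..q}" for q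
    by (rule controls_abs_diff_integrable[OF u w])
  have xy: "(\<lambda>s. norm (x s - y s)) integrable_on {0..r}"
    using r by (intro integrable_continuous_real continuous_on_subset[OF cont]) auto
  have "((\<lambda>s. Gop N (u s) (x s) - Gop N (w s) (y s)) has_integral ((x r - x 0) - (y r - y 0))) {0..r}"
    using X Y r by (intro has_integral_diff) auto
  moreover have "norm (integral {0..r} (\<lambda>s. Gop N (u s) (x s) - Gop N (w s) (y s)))
      \<le> integral {0..r} (\<lambda>s. rate N * norm (x s - y s) + k * \<bar>u s - w s\<bar>)"
  proof (rule integral_norm_bound_integral)
    show "(\<lambda>s. Gop N (u s) (x s) - Gop N (w s) (y s)) integrable_on {0..r}"
      using calculation by blast
    show "(\<lambda>s. rate N * norm (x s - y s) + k * \<bar>u s - w s\<bar>) integrable_on {0..r}"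
      by (intro integrable_add integrable_on_mult_right xy uw)
    fix s assume s: "s \<in> {0..r}"
    have "Gop N (u s) (x s) - Gop N (w s) (y s) = Gop N (u s) (x s - y s) + (u s - w s) *\<^sub>R Bc N (y s)"
      by (simp add: linear_simps[OF Gop_bounded_linear]
          Gop_diff_values[of N "u s" "y s" "w s", symmetric])
    then have "norm (Gop N (u s) (x s) - Gop N (w s) (y s))
        \<le> norm (Gop N (u s) (x s - y s)) + \<bar>u s - w s\<bar> * norm (Bc N (y s))"
      using norm_triangle_ineq[of "Gop N (u s) (x s - y s)" "(u s - w s) *\<^sub>R Bc N (y s)"] by simp
    also have "\<dots> \<le> rate N * norm (x s - y s) + \<bar>u s - w s\<bar> * k"
    proof (intro add_mono mult_left_mono norm_Gop_le controls_abs_le[OF u])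
      have "norm (Bc N (y s)) \<le> onorm (Bc N) * norm (y s)"
        by (rule onorm[OF Bc_bounded_linear])
      also have "\<dots> \<le> k" unfolding k_def using C[of s] s r B0 by (intro mult_left_mono) auto
      finally show "norm (Bc N (y s)) \<le> k" .
    qed simp
    finally show "norm (Gop N (u s) (x s) - Gop N (w s) (y s)) \<le> rate N * norm (x s - y s) + k * \<bar>u s - w s\<bar>"
      by (simp add: mult.commute)
  qed
  moreover have "integral {0..r} (\<lambda>s. rate N * norm (x s - y s) + k * \<bar>u s - w s\<bar>)
      = rate N * integral {0..r} (\<lambda>s. norm (x s - y s)) + k * integral {0..r} (\<lambda>s. \<bar>u s - w s\<bar>)"
    by (simp add: integral_add integrable_on_mult_right xy uw)
  moreover have "k * integral {0..r} (\<lambda>s. \<bar>u s - w s\<bar>) \<le> k * integral {0..t} (\<lambda>s. \<bar>u s - w s\<bar>)"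
    using r k uw by (intro mult_left_mono integral_subset_le) auto
  ultimately have 1: "norm ((x r - x 0) - (y r - y 0))
      \<le> rate N * integral {0..r} (\<lambda>s. norm (x s - y s)) + k * integral {0..t} (\<lambda>s. \<bar>u s - w s\<bar>)"
    by (simp add: integral_unique)
  have "norm (x r - y r) \<le> norm (x 0 - y 0) + norm ((x r - x 0) - (y r - y 0))"
    using norm_triangle_ineq[of "x 0 - y 0" "(x r - x 0) - (y r - y 0)"] by simp
  with 1 show "norm (x r - y r) \<le> norm (x 0 - y 0) + onorm (Bc N) * C * integral {0..t} (\<lambda>s. \<bar>u s - w s\<bar>)
      + rate N * integral {0..r} (\<lambda>r. norm (x r - y r))"
    unfolding k_def by simp
qed

text \<open>Comparison with this solution gives the a priori bound.\<close>

lemma zero_solution: "solution N u t (\<lambda>_. 0)"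
  unfolding galerkin_solution_iff by (simp add: linear_simps[OF Gop_bounded_linear])

lemma solution_norm_le:
  assumes "u \<in> controls \<delta> a" and "solution N u t x" and r: "r \<in> {0..t}"
  shows "norm (x r) \<le> norm (x 0) * exp (rate N * t)"
proof -
  have "norm (x r) \<le> norm (x 0) * exp (rate N * r)"
    using solution_stability[OF assms(1,1,2) zero_solution, of 0 r] r by simp
  also have "\<dots> \<le> norm (x 0) * exp (rate N * t)"
    using r rate_nonneg by (intro mult_left_mono) (auto intro: mult_left_mono)
  finally show ?thesis .
qed

lemma solution_unique:
  assumes "u \<in> controls \<delta> a" and "solution N u t x" "solution N u t y" "x 0 = y 0" and r: "r \<in> {0..t}"
  shows "x r = y r"
  using solution_stability[OF assms(1,1,2,3) solution_norm_le[OF assms(1,3)] r] assms(4) by simp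

text \<open>The integrand is changed at most at the end points of the added interval, where \<open>u\<close> is arbitrary.\<close>

lemma solution_append:
  assumes x: "solution N u s x" and \<tau>: "0 < \<tau>" and s: "0 \<le> s"
    and v: "\<And>r. s < r \<Longrightarrow> r < s + \<tau> \<Longrightarrow> u r = v"
  shows "solution N u (s + \<tau>) (\<lambda>r. if r \<le> s then x r else E N v (r - s) (x s))"
    (is "solution N u (s + \<tau>) ?z")
proof -
  note X = x[unfolded galerkin_solution_iff]
  interpret G: skew_bounded "Gop N v" by (rule Gop_skew_bounded)
  define e where "e r = E N v (r - s) (x s)" for r
  have e': "(e has_vector_derivative Gop N v (e r)) (at r)" for r
  proof -
    have "((\<lambda>r. r - s) has_vector_derivative 1) (at r)"
      by (auto intro!: derivative_eq_intros)
    from vector_diff_chain_at[OF this G.oexp_derivative] show ?thesis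
      by (simp add: o_def e_def[abs_def] E_def)
  qed
  have es: "e s = x s" by (simp add: e_def E_def G.oexp_zero)
  have "continuous_on {0..s + \<tau>} ?z"
    unfolding e_def[symmetric]
  proof (rule continuous_on_cases_le)
    show "continuous_on {r \<in> {0..s + \<tau>}. r \<le> s} x"
      using X by (auto elim: continuous_on_subset)
    show "continuous_on {r \<in> {0..s + \<tau>}. s \<le> r} e"
      by (intro continuous_at_imp_continuous_on ballI has_vector_derivative_continuous[OF e'])
  qed (auto simp: es intro: continuous_intros)
  moreover have "P N (?z r) = ?z r" if "r \<in> {0..s + \<tau>}" for r
    using X that s E_proj[of N "x s" v "r - s"] by auto
  moreover have "((\<lambda>q. Gop N (u q) (?z q)) has_integral (?z r - ?z 0)) {0..r}" if r: "r \<in> {0..s + \<tau>}" for r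
  proof -
    have left: "((\<lambda>q. Gop N (u q) (?z q)) has_integral (x r' - x 0)) {0..r'}" if "r' \<in> {0..s}" for r'
    proof -
      have "((\<lambda>q. Gop N (u q) (x q)) has_integral (x r' - x 0)) {0..r'}" using X that by blast
      then show ?thesis by (rule has_integral_eq[rotated]) (use that in auto)
    qed
    show ?thesis
    proof (cases "r \<le> s")
      case True
      then show ?thesis using left[of r] r s by simp
    next
      case False
      have "((\<lambda>q. Gop N v (e q)) has_integral (e r - e s)) {s..r}"
        using False e' by (intro fundamental_theorem_of_calculus) (auto intro: has_vector_derivative_at_within)
      then have "((\<lambda>q. Gop N (u q) (?z q)) has_integral (e r - e s)) {s..r}"
        using v r by (elim has_integral_spike_finite[of "{s, s + \<tau>}", rotated 2]) (auto simp: e_def)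
      then have "((\<lambda>q. Gop N (u q) (?z q)) has_integral ((x s - x 0) + (e r - e s))) {0..r}"
        using left[of s] s False by (intro has_integral_combine[of 0 s r]) auto
      then show ?thesis using False s by (simp add: es e_def[symmetric])
    qed
  qed
  ultimately show ?thesis unfolding galerkin_solution_iff by blast
qed

lemma pc_solution_exists:
  assumes "pc_steps u t xs" and y: "P N y = y"
  shows "\<exists>x. solution N u t x \<and> x 0 = y \<and> x t = X N xs y"
  using assms(1)
proof (induction xs arbitrary: t rule: rev_induct)
  case Nil
  then show ?case
    using y by (intro exI[of _ "\<lambda>_. y"]) (auto simp: galerkin_solution_iff pc_steps_Nil)
next
  case (snoc p xs)
  obtain \<tau> v where p: "p = (\<tau>, v)" by (cases p)
  note st = snoc.prems[unfolded p pc_steps_snoc]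
  then obtain x where x: "solution N u (t - \<tau>) x" "x 0 = y" "x (t - \<tau>) = X N xs y"
    using snoc.IH by blast
  have t: "0 \<le> t - \<tau>" using st pc_steps_nonneg by blast
  have "solution N u (t - \<tau> + \<tau>) (\<lambda>r. if r \<le> t - \<tau> then x r else E N v (r - (t - \<tau>)) (x (t - \<tau>)))"
    using st t by (intro solution_append x(1)) auto
  then show ?case
    using st t x(2,3)
    by (intro exI[of _ "\<lambda>r. if r \<le> t - \<tau> then x r else E N v (r - (t - \<tau>)) (x (t - \<tau>))"])
      (auto simp: p X_snoc)
qed

text \<open>Controls of bounded variation are uniform limits of piecewise constant ones, and by the
  stability estimate the corresponding solutions converge uniformly.\<close>

lemma solution_exists:
  assumes u: "u \<in> controls \<delta> a" and t: "0 \<le> t" and y: "P N y = y"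
  shows "\<exists>x. solution N u t x \<and> x 0 = y"
proof -
  have "\<exists>v\<in>controls \<delta> a. piecewise_constant v \<and> (\<forall>s. \<bar>v s - u s\<bar> \<le> inverse (real (Suc n)))" for n
    using controls_uniform_approximation[OF u t, of "inverse (real (Suc n))"] by auto
  then obtain v where v: "\<And>n. v n \<in> controls \<delta> a" "\<And>n. piecewise_constant (v n)"
    and vu: "\<And>n s. \<bar>v n s - u s\<bar> \<le> inverse (real (Suc n))" by metis
  have "\<exists>x. solution N (v n) t x \<and> x 0 = y" for n
    using pc_steps_exist[OF v(2) t, of n] pc_solution_exists[OF _ y] by blast
  then obtain x where x: "\<And>n. solution N (v n) t (x n)" and x0: "\<And>n. x n 0 = y" by metis
  note X = x[unfolded galerkin_solution_iff]
  define i where "i n = inverse (real (Suc n))" for n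
  have i: "i \<longlonglongrightarrow> 0" unfolding i_def by (rule LIMSEQ_inverse_real_of_nat)
  define C where "C = norm y * exp (rate N * t)"
  have C: "norm (x n r) \<le> C" if "r \<in> {0..t}" for n r
    using solution_norm_le[OF v(1) x that, of n] by (simp add: x0 C_def)
  have C0: "0 \<le> C" unfolding C_def by simp
  define k where "k = onorm (Bc N) * C"
  have k: "0 \<le> k" unfolding k_def using C0 onorm_pos_le[OF Bc_bounded_linear] by simp
  \<comment> \<open>the stability constant, times the length of the interval on which uniform distance bounds
    the distance in \<open>L\<^sup>1\<close>\<close>
  define Q where "Q = k * t * exp (rate N * t)"
  have diff: "norm (x n r - x m r) \<le> Q * (i n + i m)" if r: "r \<in> {0..t}" for n m r
  proof -
    have "integral {0..t} (\<lambda>s. \<bar>v n s - v m s\<bar>) \<le> integral {0..t} (\<lambda>s. i n + i m)"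
    proof (rule integral_le)
      show "\<bar>v n s - v m s\<bar> \<le> i n + i m" for s
        using vu[of n s] vu[of m s] unfolding i_def by linarith
    qed (auto intro: controls_abs_diff_integrable[OF v(1) v(1)])
    also have "\<dots> = t * (i n + i m)" using t by simp
    finally have "k * integral {0..t} (\<lambda>s. \<bar>v n s - v m s\<bar>) \<le> k * (t * (i n + i m))"
      using k by (rule mult_left_mono)
    moreover have "exp (rate N * r) \<le> exp (rate N * t)"
      using r rate_nonneg by (auto intro: mult_left_mono)
    ultimately have "k * integral {0..t} (\<lambda>s. \<bar>v n s - v m s\<bar>) * exp (rate N * r)
        \<le> k * (t * (i n + i m)) * exp (rate N * t)"
      by (rule mult_mono) (use k t in \<open>auto simp: i_def\<close>)
    moreover have "norm (x n r - x m r) \<le> k * integral {0..t} (\<lambda>s. \<bar>v n s - v m s\<bar>) * exp (rate N * r)"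
      using solution_stability[OF v(1) v(1) x x C r, of n m] unfolding k_def by (simp add: x0)
    moreover have "k * (t * (i n + i m)) * exp (rate N * t) = Q * (i n + i m)"
      by (simp add: Q_def mult_ac)
    ultimately show ?thesis by linarith
  qed
  have "convergent (\<lambda>n. x n r)" if r: "r \<in> {0..t}" for r
  proof (rule Cauchy_convergent, rule metric_CauchyI)
    fix e :: real assume e: "e > 0"
    have "(\<lambda>n. Q * i n) \<longlonglongrightarrow> 0" using tendsto_mult_left[OF i, of Q] by simp
    then have "\<forall>\<^sub>F n in sequentially. Q * i n < e / 2" using e by (intro order_tendstoD(2)) auto
    then obtain M where M: "\<And>n. n \<ge> M \<Longrightarrow> Q * i n < e / 2" unfolding eventually_sequentially by blast
    have "dist (x n r) (x m r) < e" if "n \<ge> M" "m \<ge> M" for n m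
      using diff[OF r, of n m] M[OF that(1)] M[OF that(2)] by (simp add: dist_norm distrib_left)
    then show "\<exists>M. \<forall>m\<ge>M. \<forall>n\<ge>M. dist (x m r) (x n r) < e" by blast
  qed
  then have lim: "(\<lambda>n. x n r) \<longlonglongrightarrow> lim (\<lambda>n. x n r)" if "r \<in> {0..t}" for r
    using that convergent_LIMSEQ_iff by blast
  define z where "z r = lim (\<lambda>n. x n r)" for r
  note lim = lim[folded z_def]
  have close: "norm (x n r - z r) \<le> Q * i n" if r: "r \<in> {0..t}" for n r
  proof (rule LIMSEQ_le)
    show "(\<lambda>m. norm (x n r - x m r)) \<longlonglongrightarrow> norm (x n r - z r)"
      by (intro tendsto_intros lim[OF r])
    have "(\<lambda>m. Q * (i n + i m)) \<longlonglongrightarrow> Q * (i n + 0)" by (intro tendsto_intros i)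
    then show "(\<lambda>m. Q * (i n + i m)) \<longlonglongrightarrow> Q * i n" by simp
  qed (use diff[OF r] in blast)
  have Qi: "(\<lambda>n. Q * i n) \<longlonglongrightarrow> 0" using tendsto_mult_left[OF i, of Q] by simp
  have "uniform_limit {0..t} x z sequentially"
  proof (rule uniform_limitI)
    fix e :: real assume "e > 0"
    then have "\<forall>\<^sub>F n in sequentially. Q * i n < e" using Qi by (intro order_tendstoD(2)) auto
    then show "\<forall>\<^sub>F n in sequentially. \<forall>r\<in>{0..t}. dist (x n r) (z r) < e"
      by eventually_elim (auto simp: dist_norm intro!: le_less_trans[OF close])
  qed
  then have "continuous_on {0..t} z"
    by (rule uniform_limit_theorem[rotated]) (use X in auto)
  moreover have "P N (z r) = z r" if r: "r \<in> {0..t}" for r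
  proof (rule LIMSEQ_unique)
    show "(\<lambda>n. P N (x n r)) \<longlonglongrightarrow> P N (z r)"
      by (rule bounded_linear.tendsto[OF proj_bounded_linear lim[OF r]])
    show "(\<lambda>n. P N (x n r)) \<longlonglongrightarrow> z r" using lim[OF r] X r by simp
  qed
  moreover have "((\<lambda>s. Gop N (u s) (z s)) has_integral (z r - z 0)) {0..r}" if r: "r \<in> {0..t}" for r
  proof (rule has_integral_limit)
    show "((\<lambda>s. Gop N (v n s) (x n s)) has_integral (x n r - x n 0)) {0..r}" for n
      using X r by blast
    show "(\<lambda>n. x n r - x n 0) \<longlonglongrightarrow> z r - z 0"
      using t by (intro tendsto_diff lim r) auto
    have "(\<lambda>n. rate N * (Q * i n) + i n * k) \<longlonglongrightarrow> rate N * 0 + 0 * k"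
      by (intro tendsto_intros Qi i)
    then show "(\<lambda>n. rate N * (Q * i n) + i n * k) \<longlonglongrightarrow> 0" by simp
    fix n s assume "s \<in> {0..r}"
    then have s: "s \<in> {0..t}" using r by auto
    have "Gop N (v n s) (x n s) - Gop N (u s) (z s) = Gop N (u s) (x n s - z s) + (v n s - u s) *\<^sub>R Bc N (x n s)"
      by (simp add: linear_simps[OF Gop_bounded_linear]
          Gop_diff_values[of N "v n s" "x n s" "u s", symmetric])
    then have "norm (Gop N (v n s) (x n s) - Gop N (u s) (z s))
        \<le> norm (Gop N (u s) (x n s - z s)) + \<bar>v n s - u s\<bar> * norm (Bc N (x n s))"
      using norm_triangle_ineq[of "Gop N (u s) (x n s - z s)" "(v n s - u s) *\<^sub>R Bc N (x n s)"] by simp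
    also have "\<dots> \<le> rate N * norm (x n s - z s) + i n * (onorm (Bc N) * norm (x n s))"
      using vu[of n s]
      by (intro add_mono mult_mono norm_Gop_le controls_abs_le[OF u] onorm Bc_bounded_linear)
        (auto simp: i_def)
    also have "\<dots> \<le> rate N * (Q * i n) + i n * k"
      unfolding k_def using rate_nonneg close[OF s] C[OF s] onorm_pos_le[OF Bc_bounded_linear]
      by (intro add_mono mult_left_mono) (auto simp: i_def)
    finally show "norm (Gop N (v n s) (x n s) - Gop N (u s) (z s)) \<le> rate N * (Q * i n) + i n * k" .
  qed
  moreover have "z 0 = y" unfolding z_def by (simp add: x0)
  ultimately show ?thesis unfolding galerkin_solution_iff by blast
qed

lemma galerkin_propagator_eq:
  assumes u: "u \<in> controls \<delta> a" and t: "0 \<le> t" and x: "solution N u t x" "x 0 = y"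
  shows "galerkin_propagator \<phi> N A B u t 0 y = x t"
  unfolding galerkin_propagator_def
proof (rule the_equality)
  show "\<exists>z. solution N u t z \<and> z 0 = y \<and> z t = x t" using x by blast
  fix w assume "\<exists>z. solution N u t z \<and> z 0 = y \<and> z t = w"
  then obtain z where z: "solution N u t z" "z 0 = y" "z t = w" by blast
  have "z t = x t" by (rule solution_unique[OF u z(1) x(1)]) (simp_all add: x(2) z(2) t)
  then show "w = x t" using z(3) by simp
qed

lemma galerkin_propagator_pc:
  assumes "u \<in> controls \<delta> a" and "pc_steps u t xs" and "P N y = y"
  shows "galerkin_propagator \<phi> N A B u t 0 y = X N xs y"
proof -
  obtain x where x: "solution N u t x" "x 0 = y" "x t = X N xs y"
    using pc_solution_exists[OF assms(2,3)] by blast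
  show ?thesis
    using galerkin_propagator_eq[OF assms(1) pc_steps_nonneg[OF assms(2)] x(1,2)] x(3) by simp
qed

lemma galerkin_propagator_tendsto:
  assumes u: "u \<in> controls \<delta> a" and v: "\<And>n. v n \<in> controls \<delta> a"
    and lim: "\<And>s. (\<lambda>n. v n s) \<longlonglongrightarrow> u s" and t: "0 \<le> t" and y: "P N y = y"
  shows "(\<lambda>n. galerkin_propagator \<phi> N A B (v n) t 0 y) \<longlonglongrightarrow> galerkin_propagator \<phi> N A B u t 0 y"
proof -
  obtain x where x: "solution N u t x" "x 0 = y" using solution_exists[OF u t y] by blast
  have "\<exists>x. solution N (v n) t x \<and> x 0 = y" for n using solution_exists[OF v t y] by blast
  then obtain z where z: "\<And>n. solution N (v n) t (z n)" "\<And>n. z n 0 = y" by metis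
  define C where "C = norm y * exp (rate N * t)"
  have C: "norm (x r) \<le> C" if "r \<in> {0..t}" for r
    using solution_norm_le[OF u x(1) that] by (simp add: x C_def)
  have "(\<lambda>n. z n t - x t) \<longlonglongrightarrow> 0"
  proof (rule Lim_null_comparison)
    show "\<forall>\<^sub>F n in sequentially. norm (z n t - x t)
        \<le> onorm (Bc N) * C * integral {0..t} (\<lambda>s. \<bar>v n s - u s\<bar>) * exp (rate N * t)"
      using solution_stability[OF v u z(1) x(1) C, of t] t by (intro always_eventually) (simp add: z x)
    have "(\<lambda>n. onorm (Bc N) * C * integral {0..t} (\<lambda>s. \<bar>v n s - u s\<bar>) * exp (rate N * t))
        \<longlonglongrightarrow> onorm (Bc N) * C * 0 * exp (rate N * t)"
      by (intro tendsto_intros controls_L1_convergence[OF u v lim])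
    then show "(\<lambda>n. onorm (Bc N) * C * integral {0..t} (\<lambda>s. \<bar>v n s - u s\<bar>) * exp (rate N * t)) \<longlonglongrightarrow> 0"
      by simp
  qed
  then have "(\<lambda>n. z n t) \<longlonglongrightarrow> x t" by (simp add: LIM_zero_iff)
  moreover have "galerkin_propagator \<phi> N A B u t 0 y = x t"
    by (rule galerkin_propagator_eq[OF u t x])
  moreover have "galerkin_propagator \<phi> N A B (v n) t 0 y = z n t" for n
    by (rule galerkin_propagator_eq[OF v t z])
  ultimately show ?thesis by simp
qed

end

section \<open>Convergence of the Galerkin approximations\<close>

lemma integral_abs_le_LINT:
  fixes u :: "real \<Rightarrow> real"
  assumes "integrable lborel u"
  shows "integral {x..y} (\<lambda>s. \<bar>u s\<bar>) \<le> (LINT s|lborel. \<bar>u s\<bar>)"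
proof -
  have abs: "integrable lborel (\<lambda>s. \<bar>u s\<bar>)" using assms by (rule integrable_abs)
  then have set: "set_integrable lborel {x..y} (\<lambda>s. \<bar>u s\<bar>)"
    unfolding set_integrable_def by (intro integrable_mult_indicator) auto
  have "integral {x..y} (\<lambda>s. \<bar>u s\<bar>) = (LINT s|lborel. indicator {x..y} s *\<^sub>R \<bar>u s\<bar>)"
    using set_borel_integral_eq_integral(2)[OF set] unfolding set_lebesgue_integral_def by simp
  also have "\<dots> \<le> (LINT s|lborel. \<bar>u s\<bar>)"
    using abs set unfolding set_integrable_def by (intro integral_mono) (auto simp: indicator_def)
  finally show ?thesis .
qed

context bounded_control_setting
begin

lemma pc_galerkin_error:
  assumes u: "u \<in> controls \<delta> a" "piecewise_constant u" and t: "0 \<le> t" and x: "x \<in> DA"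
    and TV: "total_variation {0..t} u \<le> ennreal K" and K: "0 \<le> K"
    and good: "good_order N \<eta>" and \<eta>: "0 \<le> \<eta>"
  shows "norm (pc_propagator DA A B u t x - galerkin_propagator \<phi> N A B u t 0 (P N x))
    \<le> norm (x - P N x) + \<eta> * growth K x * integral {0..t} (\<lambda>s. \<bar>u s\<bar>)"
proof -
  obtain xs where xs: "pc_steps u t xs" "pc_propagator DA A B u t = W xs"
    using pc_propagator_eq_W[OF u t] by blast
  have "galerkin_propagator \<phi> N A B u t 0 (P N x) = X N xs (P N x)"
    by (rule galerkin_propagator_pc[OF u(1) xs(1)]) simp
  then show ?thesis
    using pc_propagator_galerkin_error[OF u t x TV K good \<eta> xs(1)] xs(2) by simp
qed

lemma controls_abs_integrable: "u \<in> controls \<delta> a \<Longrightarrow> (\<lambda>s. \<bar>u s\<bar>) integrable_on {x..y}"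
  using controls_measurable controls_abs_le
  by (intro bounded_borel_integrable_on[of _ "(1 - \<delta>) / a"]) auto

text \<open>For a fixed time the integral of \<open>\<bar>u\<bar>\<close> is bounded for all controls, so one order serves all of
  them. This uniformity is what allows limits in the order and in the control to be exchanged.\<close>

lemma pc_galerkin_error_uniform:
  assumes t: "0 \<le> t" and x: "x \<in> DA" and K: "0 \<le> K" and e: "e > 0"
  shows "\<forall>\<^sub>F N in sequentially. \<forall>u\<in>controls \<delta> a. piecewise_constant u \<longrightarrow>
    total_variation {0..t} u \<le> ennreal K \<longrightarrow>
    norm (pc_propagator DA A B u t x - galerkin_propagator \<phi> N A B u t 0 (P N x)) < e"
proof -
  define m where "m = t * ((1 - \<delta>) / a)"
  have m: "0 \<le> m" unfolding m_def using t \<delta>_less a_pos by simp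
  obtain \<eta> where \<eta>: "\<eta> > 0" and \<eta>m: "\<eta> * (growth K x * m) < e / 2"
    using small_factor[of "growth K x * m" "e / 2"] growth_nonneg m e by auto
  have "\<forall>\<^sub>F N in sequentially. dist (P N x) x < e / 2"
    using tendstoD[OF proj_tendsto, of "e / 2" x] e by simp
  with good_order_eventually[OF \<eta>] show ?thesis
  proof eventually_elim
    case (elim N)
    show ?case
    proof (intro ballI impI)
      fix u assume u: "u \<in> controls \<delta> a" "piecewise_constant u"
        and TV: "total_variation {0..t} u \<le> ennreal K"
      have "integral {0..t} (\<lambda>s. \<bar>u s\<bar>) \<le> integral {0..t} (\<lambda>s. (1 - \<delta>) / a)"
        by (intro integral_le controls_abs_integrable u controls_abs_le integrable_const_ivl)
      also have "\<dots> = m" using t by (simp add: m_def)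
      finally have "\<eta> * growth K x * integral {0..t} (\<lambda>s. \<bar>u s\<bar>) \<le> \<eta> * growth K x * m"
        using \<eta> growth_nonneg by (intro mult_left_mono) auto
      then show "norm (pc_propagator DA A B u t x - galerkin_propagator \<phi> N A B u t 0 (P N x)) < e"
        using pc_galerkin_error[OF u t x TV K elim(1) less_imp_le[OF \<eta>]] elim(2) \<eta>m
        by (simp add: dist_norm norm_minus_commute mult.assoc)
    qed
  qed
qed

lemma pc_approximation_exists:
  assumes u: "u \<in> controls \<delta> a" and T: "0 \<le> T"
  shows "\<exists>v. pc_approximation \<delta> a T u v"
proof -
  have "\<exists>v\<in>controls \<delta> a. piecewise_constant v \<and> total_variation {0..T} v \<le> total_variation {0..T} u \<and>
      (\<forall>s. \<bar>v s - u s\<bar> \<le> inverse (real (Suc n)))" for n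
    using controls_uniform_approximation[OF u T, of "inverse (real (Suc n))"] by simp
  then obtain v where v: "\<And>n. v n \<in> controls \<delta> a \<and> piecewise_constant (v n) \<and>
      total_variation {0..T} (v n) \<le> total_variation {0..T} u"
    and close: "\<And>n s. \<bar>v n s - u s\<bar> \<le> inverse (real (Suc n))" by metis
  have "(\<lambda>n. v n s) \<longlonglongrightarrow> u s" for s
  proof -
    have "(\<lambda>n. v n s - u s) \<longlonglongrightarrow> 0"
      by (rule Lim_null_comparison[OF _ LIMSEQ_inverse_real_of_nat])
        (use close in \<open>auto intro: always_eventually\<close>)
    then show ?thesis by (simp add: LIM_zero_iff)
  qed
  then show ?thesis using v unfolding pc_approximation_def by blast
qed

context
  fixes u :: "real \<Rightarrow> real" and t :: real and x :: 'a
  assumes u: "u \<in> controls \<delta> a" and t: "0 \<le> t" and x: "x \<in> DA"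
begin

abbreviation "galerkin v N \<equiv> galerkin_propagator \<phi> N A B v t 0 (P N x)"

lemma pc_approximation_variation:
  assumes "pc_approximation \<delta> a T u v" and "t \<le> T" and "total_variation UNIV u \<le> ennreal K"
  shows "total_variation {0..t} (v n) \<le> ennreal K"
proof -
  have "total_variation {0..t} (v n) \<le> total_variation {0..T} (v n)"
    using assms(2) by (intro total_variation_subset) auto
  also have "\<dots> \<le> total_variation {0..T} u"
    using assms(1) unfolding pc_approximation_def by blast
  also have "\<dots> \<le> total_variation UNIV u"
    by (rule total_variation_subset) simp
  finally show ?thesis using assms(3) by simp
qed

lemma finite_variation_bound: "\<exists>K\<ge>0. total_variation UNIV u \<le> ennreal K"
  using u unfolding controls_def
  by (intro exI[of _ "enn2real (total_variation UNIV u)"]) (simp add: less_top)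

lemma galerkin_tendsto:
  assumes "pc_approximation \<delta> a T u v"
  shows "(\<lambda>n. galerkin (v n) N) \<longlonglongrightarrow> galerkin u N"
  using assms unfolding pc_approximation_def
  by (intro galerkin_propagator_tendsto u t) auto

text \<open>Along an approximating sequence of piecewise constant controls, Galerkin solutions of two large
  orders are both close to the same exact solution, uniformly along the sequence; pass to the limit
  in the control.\<close>

lemma galerkin_convergent: "convergent (galerkin u)"
proof (rule Cauchy_convergent, rule metric_CauchyI)
  fix e :: real assume e: "e > 0"
  obtain K where K: "0 \<le> K" "total_variation UNIV u \<le> ennreal K" using finite_variation_bound by blast
  obtain v where v: "pc_approximation \<delta> a t u v" using pc_approximation_exists[OF u t] by blast
  obtain N0 where N0: "\<And>N w. N \<ge> N0 \<Longrightarrow> w \<in> controls \<delta> a \<Longrightarrow> piecewise_constant w \<Longrightarrow>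
      total_variation {0..t} w \<le> ennreal K \<Longrightarrow> norm (pc_propagator DA A B w t x - galerkin w N) < e / 4"
    using pc_galerkin_error_uniform[OF t x K(1), of "e / 4"] e unfolding eventually_sequentially by auto
  have "dist (galerkin u M) (galerkin u N) < e" if "M \<ge> N0" "N \<ge> N0" for M N
  proof -
    have "norm (galerkin (v n) M - galerkin (v n) N) \<le> e / 2" for n
    proof -
      have 1: "norm (pc_propagator DA A B (v n) t x - galerkin (v n) L) < e / 4" if "L \<ge> N0" for L
        using N0[OF that] v pc_approximation_variation[OF v _ K(2)] unfolding pc_approximation_def by auto
      have "norm (galerkin (v n) M - galerkin (v n) N)
          \<le> norm (pc_propagator DA A B (v n) t x - galerkin (v n) N)
            + norm (pc_propagator DA A B (v n) t x - galerkin (v n) M)"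
        using norm_triangle_ineq4[of "pc_propagator DA A B (v n) t x - galerkin (v n) N"
            "pc_propagator DA A B (v n) t x - galerkin (v n) M"] by simp
      then show ?thesis using 1[OF that(1)] 1[OF that(2)] by simp
    qed
    then have "norm (galerkin u M - galerkin u N) \<le> e / 2"
      by (intro LIMSEQ_le_const2[OF tendsto_norm[OF tendsto_diff[OF galerkin_tendsto[OF v] galerkin_tendsto[OF v]]]])
        auto
    then show ?thesis using e by (simp add: dist_norm)
  qed
  then show "\<exists>N0. \<forall>M\<ge>N0. \<forall>N\<ge>N0. dist (galerkin u M) (galerkin u N) < e" by blast
qed

text \<open>The limit does not depend on the approximating sequence, since it is expressed through \<open>u\<close> alone.\<close>

lemma pc_propagator_tendsto:
  assumes v: "pc_approximation \<delta> a T u v" and T: "t \<le> T"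
  shows "(\<lambda>n. pc_propagator DA A B (v n) t x) \<longlonglongrightarrow> lim (galerkin u)"
proof (rule LIMSEQ_I)
  fix e :: real assume e: "e > 0"
  obtain K where K: "0 \<le> K" "total_variation UNIV u \<le> ennreal K" using finite_variation_bound by blast
  have "galerkin u \<longlonglongrightarrow> lim (galerkin u)" using galerkin_convergent convergent_LIMSEQ_iff by blast
  from tendstoD[OF this, of "e / 3"] e
  have "\<forall>\<^sub>F N in sequentially. dist (galerkin u N) (lim (galerkin u)) < e / 3" by simp
  with pc_galerkin_error_uniform[OF t x K(1), of "e / 3"] e
  have "\<forall>\<^sub>F N in sequentially. dist (galerkin u N) (lim (galerkin u)) < e / 3 \<and>
      (\<forall>w\<in>controls \<delta> a. piecewise_constant w \<longrightarrow> total_variation {0..t} w \<le> ennreal K \<longrightarrow>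
        norm (pc_propagator DA A B w t x - galerkin w N) < e / 3)"
    by (auto intro: eventually_conj)
  then obtain N where N: "dist (galerkin u N) (lim (galerkin u)) < e / 3"
    "\<forall>w\<in>controls \<delta> a. piecewise_constant w \<longrightarrow> total_variation {0..t} w \<le> ennreal K \<longrightarrow>
        norm (pc_propagator DA A B w t x - galerkin w N) < e / 3"
    using eventually_happens by force
  from tendstoD[OF galerkin_tendsto[OF v, of N], of "e / 3"] e
  obtain n0 where n0: "\<And>n. n \<ge> n0 \<Longrightarrow> dist (galerkin (v n) N) (galerkin u N) < e / 3"
    unfolding eventually_sequentially by auto
  have "norm (pc_propagator DA A B (v n) t x - lim (galerkin u)) < e" if "n \<ge> n0" for n
  proof -
    have "norm (pc_propagator DA A B (v n) t x - galerkin (v n) N) < e / 3"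
      using N(2) v pc_approximation_variation[OF v T K(2)] unfolding pc_approximation_def by blast
    moreover have "norm (pc_propagator DA A B (v n) t x - lim (galerkin u))
        \<le> norm (pc_propagator DA A B (v n) t x - galerkin (v n) N)
          + norm (galerkin (v n) N - galerkin u N) + norm (lim (galerkin u) - galerkin u N)"
      using norm_add_diff_le[of "pc_propagator DA A B (v n) t x - galerkin (v n) N"
          "galerkin (v n) N - galerkin u N" "lim (galerkin u) - galerkin u N"] by simp
    ultimately show ?thesis using n0[OF that] N(1) by (simp add: dist_norm norm_minus_commute)
  qed
  then show "\<exists>n0. \<forall>n\<ge>n0. norm (pc_propagator DA A B (v n) t x - lim (galerkin u)) < e" by blast
qed

lemma propagator_eq_lim: "propagator \<delta> a DA A B u t x = lim (galerkin u)"
  unfolding propagator_def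
proof (rule the_equality)
  show "\<forall>T\<ge>t. \<forall>v. pc_approximation \<delta> a T u v \<longrightarrow>
      (\<lambda>n. pc_propagator DA A B (v n) t x) \<longlonglongrightarrow> lim (galerkin u)"
    using pc_propagator_tendsto by blast
  fix l assume l: "\<forall>T\<ge>t. \<forall>v. pc_approximation \<delta> a T u v \<longrightarrow> (\<lambda>n. pc_propagator DA A B (v n) t x) \<longlonglongrightarrow> l"
  obtain v where v: "pc_approximation \<delta> a t u v" using pc_approximation_exists[OF u t] by blast
  then show "l = lim (galerkin u)"
    using l pc_propagator_tendsto[OF v] LIMSEQ_unique by blast
qed

text \<open>The limit of \<open>pc_galerkin_error\<close> along an approximating sequence. The \<open>L\<^sup>1\<close> norm of \<open>u\<close> survives
  because the approximation also converges in \<open>L\<^sup>1\<close>.\<close>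

lemma propagator_galerkin_error:
  assumes TV: "total_variation UNIV u \<le> ennreal K" and K: "0 \<le> K"
    and good: "good_order N \<eta>" and \<eta>: "0 \<le> \<eta>"
  shows "norm (propagator \<delta> a DA A B u t x - galerkin u N)
    \<le> norm (x - P N x) + \<eta> * growth K x * integral {0..t} (\<lambda>s. \<bar>u s\<bar>)"
proof -
  obtain v where v: "pc_approximation \<delta> a t u v" using pc_approximation_exists[OF u t] by blast
  then have vc: "v n \<in> controls \<delta> a" "piecewise_constant (v n)" and vlim: "(\<lambda>n. v n s) \<longlonglongrightarrow> u s" for n s
    unfolding pc_approximation_def by auto
  define J where "J n = integral {0..t} (\<lambda>s. \<bar>u s\<bar>) + integral {0..t} (\<lambda>s. \<bar>v n s - u s\<bar>)" for n
  have J: "integral {0..t} (\<lambda>s. \<bar>v n s\<bar>) \<le> J n" for n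
  proof -
    note int = controls_abs_integrable[OF u, of 0 t] controls_abs_integrable[OF vc(1), of n 0 t]
      controls_abs_diff_integrable[OF vc(1) u, of n 0 t]
    have "integral {0..t} (\<lambda>s. \<bar>v n s\<bar>) \<le> integral {0..t} (\<lambda>s. \<bar>u s\<bar> + \<bar>v n s - u s\<bar>)"
      by (rule integral_le[OF int(2) integrable_add[OF int(1,3)]]) auto
    also have "\<dots> = J n"
      unfolding J_def by (rule integral_add[OF int(1,3)])
    finally show ?thesis .
  qed
  show ?thesis
    unfolding propagator_eq_lim
  proof (rule LIMSEQ_le)
    show "(\<lambda>n. norm (pc_propagator DA A B (v n) t x - galerkin (v n) N)) \<longlonglongrightarrow> norm (lim (galerkin u) - galerkin u N)"
      by (intro tendsto_norm tendsto_diff pc_propagator_tendsto[OF v] galerkin_tendsto[OF v]) simp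
    have "J \<longlonglongrightarrow> integral {0..t} (\<lambda>s. \<bar>u s\<bar>) + 0"
      unfolding J_def by (intro tendsto_intros controls_L1_convergence[OF u vc(1) vlim])
    then show "(\<lambda>n. norm (x - P N x) + \<eta> * growth K x * J n)
        \<longlonglongrightarrow> norm (x - P N x) + \<eta> * growth K x * integral {0..t} (\<lambda>s. \<bar>u s\<bar>)"
      by (intro tendsto_intros) simp
    have "norm (pc_propagator DA A B (v n) t x - galerkin (v n) N)
        \<le> norm (x - P N x) + \<eta> * growth K x * J n" for n
    proof -
      have "norm (pc_propagator DA A B (v n) t x - galerkin (v n) N)
          \<le> norm (x - P N x) + \<eta> * growth K x * integral {0..t} (\<lambda>s. \<bar>v n s\<bar>)"
        using pc_approximation_variation[OF v order_refl TV] by (intro pc_galerkin_error vc t x K good \<eta>)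
      also have "\<dots> \<le> norm (x - P N x) + \<eta> * growth K x * J n"
        using J[of n] \<eta> growth_nonneg by (intro add_left_mono mult_left_mono) auto
      finally show ?thesis .
    qed
    then show "\<exists>n0. \<forall>n\<ge>n0. norm (pc_propagator DA A B (v n) t x - galerkin (v n) N)
        \<le> norm (x - P N x) + \<eta> * growth K x * J n" by blast
  qed
qed

end

text \<open>Time enters the error only through the integral of \<open>\<bar>u\<bar>\<close> over \<open>[0, t]\<close>, which is at most \<open>K\<close>.\<close>

lemma galerkin_approximation_uniform:
  assumes x: "x \<in> DA" and K: "0 \<le> K" and e: "e > 0"
  shows "\<forall>\<^sub>F N in sequentially. \<forall>u\<in>controls \<delta> a. integrable lborel u \<longrightarrow>
    ennreal (LINT s|lborel. \<bar>u s\<bar>) + total_variation UNIV u < ennreal K \<longrightarrow>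
    (\<forall>t\<ge>0. norm (propagator \<delta> a DA A B u t x - galerkin_propagator \<phi> N A B u t 0 (P N x)) < e)"
proof -
  obtain \<eta> where \<eta>: "\<eta> > 0" and \<eta>K: "\<eta> * (growth K x * K) < e / 2"
    using small_factor[of "growth K x * K" "e / 2"] growth_nonneg K e by auto
  have "\<forall>\<^sub>F N in sequentially. dist (P N x) x < e / 2"
    using tendstoD[OF proj_tendsto, of "e / 2" x] e by simp
  with good_order_eventually[OF \<eta>] show ?thesis
  proof eventually_elim
    case (elim N)
    show ?case
    proof (intro ballI impI allI)
      fix u t assume u: "u \<in> controls \<delta> a" and int: "integrable lborel u" and t: "(0::real) \<le> t"
        and small: "ennreal (LINT s|lborel. \<bar>u s\<bar>) + total_variation UNIV u < ennreal K"
      have "ennreal (LINT s|lborel. \<bar>u s\<bar>) \<le> ennreal (LINT s|lborel. \<bar>u s\<bar>) + total_variation UNIV u"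
        by simp
      then have "ennreal (LINT s|lborel. \<bar>u s\<bar>) \<le> ennreal K"
        using less_imp_le[OF small] by (rule order_trans)
      then have "(LINT s|lborel. \<bar>u s\<bar>) \<le> K" using K by (simp add: ennreal_le_iff)
      then have L1: "integral {0..t} (\<lambda>s. \<bar>u s\<bar>) \<le> K" using integral_abs_le_LINT[OF int, of 0 t] by simp
      have "total_variation UNIV u \<le> ennreal (LINT s|lborel. \<bar>u s\<bar>) + total_variation UNIV u"
        by simp
      then have TV: "total_variation UNIV u \<le> ennreal K"
        using less_imp_le[OF small] by (rule order_trans)
      have "\<eta> * growth K x * integral {0..t} (\<lambda>s. \<bar>u s\<bar>) \<le> \<eta> * growth K x * K"
        using L1 \<eta> growth_nonneg by (intro mult_left_mono) auto
      then show "norm (propagator \<delta> a DA A B u t x - galerkin_propagator \<phi> N A B u t 0 (P N x)) < e"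
        using propagator_galerkin_error[OF u t x TV K elim(1) less_imp_le[OF \<eta>]] elim(2) \<eta>K
        by (simp add: dist_norm norm_minus_commute mult.assoc)
    qed
  qed
qed

end

theorem proposition10:
  fixes A B :: "'a::complex_hilbert_space \<Rightarrow> 'a"
    and DA DB :: "'a set"
    and a b d \<alpha> \<delta> :: real
    and \<phi> :: "nat \<Rightarrow> 'a"
    and lam :: "nat \<Rightarrow> real"
  assumes "separable_space (euclidean :: 'a topology)"
    and "a > 0" and "b \<ge> 0" and "d \<ge> 0" and "0 \<le> \<alpha>" and "\<alpha> < 1"
    and "skew_adjoint DA A"
    and "bounded_from_below DA (\<lambda>x. \<i> *\<^sub>C A x)"
    and "skew_symmetric DB B"
    and "DA \<subseteq> DB"
    and "\<forall>\<psi>\<in>DA. norm (B \<psi>) \<le> a * norm (A \<psi>) + b * norm \<psi>"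
    and "abs_pow_dom \<phi> lam \<alpha> \<subseteq> DB"
    and "\<forall>\<psi>\<in>abs_pow_dom \<phi> lam \<alpha>. norm (B \<psi>) \<le> d * norm (abs_pow \<phi> lam \<alpha> \<psi>)"
    and "hilbert_basis \<phi>"
    and "op_spectrum DA A = range (\<lambda>j. - \<i> * complex_of_real (lam j))"
    and "filterlim lam at_top sequentially"
    and "\<forall>j. \<phi> j \<in> DA \<and> A (\<phi> j) = (- \<i> * complex_of_real (lam j)) *\<^sub>C \<phi> j"
    and "0 < \<delta>" and "\<delta> < 1"
  shows "\<forall>\<epsilon>>0. \<forall>K\<ge>0. \<forall>n::nat. \<forall>\<psi> :: nat \<Rightarrow> 'a.
    (\<forall>j\<in>{1..n}. \<psi> j \<in> abs_pow_dom \<phi> lam 1) \<longrightarrow>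
    (\<exists>N::nat. \<forall>u\<in>controls \<delta> a. integrable lborel u \<longrightarrow>
       ennreal (LINT x|lborel. \<bar>u x\<bar>) + total_variation UNIV u < ennreal K \<longrightarrow>
       (\<forall>t\<ge>0. \<forall>j\<in>{1..n}.
          norm (propagator \<delta> a DA A B u t (\<psi> j)
                - galerkin_propagator \<phi> N A B u t 0 (galerkin_proj \<phi> N (\<psi> j))) < \<epsilon>))"
proof (intro allI impI)
  interpret bounded_control_setting \<phi> A B DA DB a b d \<alpha> lam \<delta>
    using assms by unfold_locales auto
  fix \<epsilon> K :: real and n :: nat and \<psi> :: "nat \<Rightarrow> 'a"
  assume \<epsilon>: "\<epsilon> > 0" and K: "K \<ge> 0" and \<psi>: "\<forall>j\<in>{1..n}. \<psi> j \<in> abs_pow_dom \<phi> lam 1"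
  have "\<forall>\<^sub>F N in sequentially. \<forall>j\<in>{1..n}. \<forall>u\<in>controls \<delta> a. integrable lborel u \<longrightarrow>
      ennreal (LINT s|lborel. \<bar>u s\<bar>) + total_variation UNIV u < ennreal K \<longrightarrow>
      (\<forall>t\<ge>0. norm (propagator \<delta> a DA A B u t (\<psi> j)
        - galerkin_propagator \<phi> N A B u t 0 (P N (\<psi> j))) < \<epsilon>)"
    using \<psi> abs_pow_dom_1_subset K \<epsilon>
    by (intro eventually_ball_finite ballI galerkin_approximation_uniform) auto
  then obtain N where "\<forall>j\<in>{1..n}. \<forall>u\<in>controls \<delta> a. integrable lborel u \<longrightarrow>
      ennreal (LINT s|lborel. \<bar>u s\<bar>) + total_variation UNIV u < ennreal K \<longrightarrow>
      (\<forall>t\<ge>0. norm (propagator \<delta> a DA A B u t (\<psi> j)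
        - galerkin_propagator \<phi> N A B u t 0 (P N (\<psi> j))) < \<epsilon>)"
    using eventually_happens by force
  then show "\<exists>N. \<forall>u\<in>controls \<delta> a. integrable lborel u \<longrightarrow>
       ennreal (LINT x|lborel. \<bar>u x\<bar>) + total_variation UNIV u < ennreal K \<longrightarrow>
       (\<forall>t\<ge>0. \<forall>j\<in>{1..n}. norm (propagator \<delta> a DA A B u t (\<psi> j)
          - galerkin_propagator \<phi> N A B u t 0 (P N (\<psi> j))) < \<epsilon>)"
    by blast
qed

end
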